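(* Let $\mathcal{E}$ be a lextensive and cartesian closed category, and let $\mathbf{2}_{\mathcal{E}}$ be the internal free-living arrow in $\mathcal{E}$. (1) For $\mathbb{B}\in\mathbf{Cat}(\mathcal{E})$, the internal hom $[\mathbf{2}_{\mathcal{E}},\mathbb{B}]$ has the universal property of the power of $\mathbb{B}$ by $\mathbf{2}$ in $\mathbf{Cat}(\mathcal{E})$. (2) For $\mathbb{A}\in\mathbf{Cat}(\mathcal{E})$, the internal category $\mathbf{2}_{\mathcal{E}}\times\mathbb{A}$ has the universal property of the copower of $\mathbb{A}$ by $\mathbf{2}$ in $\mathbf{Cat}(\mathcal{E})$.
   Context: A category with pullbacks is extensive if it has finite coproducts and for all $A,B$ the functor $\mathcal{E}/A\times\mathcal{E}/B\to\mathcal{E}/(A+B)$ taking coproducts is an equivalence; it is lextensive if moreover it has a terminal object. $\mathbf{Cat}(\mathcal{E})$ is the $2$-category of categories, functors and natural transformations internal to $\mathcal{E}$; it is cartesian closed when $\mathcal{E}$ has finite limits and is cartesian closed, with internal hom written $[-,-]$. $\mathbf{2}=\{\bullet\to\bullet\}$ is the free-living arrow category. For lextensive $\mathcal{E}$, the essentially unique functor $F_{\mathcal{E}}:\mathbf{FinSet}\to\mathcal{E}$ preserving finite coproducts and the terminal object preserves all finite limits, hence induces a $2$-functor $\mathbf{Cat}(F_{\mathcal{E}}):\mathbf{Cat}(\mathbf{FinSet})\to\mathbf{Cat}(\mathcal{E})$ acting componentwise; $\mathbf{2}_{\mathcal{E}}:=\mathbf{Cat}(F_{\mathcal{E}})(\mathbf{2})$.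 (Its object of objects is $\mathbf 1+\mathbf 1$ and its object of arrows is $\mathbf 1+\mathbf 1+\mathbf 1$.) In a $2$-category $\mathcal{K}$, the power of $B$ by $\mathbf{2}$ is an object $B^{\mathbf 2}$ with isomorphisms of categories $\mathcal{K}(A,B^{\mathbf 2})\cong\mathbf{Cat}(\mathbf{2},\mathcal{K}(A,B))$, $2$-natural in $A$; the copower of $A$ by $\mathbf{2}$ is an object $\mathbf{2}\odot A$ with isomorphisms $\mathcal{K}(\mathbf{2}\odot A,B)\cong\mathbf{Cat}(\mathbf{2},\mathcal{K}(A,B))$, $2$-natural in $B$. *)

theory Defs
  imports Main "HOL-Library.FuncSet"
begin

section \<open>Categories and functors\<close>

record ('o, 'm) cat =
  Obj :: "'o set"
  Arr :: "'m set"
  Dom :: "'m \<Rightarrow> 'o"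
  Cod :: "'m \<Rightarrow> 'o"
  Ident :: "'o \<Rightarrow> 'm"
  Comp :: "'m \<Rightarrow> 'm \<Rightarrow> 'm"  (infixr "\<cdot>\<index>" 70)

definition hom :: "('o, 'm, 'z) cat_scheme \<Rightarrow> 'o \<Rightarrow> 'o \<Rightarrow> 'm set" where
  "hom C A B = {f \<in> Arr C. Dom C f = A \<and> Cod C f = B}"

locale category =
  fixes C :: "('o, 'm, 'z) cat_scheme" (structure)
  assumes Dom_in_Obj: "f \<in> Arr C \<Longrightarrow> Dom C f \<in> Obj C"
    and Cod_in_Obj: "f \<in> Arr C \<Longrightarrow> Cod C f \<in> Obj C"
    and Ident_in_hom: "A \<in> Obj C \<Longrightarrow> Ident C A \<in> hom C A A"
    and Comp_in_hom: "\<lbrakk>f \<in> hom C A B; g \<in> hom C B D\<rbrakk> \<Longrightarrow> g \<cdot> f \<in> hom C A D"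
    and Comp_Ident: "f \<in> hom C A B \<Longrightarrow> f \<cdot> Ident C A = f"
    and Ident_Comp: "f \<in> hom C A B \<Longrightarrow> Ident C B \<cdot> f = f"
    and Comp_assoc:
      "\<lbrakk>f \<in> hom C A B; g \<in> hom C B D; h \<in> hom C D D'\<rbrakk> \<Longrightarrow> (h \<cdot> g) \<cdot> f = h \<cdot> (g \<cdot> f)"

definition is_iso :: "('o, 'm, 'z) cat_scheme \<Rightarrow> 'm \<Rightarrow> bool" where
  "is_iso C f \<longleftrightarrow> f \<in> Arr C \<and>
     (\<exists>g \<in> hom C (Cod C f) (Dom C f).
        g \<cdot>\<^bsub>C\<^esub> f = Ident C (Dom C f) \<and> f \<cdot>\<^bsub>C\<^esub> g = Ident C (Cod C f))"

record ('o, 'm, 'p, 'n) funct =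
  fobj :: "'o \<Rightarrow> 'p"
  farr :: "'m \<Rightarrow> 'n"

definition is_functor ::
  "('o, 'm, 'y) cat_scheme \<Rightarrow> ('p, 'n, 'z) cat_scheme \<Rightarrow> ('o, 'm, 'p, 'n) funct \<Rightarrow> bool" where
  "is_functor C D F \<longleftrightarrow>
     (\<forall>A \<in> Obj C. fobj F A \<in> Obj D) \<and>
     (\<forall>f \<in> Arr C. farr F f \<in> hom D (fobj F (Dom C f)) (fobj F (Cod C f))) \<and>
     (\<forall>A \<in> Obj C. farr F (Ident C A) = Ident D (fobj F A)) \<and>
     (\<forall>f \<in> Arr C. \<forall>g \<in> Arr C. Cod C f = Dom C g \<longrightarrow>
        farr F (g \<cdot>\<^bsub>C\<^esub> f) = farr F g \<cdot>\<^bsub>D\<^esub> farr F f)"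

definition id_functor :: "('o, 'm, 'o, 'm) funct" where
  "id_functor = \<lparr>fobj = \<lambda>A. A, farr = \<lambda>f. f\<rparr>"

definition comp_functor ::
  "('p, 'n, 'q, 'k) funct \<Rightarrow> ('o, 'm, 'p, 'n) funct \<Rightarrow> ('o, 'm, 'q, 'k) funct" where
  "comp_functor G F = \<lparr>fobj = \<lambda>A. fobj G (fobj F A), farr = \<lambda>f. farr G (farr F f)\<rparr>"

definition is_nat_trans ::
  "('o, 'm, 'y) cat_scheme \<Rightarrow> ('p, 'n, 'z) cat_scheme \<Rightarrow>
   ('o, 'm, 'p, 'n) funct \<Rightarrow> ('o, 'm, 'p, 'n) funct \<Rightarrow> ('o \<Rightarrow> 'n) \<Rightarrow> bool" where
  "is_nat_trans C D F G \<tau> \<longleftrightarrow>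
     (\<forall>A \<in> Obj C. \<tau> A \<in> hom D (fobj F A) (fobj G A)) \<and>
     (\<forall>f \<in> Arr C. \<tau> (Cod C f) \<cdot>\<^bsub>D\<^esub> farr F f = farr G f \<cdot>\<^bsub>D\<^esub> \<tau> (Dom C f))"

definition is_nat_iso ::
  "('o, 'm, 'y) cat_scheme \<Rightarrow> ('p, 'n, 'z) cat_scheme \<Rightarrow>
   ('o, 'm, 'p, 'n) funct \<Rightarrow> ('o, 'm, 'p, 'n) funct \<Rightarrow> ('o \<Rightarrow> 'n) \<Rightarrow> bool" where
  "is_nat_iso C D F G \<tau> \<longleftrightarrow> is_nat_trans C D F G \<tau> \<and> (\<forall>A \<in> Obj C. is_iso D (\<tau> A))"

definition is_equivalence ::
  "('o, 'm, 'y) cat_scheme \<Rightarrow> ('p, 'n, 'z) cat_scheme \<Rightarrow> ('o, 'm, 'p, 'n) funct \<Rightarrow> bool" where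
  "is_equivalence C D F \<longleftrightarrow> is_functor C D F \<and>
     (\<exists>G \<eta> \<epsilon>. is_functor D C G \<and>
        is_nat_iso C C id_functor (comp_functor G F) \<eta> \<and>
        is_nat_iso D D (comp_functor F G) id_functor \<epsilon>)"

definition is_cat_iso ::
  "('o, 'm, 'y) cat_scheme \<Rightarrow> ('p, 'n, 'z) cat_scheme \<Rightarrow> ('o, 'm, 'p, 'n) funct \<Rightarrow> bool" where
  "is_cat_iso C D F \<longleftrightarrow> is_functor C D F \<and>
     (\<exists>G. is_functor D C G \<and>
        (\<forall>A \<in> Obj C. fobj G (fobj F A) = A) \<and> (\<forall>f \<in> Arr C. farr G (farr F f) = f) \<and>
        (\<forall>B \<in> Obj D. fobj F (fobj G B) = B) \<and> (\<forall>g \<in> Arr D. farr F (farr G g) = g))"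

definition prod_cat ::
  "('o, 'm, 'y) cat_scheme \<Rightarrow> ('p, 'n, 'z) cat_scheme \<Rightarrow> ('o \<times> 'p, 'm \<times> 'n) cat" where
  "prod_cat C D =
     \<lparr>Obj = Obj C \<times> Obj D, Arr = Arr C \<times> Arr D,
      Dom = (\<lambda>(f, g). (Dom C f, Dom D g)), Cod = (\<lambda>(f, g). (Cod C f, Cod D g)),
      Ident = (\<lambda>(A, B). (Ident C A, Ident D B)),
      Comp = (\<lambda>(f', g') (f, g). (f' \<cdot>\<^bsub>C\<^esub> f, g' \<cdot>\<^bsub>D\<^esub> g))\<rparr>"

text \<open>An arrow \<open>(f, g, h)\<close> of the slice is the arrow \<open>h\<close> regarded as a map from the object \<open>f\<close>
  over \<open>A\<close> to the object \<open>g\<close> over \<open>A\<close>.\<close>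

definition slice_cat :: "('o, 'm, 'z) cat_scheme \<Rightarrow> 'o \<Rightarrow> ('m, 'm \<times> 'm \<times> 'm) cat" where
  "slice_cat C A =
     \<lparr>Obj = {f \<in> Arr C. Cod C f = A},
      Arr = {(f, g, h). f \<in> Arr C \<and> g \<in> Arr C \<and> Cod C f = A \<and> Cod C g = A \<and>
                h \<in> hom C (Dom C f) (Dom C g) \<and> g \<cdot>\<^bsub>C\<^esub> h = f},
      Dom = (\<lambda>(f, g, h). f), Cod = (\<lambda>(f, g, h). g),
      Ident = (\<lambda>f. (f, f, Ident C (Dom C f))),
      Comp = (\<lambda>(f', g', h') (f, g, h). (f, g', h' \<cdot>\<^bsub>C\<^esub> h))\<rparr>"

text \<open>In the functor category the functors and the families of components are required to be
  extensional (\<open>undefined\<close> off the carriers), so that equality in HOL is equality of functors and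
  of natural transformations.\<close>

definition functor_cat ::
  "('o, 'm, 'y) cat_scheme \<Rightarrow> ('p, 'n, 'z) cat_scheme \<Rightarrow>
   (('o, 'm, 'p, 'n) funct,
    ('o, 'm, 'p, 'n) funct \<times> ('o, 'm, 'p, 'n) funct \<times> ('o \<Rightarrow> 'n)) cat" where
  "functor_cat C D =
     (let Fs = {F. is_functor C D F \<and> fobj F \<in> extensional (Obj C) \<and> farr F \<in> extensional (Arr C)}
      in \<lparr>Obj = Fs,
          Arr = {(F, G, \<tau>). F \<in> Fs \<and> G \<in> Fs \<and>
                   is_nat_trans C D F G \<tau> \<and> \<tau> \<in> extensional (Obj C)},
          Dom = (\<lambda>(F, G, \<tau>). F), Cod = (\<lambda>(F, G, \<tau>). G),
          Ident = (\<lambda>F. (F, F, \<lambda>A \<in> Obj C. Ident D (fobj F A))),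
          Comp = (\<lambda>(F', G', \<tau>') (F, G, \<tau>). (F, G', \<lambda>A \<in> Obj C. \<tau>' A \<cdot>\<^bsub>D\<^esub> \<tau> A))\<rparr>)"

text \<open>The functor \<open>P \<circ> \<hyphen>\<close> from \<open>functor_cat J D\<close> to \<open>functor_cat J D'\<close>.\<close>

definition functor_cat_map ::
  "('o, 'm, 'y) cat_scheme \<Rightarrow> ('p, 'n, 'q, 'k) funct \<Rightarrow>
   (('o, 'm, 'p, 'n) funct,
    ('o, 'm, 'p, 'n) funct \<times> ('o, 'm, 'p, 'n) funct \<times> ('o \<Rightarrow> 'n),
    ('o, 'm, 'q, 'k) funct,
    ('o, 'm, 'q, 'k) funct \<times> ('o, 'm, 'q, 'k) funct \<times> ('o \<Rightarrow> 'k)) funct" where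
  "functor_cat_map J P =
     (let on_obj = (\<lambda>X. \<lparr>fobj = \<lambda>j \<in> Obj J. fobj P (fobj X j), farr = \<lambda>f \<in> Arr J. farr P (farr X f)\<rparr>)
      in \<lparr>fobj = on_obj,
          farr = (\<lambda>(X, Y, \<tau>). (on_obj X, on_obj Y, \<lambda>j \<in> Obj J. farr P (\<tau> j)))\<rparr>)"

text \<open>The category \<open>\<bullet> \<rightarrow> \<bullet>\<close>, as the ordered set \<open>False \<le> True\<close>.\<close>

definition walking_arrow :: "(bool, bool \<times> bool) cat" where
  "walking_arrow =
     \<lparr>Obj = UNIV, Arr = {(i, j). i \<le> j}, Dom = fst, Cod = snd,
      Ident = (\<lambda>i. (i, i)), Comp = (\<lambda>g f. (fst f, snd g))\<rparr>"


section \<open>Limits, coproducts and exponentials\<close>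

definition is_terminal :: "('o, 'm, 'z) cat_scheme \<Rightarrow> 'o \<Rightarrow> bool" where
  "is_terminal C T \<longleftrightarrow> T \<in> Obj C \<and> (\<forall>A \<in> Obj C. \<exists>!f. f \<in> hom C A T)"

definition is_initial :: "('o, 'm, 'z) cat_scheme \<Rightarrow> 'o \<Rightarrow> bool" where
  "is_initial C I \<longleftrightarrow> I \<in> Obj C \<and> (\<forall>A \<in> Obj C. \<exists>!f. f \<in> hom C I A)"

definition is_product :: "('o, 'm, 'z) cat_scheme \<Rightarrow> 'o \<Rightarrow> 'o \<Rightarrow> 'o \<Rightarrow> 'm \<Rightarrow> 'm \<Rightarrow> bool" where
  "is_product C A B P p q \<longleftrightarrow>
     A \<in> Obj C \<and> B \<in> Obj C \<and> P \<in> Obj C \<and> p \<in> hom C P A \<and> q \<in> hom C P B \<and>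
     (\<forall>X \<in> Obj C. \<forall>f \<in> hom C X A. \<forall>g \<in> hom C X B.
        \<exists>!u. u \<in> hom C X P \<and> p \<cdot>\<^bsub>C\<^esub> u = f \<and> q \<cdot>\<^bsub>C\<^esub> u = g)"

definition is_coproduct :: "('o, 'm, 'z) cat_scheme \<Rightarrow> 'o \<Rightarrow> 'o \<Rightarrow> 'o \<Rightarrow> 'm \<Rightarrow> 'm \<Rightarrow> bool" where
  "is_coproduct C A B S i j \<longleftrightarrow>
     A \<in> Obj C \<and> B \<in> Obj C \<and> S \<in> Obj C \<and> i \<in> hom C A S \<and> j \<in> hom C B S \<and>
     (\<forall>X \<in> Obj C. \<forall>f \<in> hom C A X. \<forall>g \<in> hom C B X.
        \<exists>!u. u \<in> hom C S X \<and> u \<cdot>\<^bsub>C\<^esub> i = f \<and> u \<cdot>\<^bsub>C\<^esub> j = g)"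

definition is_pullback :: "('o, 'm, 'z) cat_scheme \<Rightarrow> 'm \<Rightarrow> 'm \<Rightarrow> 'o \<Rightarrow> 'm \<Rightarrow> 'm \<Rightarrow> bool" where
  "is_pullback C f g P p q \<longleftrightarrow>
     f \<in> Arr C \<and> g \<in> Arr C \<and> Cod C f = Cod C g \<and> P \<in> Obj C \<and>
     p \<in> hom C P (Dom C f) \<and> q \<in> hom C P (Dom C g) \<and> f \<cdot>\<^bsub>C\<^esub> p = g \<cdot>\<^bsub>C\<^esub> q \<and>
     (\<forall>X \<in> Obj C. \<forall>x \<in> hom C X (Dom C f). \<forall>y \<in> hom C X (Dom C g). f \<cdot>\<^bsub>C\<^esub> x = g \<cdot>\<^bsub>C\<^esub> y \<longrightarrow>
        (\<exists>!u. u \<in> hom C X P \<and> p \<cdot>\<^bsub>C\<^esub> u = x \<and> q \<cdot>\<^bsub>C\<^esub> u = y))"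

text \<open>The arrow \<open>\<langle>x, y\<rangle>\<close> into a product or pullback with projections \<open>p\<close> and \<open>q\<close>.\<close>

definition pairing :: "('o, 'm, 'z) cat_scheme \<Rightarrow> 'm \<Rightarrow> 'm \<Rightarrow> 'm \<Rightarrow> 'm \<Rightarrow> 'm" where
  "pairing C p q x y =
     (THE u. u \<in> hom C (Dom C x) (Dom C p) \<and> p \<cdot>\<^bsub>C\<^esub> u = x \<and> q \<cdot>\<^bsub>C\<^esub> u = y)"

definition has_terminal :: "('o, 'm, 'z) cat_scheme \<Rightarrow> bool" where
  "has_terminal C \<longleftrightarrow> (\<exists>T. is_terminal C T)"

definition has_products :: "('o, 'm, 'z) cat_scheme \<Rightarrow> bool" where
  "has_products C \<longleftrightarrow> (\<forall>A \<in> Obj C. \<forall>B \<in> Obj C. \<exists>P p q. is_product C A B P p q)"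

definition has_pullbacks :: "('o, 'm, 'z) cat_scheme \<Rightarrow> bool" where
  "has_pullbacks C \<longleftrightarrow>
     (\<forall>f \<in> Arr C. \<forall>g \<in> Arr C. Cod C f = Cod C g \<longrightarrow> (\<exists>P p q. is_pullback C f g P p q))"

definition has_finite_coproducts :: "('o, 'm, 'z) cat_scheme \<Rightarrow> bool" where
  "has_finite_coproducts C \<longleftrightarrow>
     (\<exists>I. is_initial C I) \<and> (\<forall>A \<in> Obj C. \<forall>B \<in> Obj C. \<exists>S i j. is_coproduct C A B S i j)"

text \<open>\<open>H\<close> is the internal hom \<open>[A, B]\<close>, with evaluation \<open>ev\<close> defined on the product \<open>P\<close> of \<open>H\<close>
  and \<open>A\<close> with projections \<open>p\<close> and \<open>q\<close>.\<close>

definition is_exponential ::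
  "('o, 'm, 'z) cat_scheme \<Rightarrow> 'o \<Rightarrow> 'o \<Rightarrow> 'o \<Rightarrow> 'o \<Rightarrow> 'm \<Rightarrow> 'm \<Rightarrow> 'm \<Rightarrow> bool" where
  "is_exponential C A B H P p q ev \<longleftrightarrow>
     is_product C H A P p q \<and> B \<in> Obj C \<and> ev \<in> hom C P B \<and>
     (\<forall>X Q r s. is_product C X A Q r s \<longrightarrow>
        (\<forall>f \<in> hom C Q B. \<exists>!g. g \<in> hom C X H \<and> ev \<cdot>\<^bsub>C\<^esub> pairing C p q (g \<cdot>\<^bsub>C\<^esub> r) s = f))"

definition cartesian_closed :: "('o, 'm, 'z) cat_scheme \<Rightarrow> bool" where
  "cartesian_closed C \<longleftrightarrow> category C \<and> has_terminal C \<and> has_products C \<and>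
     (\<forall>A \<in> Obj C. \<forall>B \<in> Obj C. \<exists>H P p q ev. is_exponential C A B H P p q ev)"


section \<open>Extensive categories\<close>

text \<open>A fixed but arbitrary choice of binary coproducts, meaningful when they exist.  Extensivity does
  not depend on the choice.\<close>

definition coprod :: "('o, 'm, 'z) cat_scheme \<Rightarrow> 'o \<Rightarrow> 'o \<Rightarrow> 'o \<times> 'm \<times> 'm" where
  "coprod C A B = (SOME (S, i, j). is_coproduct C A B S i j)"

abbreviation coprod_obj :: "('o, 'm, 'z) cat_scheme \<Rightarrow> 'o \<Rightarrow> 'o \<Rightarrow> 'o" where
  "coprod_obj C A B \<equiv> fst (coprod C A B)"

abbreviation coprod_inl :: "('o, 'm, 'z) cat_scheme \<Rightarrow> 'o \<Rightarrow> 'o \<Rightarrow> 'm" where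
  "coprod_inl C A B \<equiv> fst (snd (coprod C A B))"

abbreviation coprod_inr :: "('o, 'm, 'z) cat_scheme \<Rightarrow> 'o \<Rightarrow> 'o \<Rightarrow> 'm" where
  "coprod_inr C A B \<equiv> snd (snd (coprod C A B))"

definition coprod_arr :: "('o, 'm, 'z) cat_scheme \<Rightarrow> 'm \<Rightarrow> 'm \<Rightarrow> 'm" where
  "coprod_arr C f g =
     (THE u. u \<in> hom C (coprod_obj C (Dom C f) (Dom C g)) (coprod_obj C (Cod C f) (Cod C g)) \<and>
        u \<cdot>\<^bsub>C\<^esub> coprod_inl C (Dom C f) (Dom C g) = coprod_inl C (Cod C f) (Cod C g) \<cdot>\<^bsub>C\<^esub> f \<and>
        u \<cdot>\<^bsub>C\<^esub> coprod_inr C (Dom C f) (Dom C g) = coprod_inr C (Cod C f) (Cod C g) \<cdot>\<^bsub>C\<^esub> g)"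

text \<open>The functor from \<open>C/A \<times> C/B\<close> to \<open>C/(A + B)\<close> sending \<open>(f, g)\<close> to \<open>f + g\<close>; its formula
  does not mention \<open>A\<close> and \<open>B\<close>, which are the codomains of \<open>f\<close> and \<open>g\<close>.\<close>

definition slice_coprod_functor ::
  "('o, 'm, 'z) cat_scheme \<Rightarrow>
   ('m \<times> 'm, ('m \<times> 'm \<times> 'm) \<times> ('m \<times> 'm \<times> 'm), 'm, 'm \<times> 'm \<times> 'm) funct" where
  "slice_coprod_functor C =
     \<lparr>fobj = (\<lambda>(f, g). coprod_arr C f g),
      farr = (\<lambda>((f, f', h), (g, g', k)).
                (coprod_arr C f g, coprod_arr C f' g', coprod_arr C h k))\<rparr>"

definition extensive :: "('o, 'm, 'z) cat_scheme \<Rightarrow> bool" where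
  "extensive C \<longleftrightarrow> category C \<and> has_pullbacks C \<and> has_finite_coproducts C \<and>
     (\<forall>A \<in> Obj C. \<forall>B \<in> Obj C.
        is_equivalence (prod_cat (slice_cat C A) (slice_cat C B)) (slice_cat C (coprod_obj C A B))
          (slice_coprod_functor C))"

definition lextensive :: "('o, 'm, 'z) cat_scheme \<Rightarrow> bool" where
  "lextensive C \<longleftrightarrow> extensive C \<and> has_terminal C"

definition preserves_terminal ::
  "('o, 'm, 'y) cat_scheme \<Rightarrow> ('p, 'n, 'z) cat_scheme \<Rightarrow> ('o, 'm, 'p, 'n) funct \<Rightarrow> bool" where
  "preserves_terminal C D F \<longleftrightarrow> (\<forall>T. is_terminal C T \<longrightarrow> is_terminal D (fobj F T))"

definition preserves_finite_coproducts ::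
  "('o, 'm, 'y) cat_scheme \<Rightarrow> ('p, 'n, 'z) cat_scheme \<Rightarrow> ('o, 'm, 'p, 'n) funct \<Rightarrow> bool" where
  "preserves_finite_coproducts C D F \<longleftrightarrow>
     (\<forall>I. is_initial C I \<longrightarrow> is_initial D (fobj F I)) \<and>
     (\<forall>A B S i j. is_coproduct C A B S i j \<longrightarrow>
        is_coproduct D (fobj F A) (fobj F B) (fobj F S) (farr F i) (farr F j))"


section \<open>2-categories, powers and copowers\<close>

text \<open>A 2-category is given by its underlying category, together with hom-categories whose objects
  are the 1-cells and whose arrows are the 2-cells under vertical composition, and a horizontal
  composition \<open>HComp K \<beta> \<alpha>\<close> of 2-cells (\<open>\<alpha>\<close> first).\<close>

record ('o, 'm, 'c) two_cat = "('o, 'm) cat" +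
  HomCat :: "'o \<Rightarrow> 'o \<Rightarrow> ('m, 'c) cat"
  HComp :: "'c \<Rightarrow> 'c \<Rightarrow> 'c"

locale two_category = category K for K :: "('o, 'm, 'c, 'z) two_cat_scheme" (structure) +
  assumes HomCat_category: "\<lbrakk>A \<in> Obj K; B \<in> Obj K\<rbrakk> \<Longrightarrow> category (HomCat K A B)"
    and Obj_HomCat: "\<lbrakk>A \<in> Obj K; B \<in> Obj K\<rbrakk> \<Longrightarrow> Obj (HomCat K A B) = hom K A B"
    and HComp_functor:
      "\<lbrakk>A \<in> Obj K; B \<in> Obj K; C \<in> Obj K\<rbrakk> \<Longrightarrow>
         is_functor (prod_cat (HomCat K B C) (HomCat K A B)) (HomCat K A C)
           \<lparr>fobj = \<lambda>(g, f). g \<cdot> f, farr = \<lambda>(\<beta>, \<alpha>). HComp K \<beta> \<alpha>\<rparr>"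
    and HComp_assoc:
      "\<lbrakk>A \<in> Obj K; B \<in> Obj K; C \<in> Obj K; D \<in> Obj K;
        \<alpha> \<in> Arr (HomCat K A B); \<beta> \<in> Arr (HomCat K B C); \<gamma> \<in> Arr (HomCat K C D)\<rbrakk> \<Longrightarrow>
         HComp K (HComp K \<gamma> \<beta>) \<alpha> = HComp K \<gamma> (HComp K \<beta> \<alpha>)"
    and HComp_Ident:
      "\<lbrakk>A \<in> Obj K; B \<in> Obj K; \<alpha> \<in> Arr (HomCat K A B)\<rbrakk> \<Longrightarrow>
         HComp K \<alpha> (Ident (HomCat K A A) (Ident K A)) = \<alpha>"
    and Ident_HComp:
      "\<lbrakk>A \<in> Obj K; B \<in> Obj K; \<alpha> \<in> Arr (HomCat K A B)\<rbrakk> \<Longrightarrow>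
         HComp K (Ident (HomCat K B B) (Ident K B)) \<alpha> = \<alpha>"

abbreviation id_cell :: "('o, 'm, 'c, 'z) two_cat_scheme \<Rightarrow> 'm \<Rightarrow> 'c" where
  "id_cell K f \<equiv> Ident (HomCat K (Dom K f) (Cod K f)) f"

definition precomp :: "('o, 'm, 'c, 'z) two_cat_scheme \<Rightarrow> 'm \<Rightarrow> ('m, 'c, 'm, 'c) funct" where
  "precomp K u = \<lparr>fobj = \<lambda>h. h \<cdot>\<^bsub>K\<^esub> u, farr = \<lambda>\<theta>. HComp K \<theta> (id_cell K u)\<rparr>"

definition postcomp :: "('o, 'm, 'c, 'z) two_cat_scheme \<Rightarrow> 'm \<Rightarrow> ('m, 'c, 'm, 'c) funct" where
  "postcomp K v = \<lparr>fobj = \<lambda>h. v \<cdot>\<^bsub>K\<^esub> h, farr = \<lambda>\<theta>. HComp K (id_cell K v) \<theta>\<rparr>"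

text \<open>\<open>H\<close> is a power of \<open>B\<close> by the category \<open>J\<close>: the functors \<open>\<Phi> A\<close> are isomorphisms from
  \<open>K(A, H)\<close> to \<open>Cat(J, K(A, B))\<close>.  They are 2-natural in \<open>A\<close>: the second conjunct
  is naturality at a 1-cell \<open>u\<close>, on objects and on arrows, and the third is compatibility with the
  natural transformations that a 2-cell \<open>\<alpha>\<close> from \<open>u\<close> to \<open>u'\<close> induces between \<open>\<hyphen> \<circ> u\<close> and
  \<open>\<hyphen> \<circ> u'\<close>, compared at each component \<open>h\<close>.\<close>

definition is_power ::
  "('o, 'm, 'c, 'z) two_cat_scheme \<Rightarrow> ('p, 'n, 'y) cat_scheme \<Rightarrow> 'o \<Rightarrow> 'o \<Rightarrow> bool" where
  "is_power K J B H \<longleftrightarrow> B \<in> Obj K \<and> H \<in> Obj K \<and>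
     (\<exists>\<Phi>.
        (\<forall>A \<in> Obj K. is_cat_iso (HomCat K A H) (functor_cat J (HomCat K A B)) (\<Phi> A)) \<and>
        (\<forall>A \<in> Obj K. \<forall>A' \<in> Obj K. \<forall>u \<in> hom K A' A.
           (\<forall>h \<in> Obj (HomCat K A H).
              fobj (\<Phi> A') (fobj (precomp K u) h) =
              fobj (functor_cat_map J (precomp K u)) (fobj (\<Phi> A) h)) \<and>
           (\<forall>\<theta> \<in> Arr (HomCat K A H).
              farr (\<Phi> A') (farr (precomp K u) \<theta>) =
              farr (functor_cat_map J (precomp K u)) (farr (\<Phi> A) \<theta>))) \<and>
        (\<forall>A \<in> Obj K. \<forall>A' \<in> Obj K. \<forall>u \<in> hom K A' A. \<forall>u' \<in> hom K A' A.
           \<forall>\<alpha> \<in> hom (HomCat K A' A) u u'. \<forall>h \<in> hom K A H.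
              farr (\<Phi> A') (HComp K (id_cell K h) \<alpha>) =
              (fobj (functor_cat_map J (precomp K u)) (fobj (\<Phi> A) h),
               fobj (functor_cat_map J (precomp K u')) (fobj (\<Phi> A) h),
               \<lambda>j \<in> Obj J. HComp K (id_cell K (fobj (fobj (\<Phi> A) h) j)) \<alpha>)))"

text \<open>Dually, \<open>S\<close> is a copower of \<open>A\<close> by \<open>J\<close>, with isomorphisms \<open>\<Phi> B\<close> from \<open>K(S, B)\<close> to
  \<open>Cat(J, K(A, B))\<close> that are 2-natural in \<open>B\<close>.\<close>

definition is_copower ::
  "('o, 'm, 'c, 'z) two_cat_scheme \<Rightarrow> ('p, 'n, 'y) cat_scheme \<Rightarrow> 'o \<Rightarrow> 'o \<Rightarrow> bool" where
  "is_copower K J A S \<longleftrightarrow> A \<in> Obj K \<and> S \<in> Obj K \<and>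
     (\<exists>\<Phi>.
        (\<forall>B \<in> Obj K. is_cat_iso (HomCat K S B) (functor_cat J (HomCat K A B)) (\<Phi> B)) \<and>
        (\<forall>B \<in> Obj K. \<forall>B' \<in> Obj K. \<forall>v \<in> hom K B B'.
           (\<forall>h \<in> Obj (HomCat K S B).
              fobj (\<Phi> B') (fobj (postcomp K v) h) =
              fobj (functor_cat_map J (postcomp K v)) (fobj (\<Phi> B) h)) \<and>
           (\<forall>\<theta> \<in> Arr (HomCat K S B).
              farr (\<Phi> B') (farr (postcomp K v) \<theta>) =
              farr (functor_cat_map J (postcomp K v)) (farr (\<Phi> B) \<theta>))) \<and>
        (\<forall>B \<in> Obj K. \<forall>B' \<in> Obj K. \<forall>v \<in> hom K B B'. \<forall>v' \<in> hom K B B'.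
           \<forall>\<beta> \<in> hom (HomCat K B B') v v'. \<forall>h \<in> hom K S B.
              farr (\<Phi> B') (HComp K \<beta> (id_cell K h)) =
              (fobj (functor_cat_map J (postcomp K v)) (fobj (\<Phi> B) h),
               fobj (functor_cat_map J (postcomp K v')) (fobj (\<Phi> B) h),
               \<lambda>j \<in> Obj J. HComp K \<beta> (id_cell K (fobj (fobj (\<Phi> B) h) j)))))"


section \<open>The 2-category of internal categories\<close>

text \<open>The object \<open>Ob2\<close> of composable pairs is part of the data: it is some pullback, with \<open>pr1\<close>
  picking out the arrow that is applied first and \<open>pr2\<close> the one applied second.\<close>

record ('o, 'm) icat =
  Ob0 :: 'o
  Ob1 :: 'o
  Ob2 :: 'o
  src :: 'm
  tgt :: 'm
  unit_arr :: 'm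
  pr1 :: 'm
  pr2 :: 'm
  cmp :: 'm

text \<open>The composite of generalized elements \<open>f\<close> and then \<open>g\<close> of \<open>Ob1 \<A>\<close>.\<close>

definition icomp :: "('o, 'm, 'z) cat_scheme \<Rightarrow> ('o, 'm) icat \<Rightarrow> 'm \<Rightarrow> 'm \<Rightarrow> 'm" where
  "icomp E \<A> g f = cmp \<A> \<cdot>\<^bsub>E\<^esub> pairing E (pr1 \<A>) (pr2 \<A>) f g"

definition is_icat :: "('o, 'm, 'z) cat_scheme \<Rightarrow> ('o, 'm) icat \<Rightarrow> bool" where
  "is_icat E \<A> \<longleftrightarrow>
     Ob0 \<A> \<in> Obj E \<and> Ob1 \<A> \<in> Obj E \<and>
     src \<A> \<in> hom E (Ob1 \<A>) (Ob0 \<A>) \<and> tgt \<A> \<in> hom E (Ob1 \<A>) (Ob0 \<A>) \<and>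
     unit_arr \<A> \<in> hom E (Ob0 \<A>) (Ob1 \<A>) \<and>
     is_pullback E (tgt \<A>) (src \<A>) (Ob2 \<A>) (pr1 \<A>) (pr2 \<A>) \<and>
     cmp \<A> \<in> hom E (Ob2 \<A>) (Ob1 \<A>) \<and>
     src \<A> \<cdot>\<^bsub>E\<^esub> unit_arr \<A> = Ident E (Ob0 \<A>) \<and>
     tgt \<A> \<cdot>\<^bsub>E\<^esub> unit_arr \<A> = Ident E (Ob0 \<A>) \<and>
     src \<A> \<cdot>\<^bsub>E\<^esub> cmp \<A> = src \<A> \<cdot>\<^bsub>E\<^esub> pr1 \<A> \<and>
     tgt \<A> \<cdot>\<^bsub>E\<^esub> cmp \<A> = tgt \<A> \<cdot>\<^bsub>E\<^esub> pr2 \<A> \<and>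
     icomp E \<A> (Ident E (Ob1 \<A>)) (unit_arr \<A> \<cdot>\<^bsub>E\<^esub> src \<A>) = Ident E (Ob1 \<A>) \<and>
     icomp E \<A> (unit_arr \<A> \<cdot>\<^bsub>E\<^esub> tgt \<A>) (Ident E (Ob1 \<A>)) = Ident E (Ob1 \<A>) \<and>
     (\<forall>T q r. is_pullback E (pr2 \<A>) (pr1 \<A>) T q r \<longrightarrow>
        icomp E \<A> (pr2 \<A> \<cdot>\<^bsub>E\<^esub> r) (cmp \<A> \<cdot>\<^bsub>E\<^esub> q) =
        icomp E \<A> (cmp \<A> \<cdot>\<^bsub>E\<^esub> r) (pr1 \<A> \<cdot>\<^bsub>E\<^esub> q))"

record ('o, 'm) ifun =
  fdom :: "('o, 'm) icat"
  fcod :: "('o, 'm) icat"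
  map0 :: 'm
  map1 :: 'm

definition is_ifun :: "('o, 'm, 'z) cat_scheme \<Rightarrow> ('o, 'm) ifun \<Rightarrow> bool" where
  "is_ifun E F \<longleftrightarrow> (let \<A> = fdom F; \<B> = fcod F in
     is_icat E \<A> \<and> is_icat E \<B> \<and>
     map0 F \<in> hom E (Ob0 \<A>) (Ob0 \<B>) \<and> map1 F \<in> hom E (Ob1 \<A>) (Ob1 \<B>) \<and>
     src \<B> \<cdot>\<^bsub>E\<^esub> map1 F = map0 F \<cdot>\<^bsub>E\<^esub> src \<A> \<and>
     tgt \<B> \<cdot>\<^bsub>E\<^esub> map1 F = map0 F \<cdot>\<^bsub>E\<^esub> tgt \<A> \<and>
     unit_arr \<B> \<cdot>\<^bsub>E\<^esub> map0 F = map1 F \<cdot>\<^bsub>E\<^esub> unit_arr \<A> \<and>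
     icomp E \<B> (map1 F \<cdot>\<^bsub>E\<^esub> pr2 \<A>) (map1 F \<cdot>\<^bsub>E\<^esub> pr1 \<A>) = map1 F \<cdot>\<^bsub>E\<^esub> cmp \<A>)"

record ('o, 'm) inat =
  ndom :: "('o, 'm) ifun"
  ncod :: "('o, 'm) ifun"
  ncomp :: 'm

definition is_inat :: "('o, 'm, 'z) cat_scheme \<Rightarrow> ('o, 'm) inat \<Rightarrow> bool" where
  "is_inat E \<alpha> \<longleftrightarrow> (let F = ndom \<alpha>; G = ncod \<alpha>; \<A> = fdom F; \<B> = fcod F in
     is_ifun E F \<and> is_ifun E G \<and> fdom G = \<A> \<and> fcod G = \<B> \<and>
     ncomp \<alpha> \<in> hom E (Ob0 \<A>) (Ob1 \<B>) \<and>
     src \<B> \<cdot>\<^bsub>E\<^esub> ncomp \<alpha> = map0 F \<and> tgt \<B> \<cdot>\<^bsub>E\<^esub> ncomp \<alpha> = map0 G \<and>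
     icomp E \<B> (ncomp \<alpha> \<cdot>\<^bsub>E\<^esub> tgt \<A>) (map1 F) =
     icomp E \<B> (map1 G) (ncomp \<alpha> \<cdot>\<^bsub>E\<^esub> src \<A>))"

definition comp_ifun :: "('o, 'm, 'z) cat_scheme \<Rightarrow> ('o, 'm) ifun \<Rightarrow> ('o, 'm) ifun \<Rightarrow> ('o, 'm) ifun" where
  "comp_ifun E G F =
     \<lparr>fdom = fdom F, fcod = fcod G,
      map0 = map0 G \<cdot>\<^bsub>E\<^esub> map0 F, map1 = map1 G \<cdot>\<^bsub>E\<^esub> map1 F\<rparr>"

definition ICat :: "('o, 'm, 'z) cat_scheme \<Rightarrow> (('o, 'm) icat, ('o, 'm) ifun, ('o, 'm) inat) two_cat" where
  "ICat E =
     \<lparr>Obj = {\<A>. is_icat E \<A>}, Arr = {F. is_ifun E F}, Dom = fdom, Cod = fcod,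
      Ident = (\<lambda>\<A>. \<lparr>fdom = \<A>, fcod = \<A>, map0 = Ident E (Ob0 \<A>), map1 = Ident E (Ob1 \<A>)\<rparr>),
      Comp = comp_ifun E,
      HomCat = (\<lambda>\<A> \<B>.
        \<lparr>Obj = {F. is_ifun E F \<and> fdom F = \<A> \<and> fcod F = \<B>},
         Arr = {\<alpha>. is_inat E \<alpha> \<and> fdom (ndom \<alpha>) = \<A> \<and> fcod (ndom \<alpha>) = \<B>},
         Dom = ndom, Cod = ncod,
         Ident = (\<lambda>F. \<lparr>ndom = F, ncod = F, ncomp = unit_arr \<B> \<cdot>\<^bsub>E\<^esub> map0 F\<rparr>),
         Comp = (\<lambda>\<beta> \<alpha>. \<lparr>ndom = ndom \<alpha>, ncod = ncod \<beta>,
                          ncomp = icomp E \<B> (ncomp \<beta>) (ncomp \<alpha>)\<rparr>)\<rparr>),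
      HComp = (\<lambda>\<beta> \<alpha>.
        \<lparr>ndom = comp_ifun E (ndom \<beta>) (ndom \<alpha>), ncod = comp_ifun E (ncod \<beta>) (ncod \<alpha>),
         ncomp = icomp E (fcod (ndom \<beta>))
                   (ncomp \<beta> \<cdot>\<^bsub>E\<^esub> map0 (ncod \<alpha>)) (map1 (ndom \<beta>) \<cdot>\<^bsub>E\<^esub> ncomp \<alpha>)\<rparr>)\<rparr>"

text \<open>The action on objects of the 2-functor \<open>Cat(F)\<close>, where \<open>F\<close> preserves pullbacks.\<close>

definition icat_image :: "('o, 'm, 'p, 'n) funct \<Rightarrow> ('o, 'm) icat \<Rightarrow> ('p, 'n) icat" where
  "icat_image F \<A> =
     \<lparr>Ob0 = fobj F (Ob0 \<A>), Ob1 = fobj F (Ob1 \<A>), Ob2 = fobj F (Ob2 \<A>),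
      src = farr F (src \<A>), tgt = farr F (tgt \<A>), unit_arr = farr F (unit_arr \<A>),
      pr1 = farr F (pr1 \<A>), pr2 = farr F (pr2 \<A>), cmp = farr F (cmp \<A>)\<rparr>"


section \<open>Finite sets and the internal free-living arrow\<close>

text \<open>The finite subsets of \<open>'u\<close>, with an arrow \<open>(X, Y, f)\<close> for each function \<open>f\<close> from \<open>X\<close> to \<open>Y\<close>.
  When \<open>'u\<close> is infinite, this category is equivalent to that of all finite sets; it is used
  below with \<open>'u = bool list\<close>.\<close>

definition FinSet :: "('u set, 'u set \<times> 'u set \<times> ('u \<Rightarrow> 'u)) cat" where
  "FinSet =
     \<lparr>Obj = {X. finite X}, Arr = {(X, Y, f). finite X \<and> finite Y \<and> f \<in> X \<rightarrow>\<^sub>E Y},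
      Dom = (\<lambda>(X, Y, f). X), Cod = (\<lambda>(X, Y, f). Y),
      Ident = (\<lambda>X. (X, X, \<lambda>x \<in> X. x)),
      Comp = (\<lambda>(Y', Z, g) (X, Y, f). (X, Z, compose X g f))\<rparr>"

text \<open>The free-living arrow as a category internal to finite sets: an object, an arrow or a
  composable pair is a chain \<open>[i]\<close>, \<open>[i, j]\<close> or \<open>[i, j, k]\<close> in the ordered set \<open>False \<le> True\<close>.\<close>

definition bool_chains :: "nat \<Rightarrow> bool list set" where
  "bool_chains n = {xs. length xs = n \<and> sorted xs}"

definition two_FinSet :: "(bool list set, bool list set \<times> bool list set \<times> (bool list \<Rightarrow> bool list)) icat" where
  "two_FinSet =
     \<lparr>Ob0 = bool_chains 1, Ob1 = bool_chains 2, Ob2 = bool_chains 3,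
      src = (bool_chains 2, bool_chains 1, \<lambda>xs \<in> bool_chains 2. [xs ! 0]),
      tgt = (bool_chains 2, bool_chains 1, \<lambda>xs \<in> bool_chains 2. [xs ! 1]),
      unit_arr = (bool_chains 1, bool_chains 2, \<lambda>xs \<in> bool_chains 1. [xs ! 0, xs ! 0]),
      pr1 = (bool_chains 3, bool_chains 2, \<lambda>xs \<in> bool_chains 3. [xs ! 0, xs ! 1]),
      pr2 = (bool_chains 3, bool_chains 2, \<lambda>xs \<in> bool_chains 3. [xs ! 1, xs ! 2]),
      cmp = (bool_chains 3, bool_chains 2, \<lambda>xs \<in> bool_chains 3. [xs ! 0, xs ! 2])\<rparr>"


section \<open>Internal categories do form a 2-category\<close>

lemma hom_Arr: "f \<in> hom C A B \<Longrightarrow> f \<in> Arr C" "f \<in> hom C A B \<Longrightarrow> Dom C f = A"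
  "f \<in> hom C A B \<Longrightarrow> Cod C f = B"
  by (auto simp: hom_def)

context category begin

lemma hom_Obj: assumes "f \<in> hom C A B" shows "A \<in> Obj C" "B \<in> Obj C"
  using assms Dom_in_Obj Cod_in_Obj by (auto simp: hom_def)

lemma pairing_pullback:
  assumes pb: "is_pullback C f g P p q" and x: "x \<in> hom C X (Dom C f)" and y: "y \<in> hom C X (Dom C g)"
    and e: "f \<cdot> x = g \<cdot> y"
  shows "pairing C p q x y \<in> hom C X P" "p \<cdot> pairing C p q x y = x" "q \<cdot> pairing C p q x y = y"
    "\<And>u. \<lbrakk>u \<in> hom C X P; p \<cdot> u = x; q \<cdot> u = y\<rbrakk> \<Longrightarrow> u = pairing C p q x y"
proof -
  have X: "X \<in> Obj C" using x hom_Obj by blast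
  have ex1: "\<exists>!u. u \<in> hom C X P \<and> p \<cdot> u = x \<and> q \<cdot> u = y"
    using pb X x y e unfolding is_pullback_def by blast
  have D: "Dom C x = X" "Dom C p = P"
    using x pb by (auto simp: hom_def is_pullback_def)
  have *: "pairing C p q x y \<in> hom C X P \<and> p \<cdot> pairing C p q x y = x \<and> q \<cdot> pairing C p q x y = y"
    unfolding pairing_def D using ex1 by (rule theI')
  then show "pairing C p q x y \<in> hom C X P" "p \<cdot> pairing C p q x y = x" "q \<cdot> pairing C p q x y = y" by auto
  fix u assume "u \<in> hom C X P" "p \<cdot> u = x" "q \<cdot> u = y"
  then show "u = pairing C p q x y" using ex1 * by (auto elim: ex1E)
qed

lemma pairing_comp:
  assumes pb: "is_pullback C f g P p q" and x: "x \<in> hom C X (Dom C f)" and y: "y \<in> hom C X (Dom C g)"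
    and e: "f \<cdot> x = g \<cdot> y" and u: "u \<in> hom C Y X"
  shows "pairing C p q x y \<cdot> u = pairing C p q (x \<cdot> u) (y \<cdot> u)"
proof -
  note P = pairing_pullback[OF pb x y e]
  have f: "f \<in> hom C (Dom C f) (Cod C f)" "g \<in> hom C (Dom C g) (Cod C f)"
     "p \<in> hom C P (Dom C f)" "q \<in> hom C P (Dom C g)"
    using pb by (auto simp: is_pullback_def hom_def)
  have "f \<cdot> x \<cdot> u = g \<cdot> y \<cdot> u"
    using e Comp_assoc[OF u x f(1)] Comp_assoc[OF u y f(2)] by simp
  then show ?thesis
    using pairing_pullback(4)[OF pb Comp_in_hom[OF u x] Comp_in_hom[OF u y] _ Comp_in_hom[OF u P(1)]]
      P(2,3) Comp_assoc[OF u P(1) f(3)] Comp_assoc[OF u P(1) f(4)] by simp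
qed

text \<open>From here on, arrows into \<open>Ob0\<close> and \<open>Ob1\<close> are treated as generalized elements.\<close>

lemma icat_homs:
  assumes "is_icat C A"
  shows "src A \<in> hom C (Ob1 A) (Ob0 A)" "tgt A \<in> hom C (Ob1 A) (Ob0 A)"
   "unit_arr A \<in> hom C (Ob0 A) (Ob1 A)" "cmp A \<in> hom C (Ob2 A) (Ob1 A)"
   "pr1 A \<in> hom C (Ob2 A) (Ob1 A)" "pr2 A \<in> hom C (Ob2 A) (Ob1 A)"
   "is_pullback C (tgt A) (src A) (Ob2 A) (pr1 A) (pr2 A)" "Dom C (src A) = Ob1 A" "Dom C (tgt A) = Ob1 A"
   "src A \<cdot> unit_arr A = Ident C (Ob0 A)" "tgt A \<cdot> unit_arr A = Ident C (Ob0 A)"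
   "Ob0 A \<in> Obj C" "Ob1 A \<in> Obj C"
proof -
  show s: "src A \<in> hom C (Ob1 A) (Ob0 A)" "tgt A \<in> hom C (Ob1 A) (Ob0 A)"
   "unit_arr A \<in> hom C (Ob0 A) (Ob1 A)" "cmp A \<in> hom C (Ob2 A) (Ob1 A)"
   and pb: "is_pullback C (tgt A) (src A) (Ob2 A) (pr1 A) (pr2 A)"
   and "src A \<cdot> unit_arr A = Ident C (Ob0 A)" "tgt A \<cdot> unit_arr A = Ident C (Ob0 A)"
   "Ob0 A \<in> Obj C" "Ob1 A \<in> Obj C"
    using assms by (auto simp: is_icat_def)
  show D: "Dom C (src A) = Ob1 A" "Dom C (tgt A) = Ob1 A" using s by (auto simp: hom_def)
  show "pr1 A \<in> hom C (Ob2 A) (Ob1 A)" "pr2 A \<in> hom C (Ob2 A) (Ob1 A)" using pb D by (auto simp: is_pullback_def)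
qed

lemma icomp:
  assumes A: "is_icat C A" and f: "f \<in> hom C X (Ob1 A)" and g: "g \<in> hom C X (Ob1 A)"
    and e: "tgt A \<cdot> f = src A \<cdot> g"
  shows "icomp C A g f \<in> hom C X (Ob1 A)"
    "src A \<cdot> icomp C A g f = src A \<cdot> f" "tgt A \<cdot> icomp C A g f = tgt A \<cdot> g"
    "u \<in> hom C Y X \<Longrightarrow> icomp C A g f \<cdot> u = icomp C A (g \<cdot> u) (f \<cdot> u)"
proof -
  note H = icat_homs[OF A]
  have f': "f \<in> hom C X (Dom C (tgt A))" and g': "g \<in> hom C X (Dom C (src A))" using f g H(8,9) by auto
  note P = pairing_pullback[OF H(7) f' g' e]
  have ax: "src A \<cdot> cmp A = src A \<cdot> pr1 A" "tgt A \<cdot> cmp A = tgt A \<cdot> pr2 A" using A by (auto simp: is_icat_def)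
  show "icomp C A g f \<in> hom C X (Ob1 A)" unfolding icomp_def by (rule Comp_in_hom[OF P(1) H(4)])
  show "src A \<cdot> icomp C A g f = src A \<cdot> f" "tgt A \<cdot> icomp C A g f = tgt A \<cdot> g"
    unfolding icomp_def using Comp_assoc[OF P(1) H(4) H(1)] Comp_assoc[OF P(1) H(5) H(1)]
      Comp_assoc[OF P(1) H(4) H(2)] Comp_assoc[OF P(1) H(6) H(2)] P(2,3) ax by simp_all
  show "icomp C A g f \<cdot> u = icomp C A (g \<cdot> u) (f \<cdot> u)" if u: "u \<in> hom C Y X"
    unfolding icomp_def pairing_comp[OF H(7) f' g' e u, symmetric]
    by (rule Comp_assoc[OF u P(1) H(4)])
qed

lemma icomp_unit:
  assumes A: "is_icat C A" and f: "f \<in> hom C X (Ob1 A)"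
  shows "icomp C A f (unit_arr A \<cdot> src A \<cdot> f) = f" "icomp C A (unit_arr A \<cdot> tgt A \<cdot> f) f = f"
proof -
  note H = icat_homs[OF A]
  note h = Comp_in_hom[OF H(1) H(3)] Comp_in_hom[OF H(2) H(3)] Ident_in_hom[OF H(13)]
  have 1: "icomp C A (Ident C (Ob1 A)) (unit_arr A \<cdot> src A) = Ident C (Ob1 A)"
    "icomp C A (unit_arr A \<cdot> tgt A) (Ident C (Ob1 A)) = Ident C (Ob1 A)"
    using A by (auto simp: is_icat_def)
  have e1: "tgt A \<cdot> unit_arr A \<cdot> src A = src A \<cdot> Ident C (Ob1 A)"
    using Comp_assoc[OF H(1) H(3) H(2)] H(11) Ident_Comp[OF H(1)] Comp_Ident[OF H(1)] by simp
  have e2: "tgt A \<cdot> Ident C (Ob1 A) = src A \<cdot> unit_arr A \<cdot> tgt A"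
    using Comp_assoc[OF H(2) H(3) H(1)] H(10) Ident_Comp[OF H(2)] Comp_Ident[OF H(2)] by simp
  show "icomp C A f (unit_arr A \<cdot> src A \<cdot> f) = f"
    using icomp(4)[OF A h(1) h(3) e1 f] 1 Ident_Comp[OF f] Comp_assoc[OF f H(1) H(3)] by simp
  show "icomp C A (unit_arr A \<cdot> tgt A \<cdot> f) f = f"
    using icomp(4)[OF A h(3) h(2) e2 f] 1 Ident_Comp[OF f] Comp_assoc[OF f H(2) H(3)] by simp
qed

lemma icomp_assoc:
  assumes pbs: "has_pullbacks C" and A: "is_icat C A" and f: "f \<in> hom C X (Ob1 A)" and g: "g \<in> hom C X (Ob1 A)"
    and h: "h \<in> hom C X (Ob1 A)"
    and e: "tgt A \<cdot> f = src A \<cdot> g" "tgt A \<cdot> g = src A \<cdot> h"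
  shows "icomp C A (icomp C A h g) f = icomp C A h (icomp C A g f)"
proof -
  note H = icat_homs[OF A]
  have f': "f \<in> hom C X (Dom C (tgt A))" and g': "g \<in> hom C X (Dom C (src A))" "g \<in> hom C X (Dom C (tgt A))"
     and h': "h \<in> hom C X (Dom C (src A))" using f g h H(8,9) by auto
  note P = pairing_pullback[OF H(7) f' g'(1) e(1)]
  note Q = pairing_pullback[OF H(7) g'(2) h' e(2)]
  obtain T q r where pb: "is_pullback C (pr2 A) (pr1 A) T q r"
    using pbs[unfolded has_pullbacks_def, rule_format, OF hom_Arr(1)[OF H(6)] hom_Arr(1)[OF H(5)]]
      hom_Arr(3)[OF H(5)] hom_Arr(3)[OF H(6)] by auto
  have D: "Dom C (pr2 A) = Ob2 A" "Dom C (pr1 A) = Ob2 A" using H(5,6) by (auto simp: hom_def)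
  let ?x = "pairing C (pr1 A) (pr2 A) f g" and ?y = "pairing C (pr1 A) (pr2 A) g h"
  have ee: "pr2 A \<cdot> ?x = pr1 A \<cdot> ?y" using P(3) Q(2) by simp
  have xy: "?x \<in> hom C X (Dom C (pr2 A))" "?y \<in> hom C X (Dom C (pr1 A))" using P(1) Q(1) D by auto
  note W = pairing_pullback[OF pb xy ee]
  let ?w = "pairing C q r ?x ?y"
  have qr: "q \<in> hom C T (Ob2 A)" "r \<in> hom C T (Ob2 A)" "pr2 A \<cdot> q = pr1 A \<cdot> r"
    using pb D by (auto simp: is_pullback_def)
  have as: "icomp C A (pr2 A \<cdot> r) (cmp A \<cdot> q) = icomp C A (cmp A \<cdot> r) (pr1 A \<cdot> q)"
    using A pb by (auto simp: is_icat_def)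
  have ax: "src A \<cdot> cmp A = src A \<cdot> pr1 A" "tgt A \<cdot> cmp A = tgt A \<cdot> pr2 A" "tgt A \<cdot> pr1 A = src A \<cdot> pr2 A"
    using A H(7) by (auto simp: is_icat_def is_pullback_def)
  have h1: "cmp A \<cdot> q \<in> hom C T (Ob1 A)" "pr2 A \<cdot> r \<in> hom C T (Ob1 A)"
    "cmp A \<cdot> r \<in> hom C T (Ob1 A)" "pr1 A \<cdot> q \<in> hom C T (Ob1 A)"
    using Comp_in_hom[OF qr(1) H(4)] Comp_in_hom[OF qr(2) H(6)] Comp_in_hom[OF qr(2) H(4)] Comp_in_hom[OF qr(1) H(5)] by auto
  have e1: "tgt A \<cdot> cmp A \<cdot> q = src A \<cdot> pr2 A \<cdot> r"
    using Comp_assoc[OF qr(1) H(4) H(2)] Comp_assoc[OF qr(1) H(6) H(2)] Comp_assoc[OF qr(2) H(5) H(2)] Comp_assoc[OF qr(2) H(6) H(1)] ax qr(3) by simp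
  have e2: "tgt A \<cdot> pr1 A \<cdot> q = src A \<cdot> cmp A \<cdot> r"
    using Comp_assoc[OF qr(1) H(5) H(2)] Comp_assoc[OF qr(1) H(6) H(1)] Comp_assoc[OF qr(2) H(4) H(1)] Comp_assoc[OF qr(2) H(5) H(1)] ax qr(3) by simp
  have "icomp C A ((pr2 A \<cdot> r) \<cdot> ?w) ((cmp A \<cdot> q) \<cdot> ?w) = icomp C A ((cmp A \<cdot> r) \<cdot> ?w) ((pr1 A \<cdot> q) \<cdot> ?w)"
    using icomp(4)[OF A h1(1) h1(2) e1 W(1)] icomp(4)[OF A h1(4) h1(3) e2 W(1)] as by simp
  moreover have "(pr2 A \<cdot> r) \<cdot> ?w = h" "(cmp A \<cdot> q) \<cdot> ?w = icomp C A g f" "(cmp A \<cdot> r) \<cdot> ?w = icomp C A h g"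
     "(pr1 A \<cdot> q) \<cdot> ?w = f"
    using Comp_assoc[OF W(1) qr(1)] Comp_assoc[OF W(1) qr(2)]
      Comp_assoc[OF W(1) qr(2) H(6)] Comp_assoc[OF W(1) qr(1) H(4)] Comp_assoc[OF W(1) qr(2) H(4)]
      Comp_assoc[OF W(1) qr(1) H(5)] W(2,3) P(2,3) Q(2,3) unfolding icomp_def by simp_all
  ultimately show ?thesis by simp
qed

lemma ifun:
  assumes F: "is_ifun C F"
  shows "is_icat C (fdom F)" "is_icat C (fcod F)"
    "map0 F \<in> hom C (Ob0 (fdom F)) (Ob0 (fcod F))"
    "map1 F \<in> hom C (Ob1 (fdom F)) (Ob1 (fcod F))"
    "src (fcod F) \<cdot> map1 F = map0 F \<cdot> src (fdom F)"
    "tgt (fcod F) \<cdot> map1 F = map0 F \<cdot> tgt (fdom F)"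
    "unit_arr (fcod F) \<cdot> map0 F = map1 F \<cdot> unit_arr (fdom F)"
  using F by (auto simp: is_ifun_def Let_def)

lemma ifun_elt:
  assumes F: "is_ifun C F" and f: "f \<in> hom C X (Ob1 (fdom F))"
  shows "map1 F \<cdot> f \<in> hom C X (Ob1 (fcod F))"
    "src (fcod F) \<cdot> map1 F \<cdot> f = map0 F \<cdot> src (fdom F) \<cdot> f"
    "tgt (fcod F) \<cdot> map1 F \<cdot> f = map0 F \<cdot> tgt (fdom F) \<cdot> f"
  using ifun(5,6)[OF F] Comp_in_hom[OF f ifun(4)[OF F]]
    Comp_assoc[OF f ifun(4)[OF F] icat_homs(1)[OF ifun(2)[OF F]]]
    Comp_assoc[OF f ifun(4)[OF F] icat_homs(2)[OF ifun(2)[OF F]]]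
    Comp_assoc[OF f icat_homs(1)[OF ifun(1)[OF F]] ifun(3)[OF F]]
    Comp_assoc[OF f icat_homs(2)[OF ifun(1)[OF F]] ifun(3)[OF F]]
  by simp_all

lemma ifun_icomp:
  assumes F: "is_ifun C F" and f: "f \<in> hom C X (Ob1 (fdom F))" and g: "g \<in> hom C X (Ob1 (fdom F))"
    and e: "tgt (fdom F) \<cdot> f = src (fdom F) \<cdot> g"
  shows "map1 F \<cdot> icomp C (fdom F) g f = icomp C (fcod F) (map1 F \<cdot> g) (map1 F \<cdot> f)"
proof -
  let ?A = "fdom F" and ?B = "fcod F"
  note A = ifun(1)[OF F] and B = ifun(2)[OF F]
  note H = icat_homs[OF A] and m = ifun(4)[OF F]
  have f': "f \<in> hom C X (Dom C (tgt ?A))" and g': "g \<in> hom C X (Dom C (src ?A))" using f g H(8,9) by auto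
  note P = pairing_pullback[OF H(7) f' g' e]
  let ?x = "pairing C (pr1 ?A) (pr2 ?A) f g"
  have "map1 F \<cdot> icomp C ?A g f = (map1 F \<cdot> cmp ?A) \<cdot> ?x"
    unfolding icomp_def using Comp_assoc[OF P(1) H(4) m] by simp
  also have "map1 F \<cdot> cmp ?A = icomp C ?B (map1 F \<cdot> pr2 ?A) (map1 F \<cdot> pr1 ?A)"
    using F by (auto simp: is_ifun_def Let_def)
  also have "\<dots> \<cdot> ?x = icomp C ?B ((map1 F \<cdot> pr2 ?A) \<cdot> ?x) ((map1 F \<cdot> pr1 ?A) \<cdot> ?x)"
  proof (rule icomp(4)[OF B _ _ _ P(1)])
    show "map1 F \<cdot> pr1 ?A \<in> hom C (Ob2 ?A) (Ob1 ?B)" "map1 F \<cdot> pr2 ?A \<in> hom C (Ob2 ?A) (Ob1 ?B)"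
      using H m Comp_in_hom by blast+
    have "tgt ?A \<cdot> pr1 ?A = src ?A \<cdot> pr2 ?A" using H(7) by (auto simp: is_pullback_def)
    then show "tgt ?B \<cdot> map1 F \<cdot> pr1 ?A = src ?B \<cdot> map1 F \<cdot> pr2 ?A"
      using ifun_elt[OF F H(5)] ifun_elt[OF F H(6)] by simp
  qed
  also have "\<dots> = icomp C ?B (map1 F \<cdot> g) (map1 F \<cdot> f)"
    using Comp_assoc[OF P(1) H(5) m] Comp_assoc[OF P(1) H(6) m] P(2,3) by simp
  finally show ?thesis .
qed

lemma inat:
  assumes "is_inat C \<alpha>"
  shows "is_ifun C (ndom \<alpha>)" "is_ifun C (ncod \<alpha>)" "fdom (ncod \<alpha>) = fdom (ndom \<alpha>)" "fcod (ncod \<alpha>) = fcod (ndom \<alpha>)"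
   "ncomp \<alpha> \<in> hom C (Ob0 (fdom (ndom \<alpha>))) (Ob1 (fcod (ndom \<alpha>)))"
   "src (fcod (ndom \<alpha>)) \<cdot> ncomp \<alpha> = map0 (ndom \<alpha>)" "tgt (fcod (ndom \<alpha>)) \<cdot> ncomp \<alpha> = map0 (ncod \<alpha>)"
  using assms by (auto simp: is_inat_def Let_def)

lemma inat_natural:
  assumes a: "is_inat C \<alpha>" and f: "f \<in> hom C X (Ob1 (fdom (ndom \<alpha>)))"
  shows "icomp C (fcod (ndom \<alpha>)) (ncomp \<alpha> \<cdot> tgt (fdom (ndom \<alpha>)) \<cdot> f) (map1 (ndom \<alpha>) \<cdot> f) =
         icomp C (fcod (ndom \<alpha>)) (map1 (ncod \<alpha>) \<cdot> f) (ncomp \<alpha> \<cdot> src (fdom (ndom \<alpha>)) \<cdot> f)"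
proof -
  note I = inat[OF a]
  let ?A = "fdom (ndom \<alpha>)" and ?B = "fcod (ndom \<alpha>)"
  note A = ifun(1)[OF I(1)] and B = ifun(2)[OF I(1)]
  note H = icat_homs[OF A] and K = icat_homs[OF B]
  note F = ifun[OF I(1)] and G = ifun[OF I(2), unfolded I]
  have h: "ncomp \<alpha> \<cdot> tgt ?A \<in> hom C (Ob1 ?A) (Ob1 ?B)" "ncomp \<alpha> \<cdot> src ?A \<in> hom C (Ob1 ?A) (Ob1 ?B)"
    using I H Comp_in_hom by blast+
  have e: "tgt ?B \<cdot> map1 (ndom \<alpha>) = src ?B \<cdot> ncomp \<alpha> \<cdot> tgt ?A"
    "tgt ?B \<cdot> ncomp \<alpha> \<cdot> src ?A = src ?B \<cdot> map1 (ncod \<alpha>)"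
    using F(6) G(5) I(6,7) Comp_assoc[OF H(2) I(5) K(1)] Comp_assoc[OF H(1) I(5) K(2)] by simp_all
  have "icomp C ?B (ncomp \<alpha> \<cdot> tgt ?A) (map1 (ndom \<alpha>)) \<cdot> f = icomp C ?B (map1 (ncod \<alpha>)) (ncomp \<alpha> \<cdot> src ?A) \<cdot> f"
    using a by (simp add: is_inat_def Let_def)
  then show ?thesis
    using icomp(4)[OF B F(4) h(1) e(1) f] icomp(4)[OF B h(2) G(4) e(2) f]
      Comp_assoc[OF f H(1) I(5)] Comp_assoc[OF f H(2) I(5)] by simp
qed


lemma icat_elt:
  assumes A: "is_icat C A" and f: "f \<in> hom C X (Ob1 A)"
  shows "src A \<cdot> f \<in> hom C X (Ob0 A)" "tgt A \<cdot> f \<in> hom C X (Ob0 A)"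
  using Comp_in_hom[OF f icat_homs(1)[OF A]] Comp_in_hom[OF f icat_homs(2)[OF A]] by auto

lemma unit_elt:
  assumes A: "is_icat C A" and x: "x \<in> hom C X (Ob0 A)"
  shows "unit_arr A \<cdot> x \<in> hom C X (Ob1 A)" "src A \<cdot> unit_arr A \<cdot> x = x" "tgt A \<cdot> unit_arr A \<cdot> x = x"
  using Comp_in_hom[OF x icat_homs(3)[OF A]] Comp_assoc[OF x icat_homs(3)[OF A] icat_homs(1)[OF A]]
    Comp_assoc[OF x icat_homs(3)[OF A] icat_homs(2)[OF A]] icat_homs(10,11)[OF A] Ident_Comp[OF x] by simp_all

lemma ifun_unit_elt:
  assumes F: "is_ifun C F" and x: "x \<in> hom C X (Ob0 (fdom F))"
  shows "map1 F \<cdot> unit_arr (fdom F) \<cdot> x = unit_arr (fcod F) \<cdot> map0 F \<cdot> x"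
  using ifun(7)[OF F] Comp_assoc[OF x icat_homs(3)[OF ifun(1)[OF F]] ifun(4)[OF F]]
    Comp_assoc[OF x ifun(3)[OF F] icat_homs(3)[OF ifun(2)[OF F]]] by simp

lemma inat_elt:
  assumes a: "is_inat C \<alpha>" and x: "x \<in> hom C X (Ob0 (fdom (ndom \<alpha>)))"
  shows "ncomp \<alpha> \<cdot> x \<in> hom C X (Ob1 (fcod (ndom \<alpha>)))"
   "src (fcod (ndom \<alpha>)) \<cdot> ncomp \<alpha> \<cdot> x = map0 (ndom \<alpha>) \<cdot> x"
   "tgt (fcod (ndom \<alpha>)) \<cdot> ncomp \<alpha> \<cdot> x = map0 (ncod \<alpha>) \<cdot> x"
  using inat(5-7)[OF a] Comp_in_hom[OF x inat(5)[OF a]] icat_homs(1,2)[OF ifun(2)[OF inat(1)[OF a]]]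
    Comp_assoc[OF x inat(5)[OF a] icat_homs(1)[OF ifun(2)[OF inat(1)[OF a]]]]
    Comp_assoc[OF x inat(5)[OF a] icat_homs(2)[OF ifun(2)[OF inat(1)[OF a]]]] by simp_all

lemma ifun_comp_ifun:
  assumes F: "is_ifun C F" and G: "is_ifun C G" and e: "fcod F = fdom G"
  shows "is_ifun C (comp_ifun C G F)"
proof -
  note f = ifun[OF F, unfolded e] and g = ifun[OF G]
  note A = icat_homs[OF f(1)] and B = icat_homs[OF g(1)] and D = icat_homs[OF g(2)]
  note cf = Comp_assoc[OF _ f(4) g(4)] 
  have pe: "tgt (fdom F) \<cdot> pr1 (fdom F) = src (fdom F) \<cdot> pr2 (fdom F)"
    using A(7) by (simp add: is_pullback_def)
  have ic: "icomp C (fdom G) (map1 F \<cdot> pr2 (fdom F)) (map1 F \<cdot> pr1 (fdom F)) = map1 F \<cdot> cmp (fdom F)"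
    using F e by (simp add: is_ifun_def Let_def)
  have "icomp C (fcod G) ((map1 G \<cdot> map1 F) \<cdot> pr2 (fdom F)) ((map1 G \<cdot> map1 F) \<cdot> pr1 (fdom F)) =
     (map1 G \<cdot> map1 F) \<cdot> cmp (fdom F)"
    using ifun_icomp[OF G, of "map1 F \<cdot> pr1 (fdom F)" _ "map1 F \<cdot> pr2 (fdom F)"] 
      ifun_elt[OF F A(5)] ifun_elt[OF F A(6)] pe e cf[OF A(4)] cf[OF A(5)] cf[OF A(6)] ic by simp
  moreover have "src (fcod G) \<cdot> map1 G \<cdot> map1 F = (map0 G \<cdot> map0 F) \<cdot> src (fdom F)"
    "tgt (fcod G) \<cdot> map1 G \<cdot> map1 F = (map0 G \<cdot> map0 F) \<cdot> tgt (fdom F)"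
    using ifun_elt[OF G f(4)] f(5,6) Comp_assoc[OF A(1) f(3) g(3)] Comp_assoc[OF A(2) f(3) g(3)] by simp_all
  moreover have "unit_arr (fcod G) \<cdot> map0 G \<cdot> map0 F = (map1 G \<cdot> map1 F) \<cdot> unit_arr (fdom F)"
    using ifun_unit_elt[OF G f(3)] f(7) Comp_assoc[OF A(3) f(4) g(4)] by simp
  ultimately show ?thesis
    using f(1) g(2) Comp_in_hom[OF f(3) g(3)] Comp_in_hom[OF f(4) g(4)]
    unfolding is_ifun_def Let_def comp_ifun_def by simp
qed

lemma ifun_id:
  assumes A: "is_icat C A"
  shows "is_ifun C \<lparr>fdom = A, fcod = A, map0 = Ident C (Ob0 A), map1 = Ident C (Ob1 A)\<rparr>"
proof -
  note H = icat_homs[OF A]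
  have "icomp C A (pr2 A) (pr1 A) = cmp A"
  proof -
    have e: "tgt A \<cdot> pr1 A = src A \<cdot> pr2 A" using H(7) by (simp add: is_pullback_def)
    have "Ident C (Ob2 A) = pairing C (pr1 A) (pr2 A) (pr1 A) (pr2 A)"
      using pairing_pullback(4)[OF H(7), unfolded H(8,9), OF H(5,6) e, of "Ident C (Ob2 A)"]
       H Comp_Ident Ident_in_hom hom_Obj by auto
    then show ?thesis unfolding icomp_def using Comp_Ident[OF H(4)] by simp
  qed
  then show ?thesis
    using A H(12,13) Ident_Comp[OF H(1)] Ident_Comp[OF H(2)] Ident_Comp[OF H(3)] Ident_Comp[OF H(4)]
     Comp_Ident[OF H(1)] Comp_Ident[OF H(2)] Comp_Ident[OF H(3)] Ident_Comp[OF H(5)] Ident_Comp[OF H(6)]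
     Ident_in_hom
    by (simp add: is_ifun_def)
qed

lemma inat_id:
  assumes F: "is_ifun C F"
  shows "is_inat C \<lparr>ndom = F, ncod = F, ncomp = unit_arr (fcod F) \<cdot> map0 F\<rparr>"
proof -
  note f = ifun[OF F] 
  note A = icat_homs[OF f(1)] and B = icat_homs[OF f(2)]
  show ?thesis using F unit_elt[OF f(2,3)] icomp_unit[OF f(2,4)] f(5,6)
    Comp_assoc[OF A(1) f(3) B(3)] Comp_assoc[OF A(2) f(3) B(3)]
    by (simp add: is_inat_def Let_def)
qed

lemma inatI:
  assumes "is_ifun C F" "is_ifun C G" "fdom G = fdom F" "fcod G = fcod F"
    "t \<in> hom C (Ob0 (fdom F)) (Ob1 (fcod F))" "src (fcod F) \<cdot> t = map0 F" "tgt (fcod F) \<cdot> t = map0 G"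
    "icomp C (fcod F) (t \<cdot> tgt (fdom F)) (map1 F) = icomp C (fcod F) (map1 G) (t \<cdot> src (fdom F))"
  shows "is_inat C \<lparr>ndom = F, ncod = G, ncomp = t\<rparr>"
  using assms by (simp add: is_inat_def Let_def)

lemma inat_nat:
  assumes a: "is_inat C \<alpha>"
  shows "icomp C (fcod (ndom \<alpha>)) (ncomp \<alpha> \<cdot> tgt (fdom (ndom \<alpha>))) (map1 (ndom \<alpha>)) =
         icomp C (fcod (ndom \<alpha>)) (map1 (ncod \<alpha>)) (ncomp \<alpha> \<cdot> src (fdom (ndom \<alpha>)))"
  using a by (simp add: is_inat_def Let_def)

context
  assumes pbs: "has_pullbacks C"
begin

lemma inat_vcomp:
  assumes a: "is_inat C \<alpha>" and b: "is_inat C \<beta>" and e: "ncod \<alpha> = ndom \<beta>"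
  shows "is_inat C \<lparr>ndom = ndom \<alpha>, ncod = ncod \<beta>, ncomp = icomp C (fcod (ndom \<alpha>)) (ncomp \<beta>) (ncomp \<alpha>)\<rparr>"
proof -
  let ?A = "fdom (ndom \<alpha>)" and ?B = "fcod (ndom \<alpha>)"
  note I = inat[OF a] 
  have eq: "fdom (ndom \<beta>) = ?A" "fcod (ndom \<beta>) = ?B" using I(3,4) e by simp_all
  note J = inat[OF b, unfolded eq]
  note A = icat_homs[OF ifun(1)[OF I(1)]] and B0 = ifun(2)[OF I(1)] 
  note B = icat_homs[OF B0]
  note F = ifun[OF I(1)] and G = ifun[OF J(1), unfolded eq] and H = ifun[OF J(2), unfolded J(3,4)]
  have m: "tgt ?B \<cdot> ncomp \<alpha> = src ?B \<cdot> ncomp \<beta>" using I(7) J(6) e by simp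
  note c = icomp[OF B0 I(5) J(5) m]
  note as = inat_elt[OF a A(1)] inat_elt[OF a A(2)]
  note bs = inat_elt[OF b, unfolded eq, OF A(1)] inat_elt[OF b, unfolded eq, OF A(2)]
  have "icomp C ?B (icomp C ?B (ncomp \<beta>) (ncomp \<alpha>) \<cdot> tgt ?A) (map1 (ndom \<alpha>))
    = icomp C ?B (icomp C ?B (ncomp \<beta> \<cdot> tgt ?A) (ncomp \<alpha> \<cdot> tgt ?A)) (map1 (ndom \<alpha>))"
    using c(4)[OF A(2)] by simp
  also have "\<dots> = icomp C ?B (ncomp \<beta> \<cdot> tgt ?A) (icomp C ?B (ncomp \<alpha> \<cdot> tgt ?A) (map1 (ndom \<alpha>)))"
    by (rule icomp_assoc[OF pbs B0 F(4) as(4) bs(4)]) (use F(6) as(5,6) bs(5) e in simp_all)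
  also have "\<dots> = icomp C ?B (ncomp \<beta> \<cdot> tgt ?A) (icomp C ?B (map1 (ndom \<beta>)) (ncomp \<alpha> \<cdot> src ?A))"
    using inat_nat[OF a] e by simp
  also have "\<dots> = icomp C ?B (icomp C ?B (ncomp \<beta> \<cdot> tgt ?A) (map1 (ndom \<beta>))) (ncomp \<alpha> \<cdot> src ?A)"
    by (rule icomp_assoc[OF pbs B0 as(1) G(4) bs(4), symmetric]) (use G(5,6) as(3) bs(5) e in simp_all)
  also have "\<dots> = icomp C ?B (icomp C ?B (map1 (ncod \<beta>)) (ncomp \<beta> \<cdot> src ?A)) (ncomp \<alpha> \<cdot> src ?A)"
    using inat_nat[OF b] eq by simp
  also have "\<dots> = icomp C ?B (map1 (ncod \<beta>)) (icomp C ?B (ncomp \<beta> \<cdot> src ?A) (ncomp \<alpha> \<cdot> src ?A))"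
    by (rule icomp_assoc[OF pbs B0 as(1) bs(1) H(4)]) (use H(5) as(3) bs(2,3) e in simp_all)
  also have "\<dots> = icomp C ?B (map1 (ncod \<beta>)) (icomp C ?B (ncomp \<beta>) (ncomp \<alpha>) \<cdot> src ?A)"
    using c(4)[OF A(1)] by simp
  finally show ?thesis
    using c I J by (intro inatI) simp_all
qed

lemma HomCat_cat:
  assumes A: "is_icat C A" and B: "is_icat C B"
  shows "category (HomCat (ICat C) A B)"
proof -
  let ?H = "HomCat (ICat C) A B"
  have hom: "\<alpha> \<in> hom ?H F G \<longleftrightarrow> is_inat C \<alpha> \<and> ndom \<alpha> = F \<and> ncod \<alpha> = G \<and> fdom F = A \<and> fcod F = B" for \<alpha> F G
    by (auto simp: hom_def ICat_def)
  show ?thesis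
  proof
    fix f assume "f \<in> Arr ?H"
    then show "Dom ?H f \<in> Obj ?H" "Cod ?H f \<in> Obj ?H" using inat by (auto simp: ICat_def)
  next
    fix F assume "F \<in> Obj ?H" then show "Ident ?H F \<in> hom ?H F F"
      unfolding hom using inat_id by (auto simp: ICat_def)
  next
    fix f F G g H assume "f \<in> hom ?H F G" "g \<in> hom ?H G H"
    then show "g \<cdot>\<^bsub>?H\<^esub> f \<in> hom ?H F H"
      unfolding hom using inat_vcomp[of f g] by (auto simp: ICat_def)
  next
    fix f F G assume f: "f \<in> hom ?H F G"
    then have i: "is_inat C f" "ndom f = F" "ncod f = G" "fdom F = A" "fcod F = B" unfolding hom by auto
    note I = inat[OF i(1), unfolded i]
    show "f \<cdot>\<^bsub>?H\<^esub> Ident ?H F = f" "Ident ?H G \<cdot>\<^bsub>?H\<^esub> f = f"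
      using icomp_unit[OF B I(5)] i I(6,7) by (simp_all add: ICat_def)
  next
    fix f F G g H h K assume "f \<in> hom ?H F G" "g \<in> hom ?H G H" "h \<in> hom ?H H K"
    then have i: "is_inat C f" "ndom f = F" "ncod f = G" "fdom F = A" "fcod F = B"
      "is_inat C g" "ndom g = G" "ncod g = H" "fdom G = A" "fcod G = B"
      "is_inat C h" "ndom h = H" "ncod h = K" "fdom H = A" "fcod H = B" unfolding hom by auto
    note I = inat[OF i(1), unfolded i] inat[OF i(6), unfolded i] inat[OF i(11), unfolded i] 
    show "(h \<cdot>\<^bsub>?H\<^esub> g) \<cdot>\<^bsub>?H\<^esub> f = h \<cdot>\<^bsub>?H\<^esub> (g \<cdot>\<^bsub>?H\<^esub> f)"
      using icomp_assoc[OF pbs B I(5) I(12) I(19)] I(6,7,13,14,20,21)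
      by (simp add: ICat_def)
  qed
qed

lemma ICat_category: "category (ICat C)"
proof -
  have hom: "F \<in> hom (ICat C) A B \<longleftrightarrow> is_ifun C F \<and> fdom F = A \<and> fcod F = B" for F A B
    by (auto simp: hom_def ICat_def)
  show ?thesis
  proof
    fix F assume "F \<in> Arr (ICat C)" 
    then show "Dom (ICat C) F \<in> Obj (ICat C)" "Cod (ICat C) F \<in> Obj (ICat C)"
      using ifun by (auto simp: ICat_def)
  next
    fix A assume "A \<in> Obj (ICat C)" then show "Ident (ICat C) A \<in> hom (ICat C) A A"
      unfolding hom using ifun_id by (auto simp: ICat_def)
  next
    fix F G A B D assume "F \<in> hom (ICat C) A B" "G \<in> hom (ICat C) B D"
    then show "G \<cdot>\<^bsub>ICat C\<^esub> F \<in> hom (ICat C) A D"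
      unfolding hom using ifun_comp_ifun[of F G] by (auto simp: ICat_def comp_ifun_def)
  next
    fix F A B assume "F \<in> hom (ICat C) A B"
    then have F: "is_ifun C F" "fdom F = A" "fcod F = B" unfolding hom by auto
    note f = ifun[OF F(1), unfolded F]
    show "F \<cdot>\<^bsub>ICat C\<^esub> Ident (ICat C) A = F" "Ident (ICat C) B \<cdot>\<^bsub>ICat C\<^esub> F = F"
      using F Comp_Ident[OF f(3)] Comp_Ident[OF f(4)] Ident_Comp[OF f(3)] Ident_Comp[OF f(4)]
      by (simp_all add: ICat_def comp_ifun_def)
  next
    fix F G H A B D D' assume "F \<in> hom (ICat C) A B" "G \<in> hom (ICat C) B D" "H \<in> hom (ICat C) D D'"
    then have F: "is_ifun C F" "fdom F = A" "fcod F = B" "is_ifun C G" "fdom G = B" "fcod G = D"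
      "is_ifun C H" "fdom H = D" "fcod H = D'" unfolding hom by auto
    note f = ifun[OF F(1), unfolded F] ifun[OF F(4), unfolded F] ifun[OF F(7), unfolded F]
    show "(H \<cdot>\<^bsub>ICat C\<^esub> G) \<cdot>\<^bsub>ICat C\<^esub> F = H \<cdot>\<^bsub>ICat C\<^esub> (G \<cdot>\<^bsub>ICat C\<^esub> F)"
      using Comp_assoc[OF f(3) f(10) f(17)] Comp_assoc[OF f(4) f(11) f(18)]
      by (simp add: ICat_def comp_ifun_def)
  qed
qed

lemma inat_hcomp:
  assumes a: "is_inat C \<alpha>" and b: "is_inat C \<beta>" and e: "fcod (ndom \<alpha>) = fdom (ndom \<beta>)"
  shows "is_inat C (HComp (ICat C) \<beta> \<alpha>)"
    "ncomp \<beta> \<cdot> map0 (ncod \<alpha>) \<in> hom C (Ob0 (fdom (ndom \<alpha>))) (Ob1 (fcod (ndom \<beta>)))"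
    "map1 (ndom \<beta>) \<cdot> ncomp \<alpha> \<in> hom C (Ob0 (fdom (ndom \<alpha>))) (Ob1 (fcod (ndom \<beta>)))"
    "src (fcod (ndom \<beta>)) \<cdot> ncomp \<beta> \<cdot> map0 (ncod \<alpha>) = map0 (ndom \<beta>) \<cdot> map0 (ncod \<alpha>)"
    "tgt (fcod (ndom \<beta>)) \<cdot> ncomp \<beta> \<cdot> map0 (ncod \<alpha>) = map0 (ncod \<beta>) \<cdot> map0 (ncod \<alpha>)"
    "src (fcod (ndom \<beta>)) \<cdot> map1 (ndom \<beta>) \<cdot> ncomp \<alpha> = map0 (ndom \<beta>) \<cdot> map0 (ndom \<alpha>)"
    "tgt (fcod (ndom \<beta>)) \<cdot> map1 (ndom \<beta>) \<cdot> ncomp \<alpha> = map0 (ndom \<beta>) \<cdot> map0 (ncod \<alpha>)"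
proof -
  let ?A = "fdom (ndom \<alpha>)" and ?B = "fdom (ndom \<beta>)" and ?D = "fcod (ndom \<beta>)"
  let ?F = "ndom \<alpha>" and ?G = "ncod \<alpha>" and ?H = "ndom \<beta>" and ?K = "ncod \<beta>"
  note I = inat[OF a, unfolded e] and J = inat[OF b]
  note F = ifun[OF I(1), unfolded e] and G = ifun[OF I(2), unfolded I(3,4)]
    and H = ifun[OF J(1)] and K = ifun[OF J(2), unfolded J(3,4)]
  note A = icat_homs[OF F(1)] and B = icat_homs[OF H(1)] and D = icat_homs[OF H(2)]
  note bG = inat_elt[OF b G(3)]
  note Ha = ifun_elt[OF J(1) I(5)]
  show 1: "ncomp \<beta> \<cdot> map0 ?G \<in> hom C (Ob0 ?A) (Ob1 ?D)" "map1 ?H \<cdot> ncomp \<alpha> \<in> hom C (Ob0 ?A) (Ob1 ?D)"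
    and 2: "src ?D \<cdot> ncomp \<beta> \<cdot> map0 ?G = map0 ?H \<cdot> map0 ?G"
    "tgt ?D \<cdot> ncomp \<beta> \<cdot> map0 ?G = map0 ?K \<cdot> map0 ?G"
    "src ?D \<cdot> map1 ?H \<cdot> ncomp \<alpha> = map0 ?H \<cdot> map0 ?F"
    "tgt ?D \<cdot> map1 ?H \<cdot> ncomp \<alpha> = map0 ?H \<cdot> map0 ?G"
    using bG Ha I(6,7) by simp_all
  let ?t = "icomp C ?D (ncomp \<beta> \<cdot> map0 ?G) (map1 ?H \<cdot> ncomp \<alpha>)"
  have m: "tgt ?D \<cdot> map1 ?H \<cdot> ncomp \<alpha> = src ?D \<cdot> ncomp \<beta> \<cdot> map0 ?G" using 2 by simp
  note c = icomp[OF H(2) 1(2) 1(1) m]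
  note as = inat_elt[OF a A(1), unfolded e] inat_elt[OF a A(2), unfolded e]
  note HF = ifun_elt[OF J(1) F(4)] and HG = ifun_elt[OF J(1) G(4)] and KG = ifun_elt[OF J(2), unfolded J(3,4), OF G(4)]
  note Has = ifun_elt[OF J(1) as(1)] and Hat = ifun_elt[OF J(1) as(4)]
  note Gs = Comp_in_hom[OF A(1) G(3)] and Gt = Comp_in_hom[OF A(2) G(3)]
  note bGs = inat_elt[OF b Gs] and bGt = inat_elt[OF b Gt]
  have eq: "(ncomp \<beta> \<cdot> map0 ?G) \<cdot> tgt ?A = ncomp \<beta> \<cdot> map0 ?G \<cdot> tgt ?A"
    "(ncomp \<beta> \<cdot> map0 ?G) \<cdot> src ?A = ncomp \<beta> \<cdot> map0 ?G \<cdot> src ?A"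
    "(map1 ?H \<cdot> ncomp \<alpha>) \<cdot> tgt ?A = map1 ?H \<cdot> ncomp \<alpha> \<cdot> tgt ?A"
    "(map1 ?H \<cdot> ncomp \<alpha>) \<cdot> src ?A = map1 ?H \<cdot> ncomp \<alpha> \<cdot> src ?A"
    using Comp_assoc[OF A(2) G(3) J(5)] Comp_assoc[OF A(1) G(3) J(5)]
     Comp_assoc[OF A(2) I(5) H(4)] Comp_assoc[OF A(1) I(5) H(4)] by simp_all
  have "icomp C ?D (?t \<cdot> tgt ?A) (map1 ?H \<cdot> map1 ?F) =
     icomp C ?D (icomp C ?D (ncomp \<beta> \<cdot> map0 ?G \<cdot> tgt ?A) (map1 ?H \<cdot> ncomp \<alpha> \<cdot> tgt ?A)) (map1 ?H \<cdot> map1 ?F)"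
    using c(4)[OF A(2)] eq by simp
  also have "\<dots> = icomp C ?D (ncomp \<beta> \<cdot> map0 ?G \<cdot> tgt ?A) (icomp C ?D (map1 ?H \<cdot> ncomp \<alpha> \<cdot> tgt ?A) (map1 ?H \<cdot> map1 ?F))"
    by (rule icomp_assoc[OF pbs H(2) HF(1) Hat(1) bGt(1)]) (use HF Hat bGt F(6) as in simp_all)
  also have "\<dots> = icomp C ?D (ncomp \<beta> \<cdot> map0 ?G \<cdot> tgt ?A) (map1 ?H \<cdot> icomp C ?B (ncomp \<alpha> \<cdot> tgt ?A) (map1 ?F))"
    using ifun_icomp[OF J(1) F(4) as(4)] F(6) as(5) by simp
  also have "\<dots> = icomp C ?D (ncomp \<beta> \<cdot> map0 ?G \<cdot> tgt ?A) (map1 ?H \<cdot> icomp C ?B (map1 ?G) (ncomp \<alpha> \<cdot> src ?A))"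
    using inat_nat[OF a] e by simp
  also have "\<dots> = icomp C ?D (ncomp \<beta> \<cdot> map0 ?G \<cdot> tgt ?A) (icomp C ?D (map1 ?H \<cdot> map1 ?G) (map1 ?H \<cdot> ncomp \<alpha> \<cdot> src ?A))"
    using ifun_icomp[OF J(1) as(1) G(4)] G(5) as(3) by simp
  also have "\<dots> = icomp C ?D (icomp C ?D (ncomp \<beta> \<cdot> map0 ?G \<cdot> tgt ?A) (map1 ?H \<cdot> map1 ?G)) (map1 ?H \<cdot> ncomp \<alpha> \<cdot> src ?A)"
    by (rule icomp_assoc[OF pbs H(2) Has(1) HG(1) bGt(1), symmetric]) (use HG Has bGt G(5,6) as in simp_all)
  also have "icomp C ?D (ncomp \<beta> \<cdot> map0 ?G \<cdot> tgt ?A) (map1 ?H \<cdot> map1 ?G) =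
     icomp C ?D (map1 ?K \<cdot> map1 ?G) (ncomp \<beta> \<cdot> map0 ?G \<cdot> src ?A)"
    using inat_natural[OF b G(4)] G(5,6) by simp
  also have "icomp C ?D (icomp C ?D (map1 ?K \<cdot> map1 ?G) (ncomp \<beta> \<cdot> map0 ?G \<cdot> src ?A)) (map1 ?H \<cdot> ncomp \<alpha> \<cdot> src ?A)
    = icomp C ?D (map1 ?K \<cdot> map1 ?G) (icomp C ?D (ncomp \<beta> \<cdot> map0 ?G \<cdot> src ?A) (map1 ?H \<cdot> ncomp \<alpha> \<cdot> src ?A))"
    by (rule icomp_assoc[OF pbs H(2) Has(1) bGs(1) KG(1)]) (use KG Has bGs G(5,6) as in simp_all)
  also have "\<dots> = icomp C ?D (map1 ?K \<cdot> map1 ?G) (?t \<cdot> src ?A)"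
    using c(4)[OF A(1)] eq by simp
  finally have nat: "icomp C ?D (?t \<cdot> tgt ?A) (map1 ?H \<cdot> map1 ?F) = icomp C ?D (map1 ?K \<cdot> map1 ?G) (?t \<cdot> src ?A)" .
  have "is_ifun C (comp_ifun C ?H ?F)" "is_ifun C (comp_ifun C ?K ?G)"
    using ifun_comp_ifun I J e by simp_all
  then have "is_inat C \<lparr>ndom = comp_ifun C ?H ?F, ncod = comp_ifun C ?K ?G, ncomp = ?t\<rparr>"
    using nat c(1-3) 2 I(3,4) J(3,4) by (intro inatI) (simp_all add: comp_ifun_def)
  then show "is_inat C (HComp (ICat C) \<beta> \<alpha>)" by (simp add: ICat_def)
qed

lemma ICat_simps:
  "Obj (ICat C) = {A. is_icat C A}"
  "HomCat (ICat C) A B =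
        \<lparr>Obj = {F. is_ifun C F \<and> fdom F = A \<and> fcod F = B},
         Arr = {\<alpha>. is_inat C \<alpha> \<and> fdom (ndom \<alpha>) = A \<and> fcod (ndom \<alpha>) = B},
         Dom = ndom, Cod = ncod,
         Ident = (\<lambda>F. \<lparr>ndom = F, ncod = F, ncomp = unit_arr B \<cdot> map0 F\<rparr>),
         Comp = (\<lambda>\<beta> \<alpha>. \<lparr>ndom = ndom \<alpha>, ncod = ncod \<beta>,
                          ncomp = icomp C B (ncomp \<beta>) (ncomp \<alpha>)\<rparr>)\<rparr>"
   "HComp (ICat C) \<beta> \<alpha> =  \<lparr>ndom = comp_ifun C (ndom \<beta>) (ndom \<alpha>), ncod = comp_ifun C (ncod \<beta>) (ncod \<alpha>),
         ncomp = icomp C (fcod (ndom \<beta>))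
                   (ncomp \<beta> \<cdot> map0 (ncod \<alpha>)) (map1 (ndom \<beta>) \<cdot> ncomp \<alpha>)\<rparr>"
   "Comp (ICat C) = comp_ifun C" 
   "Ident (ICat C) A = \<lparr>fdom = A, fcod = A, map0 = Ident C (Ob0 A), map1 = Ident C (Ob1 A)\<rparr>"
  by (simp_all add: ICat_def)

lemma interchange:
  assumes a: "is_inat C \<alpha>" and a': "is_inat C \<alpha>'" and b: "is_inat C \<beta>" and b': "is_inat C \<beta>'"
    and e: "fdom (ndom \<beta>) = fcod (ndom \<alpha>)" "ndom \<alpha>' = ncod \<alpha>" "ndom \<beta>' = ncod \<beta>"
  defines "D \<equiv> fcod (ndom \<beta>)" and "B \<equiv> fcod (ndom \<alpha>)"
  shows "icomp C D (icomp C D (ncomp \<beta>') (ncomp \<beta>) \<cdot> map0 (ncod \<alpha>'))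
            (map1 (ndom \<beta>) \<cdot> icomp C B (ncomp \<alpha>') (ncomp \<alpha>)) =
         icomp C D (icomp C D (ncomp \<beta>' \<cdot> map0 (ncod \<alpha>')) (map1 (ndom \<beta>') \<cdot> ncomp \<alpha>'))
            (icomp C D (ncomp \<beta> \<cdot> map0 (ncod \<alpha>)) (map1 (ndom \<beta>) \<cdot> ncomp \<alpha>))"
proof -
  let ?H = "ndom \<beta>" and ?K = "ncod \<beta>" and ?L = "ncod \<beta>'" and ?F = "ndom \<alpha>" and ?G = "ncod \<alpha>" and ?M = "ncod \<alpha>'"
  note I = inat[OF a, folded B_def] and J = inat[OF b, folded D_def, unfolded e, folded B_def]
  have dd: "fdom ?H = B" "fcod ?H = D" "fdom ?G = fdom ?F" "fcod ?G = B" "fcod ?F = B" "fdom ?K = B" "fcod ?K = D"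
    using e I J by (auto simp: B_def D_def)
  note I' = inat[OF a', unfolded e dd] and J' = inat[OF b', unfolded e dd]
  note H = ifun[OF J(1), unfolded dd] and G = ifun[OF I(2), unfolded dd] and M = ifun[OF I'(2), unfolded I' dd] and K = ifun[OF J(2), unfolded dd]
  have mb: "tgt D \<cdot> ncomp \<beta> = src D \<cdot> ncomp \<beta>'" and ma: "tgt B \<cdot> ncomp \<alpha> = src B \<cdot> ncomp \<alpha>'"
    using J(7) J'(6) I(7) I'(6) by simp_all
  have 1: "icomp C D (ncomp \<beta>') (ncomp \<beta>) \<cdot> map0 ?M = icomp C D (ncomp \<beta>' \<cdot> map0 ?M) (ncomp \<beta> \<cdot> map0 ?M)"
    by (rule icomp(4)[OF H(2) J(5) J'(5) mb M(3)])
  have 2: "map1 ?H \<cdot> icomp C B (ncomp \<alpha>') (ncomp \<alpha>) = icomp C D (map1 ?H \<cdot> ncomp \<alpha>') (map1 ?H \<cdot> ncomp \<alpha>)"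
    using ifun_icomp[OF J(1), unfolded dd, OF I(5) I'(5) ma] .
  note bM = inat_elt[OF b, unfolded dd, OF M(3)] and bM' = inat_elt[OF b', unfolded e dd, OF M(3)]
    and bG = inat_elt[OF b, unfolded dd, OF G(3)]
    and Ha = ifun_elt[OF J(1), unfolded dd, OF I(5)] and Ha' = ifun_elt[OF J(1), unfolded dd, OF I'(5)]
    and Ka' = ifun_elt[OF J(2), unfolded dd, OF I'(5)]
  note HH = icomp[OF H(2) Ha(1) Ha'(1)]
  have t: "tgt D \<cdot> map1 ?H \<cdot> ncomp \<alpha> = src D \<cdot> map1 ?H \<cdot> ncomp \<alpha>'"
    "tgt D \<cdot> map1 ?H \<cdot> ncomp \<alpha>' = src D \<cdot> ncomp \<beta> \<cdot> map0 ?M"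
    "tgt D \<cdot> ncomp \<beta> \<cdot> map0 ?M = src D \<cdot> ncomp \<beta>' \<cdot> map0 ?M"
    "tgt D \<cdot> map1 ?H \<cdot> ncomp \<alpha> = src D \<cdot> ncomp \<beta> \<cdot> map0 ?G"
    "tgt D \<cdot> ncomp \<beta> \<cdot> map0 ?G = src D \<cdot> map1 ?K \<cdot> ncomp \<alpha>'"
    "tgt D \<cdot> map1 ?K \<cdot> ncomp \<alpha>' = src D \<cdot> ncomp \<beta>' \<cdot> map0 ?M"
    using bM bM' bG Ha Ha' Ka' I(6,7) I'(6,7) by simp_all
  note T1 = icomp[OF H(2) Ha(1) Ha'(1) t(1)] and T2 = icomp[OF H(2) Ha'(1) bM(1) t(2)]
    and T4 = icomp[OF H(2) Ha(1) bG(1) t(4)] and T3 = icomp[OF H(2) bM(1) bM'(1) t(3)]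
  have n: "icomp C D (ncomp \<beta> \<cdot> map0 ?M) (map1 ?H \<cdot> ncomp \<alpha>') = icomp C D (map1 ?K \<cdot> ncomp \<alpha>') (ncomp \<beta> \<cdot> map0 ?G)"
    using inat_natural[OF b, unfolded dd, OF I'(5)] I'(6,7) by simp
  have "icomp C D (icomp C D (ncomp \<beta>' \<cdot> map0 ?M) (ncomp \<beta> \<cdot> map0 ?M)) (icomp C D (map1 ?H \<cdot> ncomp \<alpha>') (map1 ?H \<cdot> ncomp \<alpha>)) =
    icomp C D (ncomp \<beta>' \<cdot> map0 ?M) (icomp C D (ncomp \<beta> \<cdot> map0 ?M) (icomp C D (map1 ?H \<cdot> ncomp \<alpha>') (map1 ?H \<cdot> ncomp \<alpha>)))"
    by (rule icomp_assoc[OF pbs H(2) T1(1) bM(1) bM'(1)]) (use T1 t in simp_all)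
  also have "\<dots> = icomp C D (ncomp \<beta>' \<cdot> map0 ?M) (icomp C D (icomp C D (ncomp \<beta> \<cdot> map0 ?M) (map1 ?H \<cdot> ncomp \<alpha>')) (map1 ?H \<cdot> ncomp \<alpha>))"
    using icomp_assoc[OF pbs H(2) Ha(1) Ha'(1) bM(1) t(1,2)] by simp
  also have "\<dots> = icomp C D (ncomp \<beta>' \<cdot> map0 ?M) (icomp C D (map1 ?K \<cdot> ncomp \<alpha>') (icomp C D (ncomp \<beta> \<cdot> map0 ?G) (map1 ?H \<cdot> ncomp \<alpha>)))"
    using icomp_assoc[OF pbs H(2) Ha(1) bG(1) Ka'(1) t(4,5)] n by simp
  also have "\<dots> = icomp C D (icomp C D (ncomp \<beta>' \<cdot> map0 ?M) (map1 ?K \<cdot> ncomp \<alpha>')) (icomp C D (ncomp \<beta> \<cdot> map0 ?G) (map1 ?H \<cdot> ncomp \<alpha>))"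
    by (rule icomp_assoc[OF pbs H(2) T4(1) Ka'(1) bM'(1), symmetric]) (use T4 t in simp_all)
  finally show ?thesis unfolding 1 2 e .
qed

theorem two_category_ICat: "two_category (ICat C)"
proof (rule two_category.intro[OF ICat_category], rule two_category_axioms.intro)
  show "category (HomCat (ICat C) A B)" if "A \<in> Obj (ICat C)" "B \<in> Obj (ICat C)" for A B
    using that HomCat_cat by (simp add: ICat_simps(1))
  show "Obj (HomCat (ICat C) A B) = hom (ICat C) A B" if "A \<in> Obj (ICat C)" "B \<in> Obj (ICat C)" for A B
    by (auto simp: ICat_def hom_def)
next
  fix A B D assume "A \<in> Obj (ICat C)" "B \<in> Obj (ICat C)" "D \<in> Obj (ICat C)"
  show "is_functor (prod_cat (HomCat (ICat C) B D) (HomCat (ICat C) A B)) (HomCat (ICat C) A D)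
           \<lparr>fobj = \<lambda>(g, f). g \<cdot>\<^bsub>ICat C\<^esub> f, farr = \<lambda>(\<beta>, \<alpha>). HComp (ICat C) \<beta> \<alpha>\<rparr>"
    unfolding is_functor_def
  proof (intro conjI ballI impI)
    let ?P = "prod_cat (HomCat (ICat C) B D) (HomCat (ICat C) A B)" and ?Q = "HomCat (ICat C) A D"
    let ?F = "\<lparr>fobj = \<lambda>(g, f). g \<cdot>\<^bsub>ICat C\<^esub> f, farr = \<lambda>(\<beta>, \<alpha>). HComp (ICat C) \<beta> \<alpha>\<rparr>"
    { fix X assume "X \<in> Obj ?P"
      then obtain G F where X: "X = (G, F)" "is_ifun C F" "is_ifun C G" "fdom F = A" "fcod F = B" "fdom G = B" "fcod G = D"
        by (cases X) (auto simp: prod_cat_def ICat_simps)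
      then show "fobj ?F X \<in> Obj ?Q" using ifun_comp_ifun[of F G] by (simp add: ICat_simps) (simp add: comp_ifun_def)
      note f = ifun[OF X(2), unfolded X] and g = ifun[OF X(3), unfolded X]
      note B = icat_homs[OF g(1)] and D = icat_homs[OF g(2)]
      have u: "map1 G \<cdot> unit_arr B \<cdot> map0 F = unit_arr D \<cdot> map0 G \<cdot> map0 F"
        using ifun_unit_elt[OF X(3), unfolded X, OF f(3)] by simp
      have as: "(unit_arr D \<cdot> map0 G) \<cdot> map0 F = unit_arr D \<cdot> map0 G \<cdot> map0 F"
        by (rule Comp_assoc[OF f(3) g(3) D(3)])
      note h = Comp_in_hom[OF f(3) g(3)]
      note ue = unit_elt[OF g(2) h]
      have "icomp C D (unit_arr D \<cdot> map0 G \<cdot> map0 F) (unit_arr D \<cdot> map0 G \<cdot> map0 F) = unit_arr D \<cdot> map0 G \<cdot> map0 F"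
        using icomp_unit(1)[OF g(2) ue(1)] ue by simp
      then show "farr ?F (Ident ?P X) = Ident ?Q (fobj ?F X)"
        using X u as by (simp add: prod_cat_def ICat_simps) (simp add: comp_ifun_def) }
    { fix X assume "X \<in> Arr ?P"
      then obtain b a where X: "X = (b, a)" "is_inat C a" "is_inat C b" "fdom (ndom a) = A" "fcod (ndom a) = B" "fdom (ndom b) = B" "fcod (ndom b) = D"
        by (cases X) (auto simp: prod_cat_def ICat_simps)
      have "is_inat C (HComp (ICat C) b a)" using inat_hcomp(1)[OF X(2,3)] X by simp
      then show "farr ?F X \<in> hom ?Q (fobj ?F (Dom ?P X)) (fobj ?F (Cod ?P X))"
        using X by (auto simp: hom_def prod_cat_def ICat_simps) (auto simp: comp_ifun_def) }
    { fix X Y assume "X \<in> Arr ?P" "Y \<in> Arr ?P" and c: "Cod ?P X = Dom ?P Y"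
      then obtain b a b' a' where X: "X = (b, a)" "is_inat C a" "is_inat C b" "fdom (ndom a) = A" "fcod (ndom a) = B" "fdom (ndom b) = B" "fcod (ndom b) = D"
        and Y: "Y = (b', a')" "is_inat C a'" "is_inat C b'"  "fdom (ndom a') = A" "fcod (ndom a') = B" "fdom (ndom b') = B" "fcod (ndom b') = D"
        by (cases X, cases Y) (auto simp: prod_cat_def ICat_simps)
      have e: "ndom a' = ncod a" "ndom b' = ncod b" using c X Y by (auto simp: prod_cat_def ICat_simps)
      have d: "fcod (ncod b) = D" using Y e by simp
      show "farr ?F (Y \<cdot>\<^bsub>?P\<^esub> X) = farr ?F Y \<cdot>\<^bsub>?Q\<^esub> farr ?F X"
        using interchange[OF X(2) Y(2) X(3) Y(3) _ e] X Y e d by (simp add: prod_cat_def ICat_simps) }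
  qed
next
  fix A B D D' a b c
  assume "a \<in> Arr (HomCat (ICat C) A B)" "b \<in> Arr (HomCat (ICat C) B D)" "c \<in> Arr (HomCat (ICat C) D D')"
  then have X: "is_inat C a" "is_inat C b" "is_inat C c" "fdom (ndom a) = A" "fcod (ndom a) = B" "fdom (ndom b) = B" "fcod (ndom b) = D"
     "fdom (ndom c) = D" "fcod (ndom c) = D'" by (auto simp: ICat_simps)
  note I = inat[OF X(1), unfolded X] and J = inat[OF X(2), unfolded X] and K = inat[OF X(3), unfolded X]
  note f0 = ifun[OF I(1), unfolded X] and f1 = ifun[OF I(2), unfolded I X] and g0 = ifun[OF J(1), unfolded X] and g1 = ifun[OF J(2), unfolded J X]
    and k0 = ifun[OF K(1), unfolded X] and k1 = ifun[OF K(2), unfolded K X]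
  have cc: "comp_ifun C (comp_ifun C (ndom c) (ndom b)) (ndom a) = comp_ifun C (ndom c) (comp_ifun C (ndom b) (ndom a))"
    "comp_ifun C (comp_ifun C (ncod c) (ncod b)) (ncod a) = comp_ifun C (ncod c) (comp_ifun C (ncod b) (ncod a))"
    using Comp_assoc[OF f0(3) g0(3) k0(3)] Comp_assoc[OF f0(4) g0(4) k0(4)] Comp_assoc[OF f1(3) g1(3) k1(3)] Comp_assoc[OF f1(4) g1(4) k1(4)]
    by (simp_all add: comp_ifun_def)
  note ba = inat_hcomp[OF X(1,2), unfolded X] and cb = inat_hcomp[OF X(2,3), unfolded X]
  have mcb: "tgt D' \<cdot> map1 (ndom c) \<cdot> ncomp b = src D' \<cdot> ncomp c \<cdot> map0 (ncod b)" using cb by simp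
  have mba: "tgt D \<cdot> map1 (ndom b) \<cdot> ncomp a = src D \<cdot> ncomp b \<cdot> map0 (ncod a)" using ba by simp
  have 1: "icomp C D' (ncomp c \<cdot> map0 (ncod b)) (map1 (ndom c) \<cdot> ncomp b) \<cdot> map0 (ncod a) =
     icomp C D' (ncomp c \<cdot> map0 (ncod b) \<cdot> map0 (ncod a)) (map1 (ndom c) \<cdot> ncomp b \<cdot> map0 (ncod a))"
    using icomp(4)[OF k0(2) cb(3,2) mcb f1(3)] Comp_assoc[OF f1(3) g1(3) K(5)] Comp_assoc[OF f1(3) J(5) k0(4)] by simp
  have 2: "map1 (ndom c) \<cdot> icomp C D (ncomp b \<cdot> map0 (ncod a)) (map1 (ndom b) \<cdot> ncomp a) =
    icomp C D' (map1 (ndom c) \<cdot> ncomp b \<cdot> map0 (ncod a)) (map1 (ndom c) \<cdot> map1 (ndom b) \<cdot> ncomp a)"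
    using ifun_icomp[OF K(1), unfolded X, OF ba(3,2) mba] by simp
  note bf = ifun_elt[OF K(1), unfolded X, OF ba(2)] and ga = ifun_elt[OF K(1), unfolded X, OF ba(3)]
    and cg = inat_elt[OF X(3), unfolded X, OF Comp_in_hom[OF f1(3) g1(3)]]
  have "icomp C D' (icomp C D' (ncomp c \<cdot> map0 (ncod b) \<cdot> map0 (ncod a)) (map1 (ndom c) \<cdot> ncomp b \<cdot> map0 (ncod a)))
      (map1 (ndom c) \<cdot> map1 (ndom b) \<cdot> ncomp a) =
     icomp C D' (ncomp c \<cdot> map0 (ncod b) \<cdot> map0 (ncod a)) (icomp C D' (map1 (ndom c) \<cdot> ncomp b \<cdot> map0 (ncod a)) (map1 (ndom c) \<cdot> map1 (ndom b) \<cdot> ncomp a))"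
    by (rule icomp_assoc[OF pbs k0(2) ga(1) bf(1) cg(1)]) (use bf ga cg ba in simp_all)
  then show "HComp (ICat C) (HComp (ICat C) c b) a = HComp (ICat C) c (HComp (ICat C) b a)"
    using cc 1 2 X Comp_assoc[OF I(5) g0(4) k0(4)] by (simp add: ICat_simps) (simp add: comp_ifun_def)
next
  fix A B a assume "a \<in> Arr (HomCat (ICat C) A B)"
  then have X: "is_inat C a" "fdom (ndom a) = A" "fcod (ndom a) = B" by (auto simp: ICat_simps)
  note I = inat[OF X(1), unfolded X]
  note f0 = ifun[OF I(1), unfolded X] and f1 = ifun[OF I(2), unfolded I X]
  note A = icat_homs[OF f0(1)] and B = icat_homs[OF f0(2)]
  have i: "comp_ifun C (ndom a) (Ident (ICat C) A) = ndom a" "comp_ifun C (ncod a) (Ident (ICat C) A) = ncod a"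
    "comp_ifun C (Ident (ICat C) B) (ndom a) = ndom a" "comp_ifun C (Ident (ICat C) B) (ncod a) = ncod a"
    using X I(3,4) Comp_Ident[OF f0(3)] Comp_Ident[OF f0(4)] Comp_Ident[OF f1(3)] Comp_Ident[OF f1(4)] 
     Ident_Comp[OF f0(3)] Ident_Comp[OF f0(4)] Ident_Comp[OF f1(3)] Ident_Comp[OF f1(4)] 
    by (simp_all add: ICat_simps comp_ifun_def)
  show "HComp (ICat C) a (Ident (HomCat (ICat C) A A) (Ident (ICat C) A)) = a"
    using i icomp_unit(1)[OF f0(2) I(5)] I(6) X Comp_Ident[OF A(3)] Comp_Ident[OF I(5)] f0(7)
    by (simp add: ICat_simps)
  show "HComp (ICat C) (Ident (HomCat (ICat C) B B) (Ident (ICat C) B)) a = a"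
    using i icomp_unit(2)[OF f0(2) I(5)] I(7) X Comp_Ident[OF B(3)] Ident_Comp[OF I(5)]
    by (simp add: ICat_simps)
qed

end
end

end

theory Submission
  imports Defs
begin

text \<open>A functor out of the product \<open>2 \<times> A\<close> is determined by its values on copies of \<open>A\<close>: since
  \<open>E\<close> is cartesian closed, \<open>\<hyphen> \<times> Y\<close> preserves the presentation of \<open>F X\<close> as a coproduct of
  points, so the objects, arrows and composable pairs of \<open>2 \<times> A\<close> are coproducts of two, three and
  four copies of those of \<open>A\<close>.  The functors \<open>2 \<times> A \<rightarrow> B\<close> are therefore the natural transformations
  between functors \<open>A \<rightarrow> B\<close>, and the natural transformations between them are the commutative
  squares.

  For the power, the exponential gives \<open>K(A, H) \<cong> K(A \<times> 2, B)\<close> on objects only.  The 2-cells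
  between arrows \<open>A \<rightarrow> H\<close> are the arrows \<open>A \<times> 2 \<rightarrow> H\<close>, hence the arrows
  \<open>(A \<times> 2) \<times> 2 \<rightarrow> B\<close>, and two applications of the copower property identify these with the
  arrows of \<open>Cat(2, K(A, B))\<close>.\<close>

text \<open>\<open>is_power\<close> and \<open>is_copower\<close> ask for a whole family of
  isomorphisms together with its 2-naturality. By Yoneda such a family amounts to one universal
  2-cell, its value at an identity, so the universal properties are proved in the form
  \<open>copower_cell\<close> and \<open>power_cell\<close>: the isomorphisms are whiskerings with
  that cell, and 2-naturality becomes associativity of whiskering. For the copower the universal
  cell joins the two ends of 2 x A, its components being the identities of A placed over the arrow
  of 2; for the power it is that cell on H followed by evaluation.

  Products and exponentials of internal categories are given by their universal properties alone, so
  a product has to be compared with the componentwise one before it can be split into copies. A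
  functor out of 2 x A is given on objects and arrows, which calls for extension along the copies
  there; its compatibility with composition is an equation on composable pairs, which calls for the
  copies of these to be jointly epic.\<close>

lemma homI: "\<lbrakk>f \<in> Arr C; Dom C f = A; Cod C f = B\<rbrakk> \<Longrightarrow> f \<in> hom C A B"
  by (simp add: hom_def)

section \<open>Arrows typed by domain and codomain\<close>

context category begin

text \<open>The laws of \<open>category\<close> mention the objects of each hom set. The versions
  collected in \<open>arr_simps\<close> have conditions on \<open>Dom\<close> and \<open>Cod\<close>
  instead, so that they can serve as rewrite rules with nothing left to instantiate.\<close>

lemma Comp_Arr:
  assumes "f \<in> Arr C" "g \<in> Arr C" "Cod C f = Dom C g"
  shows "g \<cdot> f \<in> Arr C" "Dom C (g \<cdot> f) = Dom C f" "Cod C (g \<cdot> f) = Cod C g"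
  using Comp_in_hom[of f "Dom C f" "Cod C f" g "Cod C g"] assms by (auto simp: hom_def)

lemma assoc_Arr:
  assumes "f \<in> Arr C" "g \<in> Arr C" "h \<in> Arr C" "Cod C f = Dom C g" "Cod C g = Dom C h"
  shows "(h \<cdot> g) \<cdot> f = h \<cdot> (g \<cdot> f)"
  using Comp_assoc[of f "Dom C f" "Cod C f" g "Cod C g" h "Cod C h"] assms by (auto simp: hom_def)

lemma Ident_Arr:
  assumes "A \<in> Obj C"
  shows "Ident C A \<in> Arr C" "Dom C (Ident C A) = A" "Cod C (Ident C A) = A"
  using Ident_in_hom[OF assms] by (auto simp: hom_def)

lemma Comp_Ident_Arr: "f \<in> Arr C \<Longrightarrow> Dom C f = A \<Longrightarrow> f \<cdot> Ident C A = f"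
  using Comp_Ident[of f A "Cod C f"] by (simp add: hom_def)

lemma Ident_Comp_Arr: "f \<in> Arr C \<Longrightarrow> Cod C f = A \<Longrightarrow> Ident C A \<cdot> f = f"
  using Ident_Comp[of f "Dom C f" A] by (simp add: hom_def)

lemmas arr_simps = Comp_Arr assoc_Arr Ident_Arr Comp_Ident_Arr Ident_Comp_Arr Dom_in_Obj Cod_in_Obj

end

section \<open>Functors from the walking arrow\<close>

text \<open>The functor that picks out the arrow \<open>t\<close>. The restriction to
  \<open>Arr walking_arrow\<close> makes it extensional, as the objects of
  \<open>functor_cat\<close> must be; \<open>fobj\<close> is so already, both booleans being
  objects.\<close>

definition arrow_diagram :: "('o, 'm, 'z) cat_scheme \<Rightarrow> 'm \<Rightarrow> (bool, bool \<times> bool, 'o, 'm) funct" where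
  "arrow_diagram D t =
     \<lparr>fobj = \<lambda>j. if j then Cod D t else Dom D t,
      farr = \<lambda>x \<in> Arr walking_arrow.
        if fst x = snd x then Ident D (if fst x then Cod D t else Dom D t) else t\<rparr>"

lemma fobj_arrow_diagram [simp]:
  "fobj (arrow_diagram D t) j = (if j then Cod D t else Dom D t)"
  by (simp add: arrow_diagram_def)

lemma farr_arrow_diagram [simp]: "farr (arrow_diagram D t) (False, True) = t"
  by (simp add: arrow_diagram_def walking_arrow_def)

lemma arrow_diagram_eqD: "arrow_diagram D t = arrow_diagram D t' \<Longrightarrow> t = t'"
  by (metis farr_arrow_diagram)

lemma walking_arrow_simps [simp]:
  "Obj walking_arrow = UNIV"
  "Arr walking_arrow = {(False, False), (False, True), (True, True)}"
  "Dom walking_arrow x = fst x" "Cod walking_arrow x = snd x" "Ident walking_arrow j = (j, j)"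
  "g \<cdot>\<^bsub>walking_arrow\<^esub> f = (fst f, snd g)"
  unfolding walking_arrow_def by (auto simp: le_bool_def)

text \<open>The values on the identities are forced, so a functor is its value on the one remaining
  arrow. The equality of sets is literal because the objects of \<open>functor_cat\<close> are
  extensional.\<close>

lemma (in category) Obj_functor_cat_walking_arrow:
  "Obj (functor_cat walking_arrow C) = arrow_diagram C ` Arr C"
proof (intro subset_antisym subsetI)
  fix X assume "X \<in> arrow_diagram C ` Arr C"
  then show "X \<in> Obj (functor_cat walking_arrow C)"
    by (auto simp: functor_cat_def is_functor_def arrow_diagram_def hom_def arr_simps)
next
  fix X assume "X \<in> Obj (functor_cat walking_arrow C)"
  then have X: "is_functor walking_arrow C X" "farr X \<in> extensional (Arr walking_arrow)"
    by (auto simp: functor_cat_def)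
  let ?t = "farr X (False, True)"
  have t: "?t \<in> hom C (fobj X False) (fobj X True)"
    using X(1) by (auto simp: is_functor_def)
  have i: "farr X (j, j) = Ident C (fobj X j)" for j
    using X(1) by (auto simp: is_functor_def)
  \<comment> \<open>The only pair off the carrier is \<open>(True, False)\<close>, where both sides
    are \<open>undefined\<close>.\<close>
  have "farr X x = farr (arrow_diagram C ?t) x" for x
  proof (cases "x \<in> Arr walking_arrow")
    case True
    then show ?thesis using t i by (auto simp: arrow_diagram_def hom_def)
  next
    case False
    then show ?thesis
      by (simp add: arrow_diagram_def extensional_arb[OF X(2) False] del: walking_arrow_simps)
  qed
  moreover have "fobj X j = fobj (arrow_diagram C ?t) j" for j
    using t by (auto simp: hom_def)
  moreover have "funct.more X = funct.more (arrow_diagram C ?t)" by simp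
  ultimately have "X = arrow_diagram C ?t" by (intro funct.equality ext)
  then show "X \<in> arrow_diagram C ` Arr C" by (rule image_eqI[OF _ hom_Arr(1)[OF t]])
qed

text \<open>Naturality at the two identities is automatic, which leaves the square at
  \<open>(False, True)\<close>. Extensionality puts no condition on \<open>\<theta>\<close>, since
  every boolean is an object.\<close>

lemma (in category) Arr_functor_cat_walking_arrow:
  "(X, Y, \<theta>) \<in> Arr (functor_cat walking_arrow C) \<longleftrightarrow>
     (\<exists>t \<in> Arr C. \<exists>t' \<in> Arr C. X = arrow_diagram C t \<and> Y = arrow_diagram C t' \<and>
        \<theta> False \<in> hom C (Dom C t) (Dom C t') \<and> \<theta> True \<in> hom C (Cod C t) (Cod C t') \<and>
        t' \<cdot> \<theta> False = \<theta> True \<cdot> t)"  (is "?l \<longleftrightarrow> ?r")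
proof -
  have *: "Arr (functor_cat J C) = {(F, G, \<tau>). F \<in> Obj (functor_cat J C) \<and> G \<in> Obj (functor_cat J C) \<and>
        is_nat_trans J C F G \<tau> \<and> \<tau> \<in> extensional (Obj J)}" for J :: "(bool, bool \<times> bool) cat"
    by (simp add: functor_cat_def Let_def)
  have "is_nat_trans walking_arrow C (arrow_diagram C t) (arrow_diagram C t') \<theta> \<longleftrightarrow>
      \<theta> False \<in> hom C (Dom C t) (Dom C t') \<and> \<theta> True \<in> hom C (Cod C t) (Cod C t') \<and>
        t' \<cdot> \<theta> False = \<theta> True \<cdot> t" if "t \<in> Arr C" "t' \<in> Arr C" for t t'
    using that by (auto simp: is_nat_trans_def arrow_diagram_def hom_def arr_simps all_bool_eq)
  then show ?thesis unfolding * Obj_functor_cat_walking_arrow by auto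
qed

lemma functor_cat_simps:
  "Dom (functor_cat J C) (X, Y, \<theta>) = X" "Cod (functor_cat J C) (X, Y, \<theta>) = Y"
  "Ident (functor_cat J C) X = (X, X, \<lambda>j \<in> Obj J. Ident C (fobj X j))"
  "(Y', Z, \<theta>') \<cdot>\<^bsub>functor_cat J C\<^esub> (X, Y, \<theta>) = (X, Z, \<lambda>j \<in> Obj J. \<theta>' j \<cdot>\<^bsub>C\<^esub> \<theta> j)"
  by (simp_all add: functor_cat_def Let_def)

lemma functor_cat_map_arrow_diagram:
  assumes "is_functor C D P" "category C" "t \<in> Arr C"
  shows "fobj (functor_cat_map walking_arrow P) (arrow_diagram C t) = arrow_diagram D (farr P t)"
proof -
  interpret category C by fact
  have "farr P t \<in> hom D (fobj P (Dom C t)) (fobj P (Cod C t))"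
     "farr P (Ident C (Dom C t)) = Ident D (fobj P (Dom C t))"
     "farr P (Ident C (Cod C t)) = Ident D (fobj P (Cod C t))"
    using assms Dom_in_Obj Cod_in_Obj by (auto simp: is_functor_def)
  then show ?thesis
    by (auto simp: functor_cat_map_def Let_def arrow_diagram_def hom_def fun_eq_iff)
qed

text \<open>The inverse of a bijective functor is a functor: each law for the inverse holds after
  applying \<open>F\<close>, and \<open>F\<close> is injective on arrows. That \<open>C\<close> is a
  category puts the identities and composites in question into \<open>Arr C\<close>.\<close>

lemma is_cat_isoI:
  assumes "is_functor C D F" "bij_betw (fobj F) (Obj C) (Obj D)" "bij_betw (farr F) (Arr C) (Arr D)"
    and "category C"
  shows "is_cat_iso C D F"
proof -
  interpret C: category C by fact
  let ?g = "inv_into (Obj C) (fobj F)" and ?h = "inv_into (Arr C) (farr F)"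
  note o = bij_betw_inv_into_left[OF assms(2)] bij_betw_inv_into_right[OF assms(2)]
    and a = bij_betw_inv_into_left[OF assms(3)] bij_betw_inv_into_right[OF assms(3)]
  have go: "?g B \<in> Obj C" if "B \<in> Obj D" for B
    using that assms(2) bij_betw_apply bij_betw_inv_into by metis
  have ha: "?h f \<in> Arr C" if "f \<in> Arr D" for f
    using that assms(3) bij_betw_apply bij_betw_inv_into by metis
  have F: "farr F f \<in> Arr D" "Dom D (farr F f) = fobj F (Dom C f)" "Cod D (farr F f) = fobj F (Cod C f)"
    if "f \<in> Arr C" for f
    using that assms(1) by (auto simp: is_functor_def hom_def)
  have dc: "Dom C (?h f) = ?g (Dom D f)" "Cod C (?h f) = ?g (Cod D f)" if "f \<in> Arr D" for f
    using F[OF ha[OF that]] a(2)[OF that] o(1)[OF C.Dom_in_Obj[OF ha[OF that]]]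
      o(1)[OF C.Cod_in_Obj[OF ha[OF that]]] by auto
  have "is_functor D C \<lparr>fobj = ?g, farr = ?h\<rparr>"
    unfolding is_functor_def
  proof (intro conjI ballI impI; simp)
    show "?g B \<in> Obj C" if "B \<in> Obj D" for B by (rule go[OF that])
    show "?h f \<in> hom C (?g (Dom D f)) (?g (Cod D f))" if "f \<in> Arr D" for f
      using ha dc that by (simp add: hom_def)
    show "?h (Ident D B) = Ident C (?g B)" if "B \<in> Obj D" for B
    proof -
      have "farr F (Ident C (?g B)) = Ident D B"
        using assms(1) go[OF that] o(2)[OF that] by (simp add: is_functor_def)
      then show ?thesis using a(1)[OF C.Ident_Arr(1)[OF go[OF that]]] by simp
    qed
    show "?h (g \<cdot>\<^bsub>D\<^esub> f) = ?h g \<cdot>\<^bsub>C\<^esub> ?h f"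
      if f: "f \<in> Arr D" and g: "g \<in> Arr D" and e: "Cod D f = Dom D g" for f g
    proof -
      have e': "Cod C (?h f) = Dom C (?h g)" using dc f g e by simp
      have "farr F (?h g \<cdot>\<^bsub>C\<^esub> ?h f) = g \<cdot>\<^bsub>D\<^esub> f"
        using assms(1) ha[OF f] ha[OF g] e' a(2)[OF f] a(2)[OF g] by (simp add: is_functor_def)
      then show ?thesis using a(1)[OF C.Comp_Arr(1)[OF ha[OF f] ha[OF g] e']] by simp
    qed
  qed
  then show ?thesis
    unfolding is_cat_iso_def using assms(1) o a by (intro conjI exI[of _ "\<lparr>fobj = ?g, farr = ?h\<rparr>"]) auto
qed

text \<open>An object goes to its component of \<open>t\<close>, an arrow \<open>f\<close> to its
  naturality square with sides \<open>G False f\<close> and \<open>G True f\<close>;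
  \<open>d\<close> and \<open>c\<close> stand for domain and codomain. The two functors enter by
  their arrow parts, since their values on objects are the ends of \<open>t\<close>.\<close>

definition arrow_functor ::
  "('p, 'n, 'z) cat_scheme \<Rightarrow> (bool \<Rightarrow> 'm \<Rightarrow> 'n) \<Rightarrow> ('o \<Rightarrow> 'n) \<Rightarrow> ('m \<Rightarrow> 'o) \<Rightarrow> ('m \<Rightarrow> 'o) \<Rightarrow>
   ('o, 'm, (bool, bool \<times> bool, 'p, 'n) funct,
    (bool, bool \<times> bool, 'p, 'n) funct \<times> (bool, bool \<times> bool, 'p, 'n) funct \<times> (bool \<Rightarrow> 'n)) funct" where
  "arrow_functor D G t d c =
     \<lparr>fobj = \<lambda>X. arrow_diagram D (t X),
      farr = \<lambda>f. (arrow_diagram D (t (d f)), arrow_diagram D (t (c f)), \<lambda>j. G j f)\<rparr>"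

text \<open>A functor into \<open>functor_cat walking_arrow D\<close> amounts to a natural transformation \<open>t\<close> from
  \<open>G False\<close> to \<open>G True\<close>; the remaining hypotheses make it bijective on objects and on arrows.\<close>

lemma arrow_functor_iso:
  fixes C :: "('o, 'm, 'y) cat_scheme" and D :: "('p, 'n, 'z) cat_scheme"
  assumes C: "category C" and D: "category D"
    and G: "\<And>j. is_functor C D (G j)" and t: "is_nat_trans C D (G False) (G True) t"
    and ex1: "\<And>a. a \<in> Arr D \<Longrightarrow> \<exists>X \<in> Obj C. t X = a"
    and un1: "\<And>X Y. \<lbrakk>X \<in> Obj C; Y \<in> Obj C; t X = t Y\<rbrakk> \<Longrightarrow> X = Y"
    and ex2: "\<And>X Y a b. \<lbrakk>X \<in> Obj C; Y \<in> Obj C; a \<in> hom D (fobj (G False) X) (fobj (G False) Y);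
         b \<in> hom D (fobj (G True) X) (fobj (G True) Y); t Y \<cdot>\<^bsub>D\<^esub> a = b \<cdot>\<^bsub>D\<^esub> t X\<rbrakk> \<Longrightarrow>
         \<exists>f \<in> hom C X Y. farr (G False) f = a \<and> farr (G True) f = b"
    and un2: "\<And>X Y f g. \<lbrakk>f \<in> hom C X Y; g \<in> hom C X Y; farr (G False) f = farr (G False) g;
         farr (G True) f = farr (G True) g\<rbrakk> \<Longrightarrow> f = g"
  shows "is_cat_iso C (functor_cat walking_arrow D) (arrow_functor D (\<lambda>j. farr (G j)) t (Dom C) (Cod C))"
    (is "is_cat_iso C ?D ?F")
proof -
  interpret C: category C by fact
  interpret D: category D by fact
  have tt: "t X \<in> Arr D" "Dom D (t X) = fobj (G False) X" "Cod D (t X) = fobj (G True) X" if "X \<in> Obj C" for X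
    using t that by (auto simp: is_nat_trans_def hom_def)
  have nat: "t (Cod C f) \<cdot>\<^bsub>D\<^esub> farr (G False) f = farr (G True) f \<cdot>\<^bsub>D\<^esub> t (Dom C f)" if "f \<in> Arr C" for f
    using t that by (auto simp: is_nat_trans_def)
  have Gh: "farr (G j) f \<in> hom D (fobj (G j) (Dom C f)) (fobj (G j) (Cod C f))" if "f \<in> Arr C" for j f
    using G[of j] that by (auto simp: is_functor_def)
  have Gi: "farr (G j) (Ident C X) = Ident D (fobj (G j) X)" if "X \<in> Obj C" for j X
    using G[of j] that by (auto simp: is_functor_def)
  have Gc: "farr (G j) (g \<cdot>\<^bsub>C\<^esub> f) = farr (G j) g \<cdot>\<^bsub>D\<^esub> farr (G j) f"
    if "f \<in> Arr C" "g \<in> Arr C" "Cod C f = Dom C g" for j f g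
    using G[of j] that by (auto simp: is_functor_def)
  have fo: "fobj ?F X = arrow_diagram D (t X)" for X by (simp add: arrow_functor_def)
  have fa: "farr ?F f = (arrow_diagram D (t (Dom C f)), arrow_diagram D (t (Cod C f)), \<lambda>j. farr (G j) f)" for f
    by (simp add: arrow_functor_def)
  have farr_in: "farr ?F f \<in> Arr ?D" if "f \<in> Arr C" for f
    unfolding fa D.Arr_functor_cat_walking_arrow
    using tt[OF C.Dom_in_Obj[OF that]] tt[OF C.Cod_in_Obj[OF that]] nat[OF that] Gh[OF that]
    by (intro bexI[of _ "t (Dom C f)"] bexI[of _ "t (Cod C f)"]) simp_all
  have "is_functor C ?D ?F"
    unfolding is_functor_def
  proof (intro conjI ballI impI)
    show "fobj ?F X \<in> Obj ?D" if "X \<in> Obj C" for X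
      using tt that by (auto simp: fo D.Obj_functor_cat_walking_arrow)
    show "farr ?F f \<in> hom ?D (fobj ?F (Dom C f)) (fobj ?F (Cod C f))" if "f \<in> Arr C" for f
      using farr_in[OF that] by (simp add: hom_def fa fo functor_cat_simps)
    show "farr ?F (Ident C X) = Ident ?D (fobj ?F X)" if "X \<in> Obj C" for X
      using that by (auto simp: fa fo functor_cat_simps C.Ident_Arr Gi tt)
    show "farr ?F (g \<cdot>\<^bsub>C\<^esub> f) = farr ?F g \<cdot>\<^bsub>?D\<^esub> farr ?F f"
      if "f \<in> Arr C" "g \<in> Arr C" "Cod C f = Dom C g" for f g
      using that by (auto simp: fa fo functor_cat_simps C.Comp_Arr Gc)
  qed
  moreover have "bij_betw (fobj ?F) (Obj C) (Obj ?D)"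
  proof (rule bij_betw_imageI)
    show "inj_on (fobj ?F) (Obj C)"
      by (rule inj_onI) (auto simp: fo dest: arrow_diagram_eqD un1)
    show "fobj ?F ` Obj C = Obj ?D"
    proof -
      have "t ` Obj C = Arr D" using ex1 tt by auto
      then show ?thesis unfolding D.Obj_functor_cat_walking_arrow fo by (metis image_image)
    qed
  qed
  moreover have "bij_betw (farr ?F) (Arr C) (Arr ?D)"
  proof (rule bij_betw_imageI)
    show "inj_on (farr ?F) (Arr C)"
    proof (rule inj_onI)
      fix f g assume f: "f \<in> Arr C" and g: "g \<in> Arr C" and "farr ?F f = farr ?F g"
      then have e: "t (Dom C f) = t (Dom C g)" "t (Cod C f) = t (Cod C g)" "\<And>j. farr (G j) f = farr (G j) g"
        by (auto simp: fa fun_eq_iff dest: arrow_diagram_eqD)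
      \<comment> \<open>\<open>un2\<close> compares parallel arrows only. That \<open>f\<close> and
        \<open>g\<close> are parallel is read off from the sides of the squares that come from
        \<open>t\<close>, by \<open>un1\<close>.\<close>
      then have "Dom C f = Dom C g" "Cod C f = Cod C g"
        using f g un1 C.Dom_in_Obj C.Cod_in_Obj by blast+
      then show "f = g" using un2[of f "Dom C g" "Cod C g" g] e f g by (auto simp: hom_def)
    qed
    show "farr ?F ` Arr C = Arr ?D"
    proof (intro subset_antisym subsetI)
      fix x assume "x \<in> farr ?F ` Arr C" then show "x \<in> Arr ?D" using farr_in by auto
    next
      fix x assume x: "x \<in> Arr ?D"
      obtain P Q \<theta> where xe: "x = (P, Q, \<theta>)" by (cases x)
      obtain a b where ab: "a \<in> Arr D" "b \<in> Arr D" "P = arrow_diagram D a" "Q = arrow_diagram D b"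
        "\<theta> False \<in> hom D (Dom D a) (Dom D b)" "\<theta> True \<in> hom D (Cod D a) (Cod D b)"
        "b \<cdot>\<^bsub>D\<^esub> \<theta> False = \<theta> True \<cdot>\<^bsub>D\<^esub> a"
        using x unfolding xe D.Arr_functor_cat_walking_arrow by blast
      obtain X Y where XY: "X \<in> Obj C" "t X = a" "Y \<in> Obj C" "t Y = b"
        using ex1 ab(1,2) by metis
      then obtain f where f: "f \<in> hom C X Y" "farr (G False) f = \<theta> False" "farr (G True) f = \<theta> True"
        using ex2[of X Y "\<theta> False" "\<theta> True"] ab tt by metis
      have "farr (G j) f = \<theta> j" for j using f by (cases j) auto
      then have "farr ?F f = x" using f(1) XY ab(3,4) unfolding xe fa by (auto simp: hom_def)
      then show "x \<in> farr ?F ` Arr C"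
        using hom_Arr(1)[OF f(1)] by (metis image_eqI)
    qed
  qed
  ultimately show ?thesis by (rule is_cat_isoI[OF _ _ _ C])
qed

section \<open>Binary products in a category\<close>

context category begin

lemma product_homs:
  assumes "is_product C A B P p q"
  shows "p \<in> hom C P A" "q \<in> hom C P B" "A \<in> Obj C" "B \<in> Obj C" "P \<in> Obj C"
  using assms by (auto simp: is_product_def)

lemma product_pairing:
  assumes P: "is_product C A B P p q" and x: "x \<in> hom C X A" and y: "y \<in> hom C X B"
  shows "pairing C p q x y \<in> hom C X P" "p \<cdot> pairing C p q x y = x" "q \<cdot> pairing C p q x y = y"
proof -
  have ex1: "\<exists>!u. u \<in> hom C X P \<and> p \<cdot> u = x \<and> q \<cdot> u = y"
    using P x y hom_Obj(1)[OF x] unfolding is_product_def by blast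
  have D: "Dom C x = X" "Dom C p = P"
    using x P by (auto simp: hom_def is_product_def)
  have *: "pairing C p q x y \<in> hom C X P \<and> p \<cdot> pairing C p q x y = x \<and> q \<cdot> pairing C p q x y = y"
    unfolding pairing_def D using ex1 by (rule theI')
  then show "pairing C p q x y \<in> hom C X P" "p \<cdot> pairing C p q x y = x" "q \<cdot> pairing C p q x y = y"
    by auto
qed

lemma product_ext:
  assumes P: "is_product C A B P p q" and u: "u \<in> hom C X P" and v: "v \<in> hom C X P"
    and e: "p \<cdot> u = p \<cdot> v" "q \<cdot> u = q \<cdot> v"
  shows "u = v"
proof -
  note h = product_homs[OF P]
  have "\<exists>!w. w \<in> hom C X P \<and> p \<cdot> w = p \<cdot> v \<and> q \<cdot> w = q \<cdot> v"
    using P Comp_in_hom[OF v h(1)] Comp_in_hom[OF v h(2)] hom_Obj(1)[OF u]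
    unfolding is_product_def by blast
  then show ?thesis using u v e by blast
qed

lemma product_swap: "is_product C A B P p q \<Longrightarrow> is_product C B A P q p"
  unfolding is_product_def by (simp add: conj_commute conj_left_commute)

end

section \<open>Whiskering in a 2-category\<close>

context two_category begin

abbreviation whisker_left :: "'m \<Rightarrow> 'c \<Rightarrow> 'c" (infixr "\<rhd>" 75) where
  "v \<rhd> \<alpha> \<equiv> HComp K (id_cell K v) \<alpha>"

abbreviation whisker_right :: "'c \<Rightarrow> 'm \<Rightarrow> 'c" (infixl "\<lhd>" 75) where
  "\<beta> \<lhd> u \<equiv> HComp K \<beta> (id_cell K u)"

lemma id_cell_hom: "f \<in> hom K A B \<Longrightarrow> id_cell K f = Ident (HomCat K A B) f"
  by (auto simp: hom_def)

lemma id_cell_in_hom: "f \<in> hom K A B \<Longrightarrow> id_cell K f \<in> hom (HomCat K A B) f f"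
  using category.Ident_in_hom[OF HomCat_category] Obj_HomCat hom_Obj[of f A B]
  by (simp add: id_cell_hom)

lemma cell_homs:
  assumes "\<alpha> \<in> hom (HomCat K A B) f g" "A \<in> Obj K" "B \<in> Obj K"
  shows "f \<in> hom K A B" "g \<in> hom K A B"
  using category.hom_Obj[OF HomCat_category[OF assms(2,3)] assms(1)] Obj_HomCat[OF assms(2,3)] by auto

lemma HComp_in_hom:
  assumes a: "\<alpha> \<in> hom (HomCat K A B) f f'" and b: "\<beta> \<in> hom (HomCat K B D) g g'"
    and o: "A \<in> Obj K" "B \<in> Obj K" "D \<in> Obj K"
  shows "HComp K \<beta> \<alpha> \<in> hom (HomCat K A D) (g \<cdot> f) (g' \<cdot> f')"
  using HComp_functor[OF o] a b unfolding is_functor_def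
  by (auto simp: prod_cat_def hom_def)

lemma HComp_vcomp:
  assumes a: "\<alpha> \<in> hom (HomCat K A B) f f'" "\<alpha>' \<in> hom (HomCat K A B) f' f''"
    and b: "\<beta> \<in> hom (HomCat K B D) g g'" "\<beta>' \<in> hom (HomCat K B D) g' g''"
    and o: "A \<in> Obj K" "B \<in> Obj K" "D \<in> Obj K"
  shows "HComp K (\<beta>' \<cdot>\<^bsub>HomCat K B D\<^esub> \<beta>) (\<alpha>' \<cdot>\<^bsub>HomCat K A B\<^esub> \<alpha>) =
    HComp K \<beta>' \<alpha>' \<cdot>\<^bsub>HomCat K A D\<^esub> HComp K \<beta> \<alpha>"
  using HComp_functor[OF o] a b unfolding is_functor_def
  by (auto simp: prod_cat_def hom_def)

lemma HComp_id_cell: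
  assumes f: "f \<in> hom K A B" and g: "g \<in> hom K B D"
  shows "HComp K (id_cell K g) (id_cell K f) = id_cell K (g \<cdot> f)"
proof -
  have o: "A \<in> Obj K" "B \<in> Obj K" "D \<in> Obj K" using hom_Obj f g by auto
  have "HComp K (Ident (HomCat K B D) g) (Ident (HomCat K A B) f) = Ident (HomCat K A D) (g \<cdot> f)"
    using HComp_functor[OF o] f g Obj_HomCat[OF o(1,2)] Obj_HomCat[OF o(2,3)] unfolding is_functor_def
    by (auto simp: prod_cat_def)
  then show ?thesis using id_cell_hom[OF f] id_cell_hom[OF g] id_cell_hom[OF Comp_in_hom[OF f g]] by simp
qed

lemma whisker_in_hom:
  assumes a: "\<alpha> \<in> hom (HomCat K A B) f f'" and o: "A \<in> Obj K" "B \<in> Obj K"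
  shows "v \<in> hom K B D \<Longrightarrow> v \<rhd> \<alpha> \<in> hom (HomCat K A D) (v \<cdot> f) (v \<cdot> f')"
    "u \<in> hom K X A \<Longrightarrow> \<alpha> \<lhd> u \<in> hom (HomCat K X B) (f \<cdot> u) (f' \<cdot> u)"
  using HComp_in_hom[OF a id_cell_in_hom o] HComp_in_hom[OF id_cell_in_hom a _ o] hom_Obj by blast+

lemma whisker_vcomp:
  assumes a: "\<alpha> \<in> hom (HomCat K A B) f f'" "\<alpha>' \<in> hom (HomCat K A B) f' f''"
    and o: "A \<in> Obj K" "B \<in> Obj K"
  shows "v \<in> hom K B D \<Longrightarrow> v \<rhd> (\<alpha>' \<cdot>\<^bsub>HomCat K A B\<^esub> \<alpha>) = (v \<rhd> \<alpha>') \<cdot>\<^bsub>HomCat K A D\<^esub> (v \<rhd> \<alpha>)"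
    "u \<in> hom K X A \<Longrightarrow> (\<alpha>' \<cdot>\<^bsub>HomCat K A B\<^esub> \<alpha>) \<lhd> u = (\<alpha>' \<lhd> u) \<cdot>\<^bsub>HomCat K X B\<^esub> (\<alpha> \<lhd> u)"
proof -
  have i: "id_cell K w \<cdot>\<^bsub>HomCat K Y Z\<^esub> id_cell K w = id_cell K w" if "w \<in> hom K Y Z" for w Y Z
    using category.Comp_Ident[OF HomCat_category id_cell_in_hom[OF that]] hom_Obj[OF that] id_cell_hom[OF that]
    by simp
  show "v \<in> hom K B D \<Longrightarrow> v \<rhd> (\<alpha>' \<cdot>\<^bsub>HomCat K A B\<^esub> \<alpha>) = (v \<rhd> \<alpha>') \<cdot>\<^bsub>HomCat K A D\<^esub> (v \<rhd> \<alpha>)"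
    using HComp_vcomp[OF a id_cell_in_hom id_cell_in_hom o] i hom_Obj by metis
  show "u \<in> hom K X A \<Longrightarrow> (\<alpha>' \<cdot>\<^bsub>HomCat K A B\<^esub> \<alpha>) \<lhd> u = (\<alpha>' \<lhd> u) \<cdot>\<^bsub>HomCat K X B\<^esub> (\<alpha> \<lhd> u)"
    using HComp_vcomp[OF id_cell_in_hom id_cell_in_hom a _ o] i hom_Obj by metis
qed

lemma whisker_assoc:
  assumes a: "\<alpha> \<in> hom (HomCat K A B) f f'" and o: "A \<in> Obj K" "B \<in> Obj K"
  shows "\<lbrakk>v \<in> hom K B D; w \<in> hom K D D'\<rbrakk> \<Longrightarrow> w \<rhd> v \<rhd> \<alpha> = (w \<cdot> v) \<rhd> \<alpha>"
    "\<lbrakk>u \<in> hom K X A; t \<in> hom K Y X\<rbrakk> \<Longrightarrow> \<alpha> \<lhd> u \<lhd> t = \<alpha> \<lhd> (u \<cdot> t)"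
    "\<lbrakk>v \<in> hom K B D; u \<in> hom K X A\<rbrakk> \<Longrightarrow> (v \<rhd> \<alpha>) \<lhd> u = v \<rhd> (\<alpha> \<lhd> u)"
proof -
  have a': "\<alpha> \<in> Arr (HomCat K A B)" using a hom_Arr(1) by metis
  show "w \<rhd> v \<rhd> \<alpha> = (w \<cdot> v) \<rhd> \<alpha>" if v: "v \<in> hom K B D" and w: "w \<in> hom K D D'"
    using HComp_assoc[OF o hom_Obj(2)[OF v] hom_Obj(2)[OF w] a' hom_Arr(1)[OF id_cell_in_hom[OF v]]
        hom_Arr(1)[OF id_cell_in_hom[OF w]]] HComp_id_cell[OF v w] by simp
  show "\<alpha> \<lhd> u \<lhd> t = \<alpha> \<lhd> (u \<cdot> t)" if u: "u \<in> hom K X A" and t: "t \<in> hom K Y X"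
    using HComp_assoc[OF hom_Obj(1)[OF t] hom_Obj(1)[OF u] o hom_Arr(1)[OF id_cell_in_hom[OF t]]
        hom_Arr(1)[OF id_cell_in_hom[OF u]] a'] HComp_id_cell[OF t u] by simp
  show "(v \<rhd> \<alpha>) \<lhd> u = v \<rhd> (\<alpha> \<lhd> u)" if v: "v \<in> hom K B D" and u: "u \<in> hom K X A"
    using HComp_assoc[OF hom_Obj(1)[OF u] o hom_Obj(2)[OF v] hom_Arr(1)[OF id_cell_in_hom[OF u]] a'
        hom_Arr(1)[OF id_cell_in_hom[OF v]]] .
qed

text \<open>Both sides are the horizontal composite of \<open>\<beta>\<close> and
  \<open>\<alpha>\<close>, factored through identity 2-cells in the two possible orders.\<close>

lemma whisker_exchange:
  assumes a: "\<alpha> \<in> hom (HomCat K A B) f f'" and b: "\<beta> \<in> hom (HomCat K B D) g g'"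
    and o: "A \<in> Obj K" "B \<in> Obj K" "D \<in> Obj K"
  shows "(g' \<rhd> \<alpha>) \<cdot>\<^bsub>HomCat K A D\<^esub> (\<beta> \<lhd> f) = (\<beta> \<lhd> f') \<cdot>\<^bsub>HomCat K A D\<^esub> (g \<rhd> \<alpha>)"
proof -
  note f = cell_homs[OF a o(1,2)] and g = cell_homs[OF b o(2,3)]
  interpret AB: category "HomCat K A B" using HomCat_category o by blast
  interpret BD: category "HomCat K B D" using HomCat_category o by blast
  have "(g' \<rhd> \<alpha>) \<cdot>\<^bsub>HomCat K A D\<^esub> (\<beta> \<lhd> f) =
     HComp K (id_cell K g' \<cdot>\<^bsub>HomCat K B D\<^esub> \<beta>) (\<alpha> \<cdot>\<^bsub>HomCat K A B\<^esub> id_cell K f)"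
    using HComp_vcomp[OF id_cell_in_hom[OF f(1)] a b id_cell_in_hom[OF g(2)] o] by simp
  also have "\<dots> = HComp K (\<beta> \<cdot>\<^bsub>HomCat K B D\<^esub> id_cell K g) (id_cell K f' \<cdot>\<^bsub>HomCat K A B\<^esub> \<alpha>)"
    using AB.Comp_Ident[OF a] AB.Ident_Comp[OF a] BD.Comp_Ident[OF b] BD.Ident_Comp[OF b]
      id_cell_hom f g by simp
  also have "\<dots> = (\<beta> \<lhd> f') \<cdot>\<^bsub>HomCat K A D\<^esub> (g \<rhd> \<alpha>)"
    using HComp_vcomp[OF a id_cell_in_hom[OF f(2)] id_cell_in_hom[OF g(1)] b o] by simp
  finally show ?thesis .
qed

lemma whisker_id_cell:
  "\<lbrakk>f \<in> hom K A B; v \<in> hom K B D\<rbrakk> \<Longrightarrow> v \<rhd> Ident (HomCat K A B) f = Ident (HomCat K A D) (v \<cdot> f)"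
  "\<lbrakk>f \<in> hom K A B; u \<in> hom K X A\<rbrakk> \<Longrightarrow> Ident (HomCat K A B) f \<lhd> u = Ident (HomCat K X B) (f \<cdot> u)"
  using HComp_id_cell id_cell_hom Comp_in_hom by metis+

lemma precomp_functor:
  assumes u: "u \<in> hom K A S" and B: "B \<in> Obj K"
  shows "is_functor (HomCat K S B) (HomCat K A B) (precomp K u)"
proof -
  have o: "A \<in> Obj K" "S \<in> Obj K" using hom_Obj u by auto
  have h: "\<theta> \<in> hom (HomCat K S B) (Dom (HomCat K S B) \<theta>) (Cod (HomCat K S B) \<theta>)"
    if "\<theta> \<in> Arr (HomCat K S B)" for \<theta> using that by (simp add: hom_def)
  show ?thesis
    unfolding is_functor_def precomp_def Obj_HomCat[OF o(1) B] Obj_HomCat[OF o(2) B]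
    using Comp_in_hom[OF u] whisker_in_hom(2)[OF h o(2) B u] whisker_id_cell(2)[OF _ u]
      whisker_vcomp(2)[OF h homI[OF _ _ refl] o(2) B u] h by auto
qed

lemma postcomp_functor:
  assumes v: "v \<in> hom K B B'" and A: "A \<in> Obj K"
  shows "is_functor (HomCat K A B) (HomCat K A B') (postcomp K v)"
proof -
  have o: "B \<in> Obj K" "B' \<in> Obj K" using hom_Obj v by auto
  have h: "\<theta> \<in> hom (HomCat K A B) (Dom (HomCat K A B) \<theta>) (Cod (HomCat K A B) \<theta>)"
    if "\<theta> \<in> Arr (HomCat K A B)" for \<theta> using that by (simp add: hom_def)
  show ?thesis
    unfolding is_functor_def postcomp_def Obj_HomCat[OF A o(1)] Obj_HomCat[OF A o(2)]
    using Comp_in_hom[OF _ v] whisker_in_hom(1)[OF h A o(1) v] whisker_id_cell(1)[OF _ v]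
      whisker_vcomp(1)[OF h homI[OF _ _ refl] A o(1) v] h by auto
qed

end

section \<open>Universal 2-cells\<close>

context two_category begin

text \<open>The Yoneda form of a copower by the walking arrow: \<open>\<sigma>\<close> is the 2-cell
  to which the identity of \<open>S\<close> corresponds. For each \<open>B\<close> the first two
  clauses are bijectivity on 1-cells and the last two bijectivity on 2-cells, a 2-cell being tested
  along the two legs. The legs form a family over \<open>bool\<close> so that both ends can be
  treated at once.\<close>

definition copower_cell :: "'o \<Rightarrow> 'o \<Rightarrow> (bool \<Rightarrow> 'm) \<Rightarrow> 'c \<Rightarrow> bool" where
  "copower_cell A S i \<sigma> \<longleftrightarrow> A \<in> Obj K \<and> S \<in> Obj K \<and> \<sigma> \<in> hom (HomCat K A S) (i False) (i True) \<and>
     (\<forall>B \<in> Obj K.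
        (\<forall>\<tau> \<in> Arr (HomCat K A B). \<exists>h \<in> hom K S B. h \<rhd> \<sigma> = \<tau>) \<and>
        (\<forall>h \<in> hom K S B. \<forall>k \<in> hom K S B. h \<rhd> \<sigma> = k \<rhd> \<sigma> \<longrightarrow> h = k) \<and>
        (\<forall>h \<in> hom K S B. \<forall>k \<in> hom K S B.
           \<forall>a \<in> hom (HomCat K A B) (h \<cdot> i False) (k \<cdot> i False).
           \<forall>b \<in> hom (HomCat K A B) (h \<cdot> i True) (k \<cdot> i True).
           (k \<rhd> \<sigma>) \<cdot>\<^bsub>HomCat K A B\<^esub> a = b \<cdot>\<^bsub>HomCat K A B\<^esub> (h \<rhd> \<sigma>) \<longrightarrow>
           (\<exists>\<theta> \<in> hom (HomCat K S B) h k. \<theta> \<lhd> i False = a \<and> \<theta> \<lhd> i True = b)) \<and>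
        (\<forall>h k. \<forall>\<theta> \<in> hom (HomCat K S B) h k. \<forall>\<theta>' \<in> hom (HomCat K S B) h k.
           \<theta> \<lhd> i False = \<theta>' \<lhd> i False \<and> \<theta> \<lhd> i True = \<theta>' \<lhd> i True \<longrightarrow> \<theta> = \<theta>'))"

text \<open>The dual of \<open>copower_cell\<close> with 1-cells reversed and 2-cells kept:
  whiskering changes sides, while \<open>\<epsilon>\<close> still runs from \<open>e False\<close>
  to \<open>e True\<close>.\<close>

definition power_cell :: "'o \<Rightarrow> 'o \<Rightarrow> (bool \<Rightarrow> 'm) \<Rightarrow> 'c \<Rightarrow> bool" where
  "power_cell B H e \<epsilon> \<longleftrightarrow> B \<in> Obj K \<and> H \<in> Obj K \<and> \<epsilon> \<in> hom (HomCat K H B) (e False) (e True) \<and>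
     (\<forall>A \<in> Obj K.
        (\<forall>\<tau> \<in> Arr (HomCat K A B). \<exists>h \<in> hom K A H. \<epsilon> \<lhd> h = \<tau>) \<and>
        (\<forall>h \<in> hom K A H. \<forall>k \<in> hom K A H. \<epsilon> \<lhd> h = \<epsilon> \<lhd> k \<longrightarrow> h = k) \<and>
        (\<forall>h \<in> hom K A H. \<forall>k \<in> hom K A H.
           \<forall>a \<in> hom (HomCat K A B) (e False \<cdot> h) (e False \<cdot> k).
           \<forall>b \<in> hom (HomCat K A B) (e True \<cdot> h) (e True \<cdot> k).
           (\<epsilon> \<lhd> k) \<cdot>\<^bsub>HomCat K A B\<^esub> a = b \<cdot>\<^bsub>HomCat K A B\<^esub> (\<epsilon> \<lhd> h) \<longrightarrow>
           (\<exists>\<theta> \<in> hom (HomCat K A H) h k. e False \<rhd> \<theta> = a \<and> e True \<rhd> \<theta> = b)) \<and>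
        (\<forall>h k. \<forall>\<theta> \<in> hom (HomCat K A H) h k. \<forall>\<theta>' \<in> hom (HomCat K A H) h k.
           e False \<rhd> \<theta> = e False \<rhd> \<theta>' \<and> e True \<rhd> \<theta> = e True \<rhd> \<theta>' \<longrightarrow> \<theta> = \<theta>'))"

lemma copower_cellD:
  assumes "copower_cell A S i \<sigma>"
  shows "A \<in> Obj K" "S \<in> Obj K" "\<sigma> \<in> hom (HomCat K A S) (i False) (i True)" "\<And>j. i j \<in> hom K A S"
    "\<And>B \<tau>. \<lbrakk>B \<in> Obj K; \<tau> \<in> Arr (HomCat K A B)\<rbrakk> \<Longrightarrow> \<exists>h \<in> hom K S B. h \<rhd> \<sigma> = \<tau>"
    "\<And>B h k. \<lbrakk>h \<in> hom K S B; k \<in> hom K S B; h \<rhd> \<sigma> = k \<rhd> \<sigma>\<rbrakk> \<Longrightarrow> h = k"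
    "\<And>B h k a b. \<lbrakk>h \<in> hom K S B; k \<in> hom K S B;
       a \<in> hom (HomCat K A B) (h \<cdot> i False) (k \<cdot> i False);
       b \<in> hom (HomCat K A B) (h \<cdot> i True) (k \<cdot> i True);
       (k \<rhd> \<sigma>) \<cdot>\<^bsub>HomCat K A B\<^esub> a = b \<cdot>\<^bsub>HomCat K A B\<^esub> (h \<rhd> \<sigma>)\<rbrakk> \<Longrightarrow>
       \<exists>\<theta> \<in> hom (HomCat K S B) h k. \<theta> \<lhd> i False = a \<and> \<theta> \<lhd> i True = b"
    "\<And>B h k \<theta> \<theta>'. \<lbrakk>B \<in> Obj K; \<theta> \<in> hom (HomCat K S B) h k; \<theta>' \<in> hom (HomCat K S B) h k;
       \<theta> \<lhd> i False = \<theta>' \<lhd> i False; \<theta> \<lhd> i True = \<theta>' \<lhd> i True\<rbrakk> \<Longrightarrow> \<theta> = \<theta>'"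
proof -
  show o: "A \<in> Obj K" "S \<in> Obj K" and s: "\<sigma> \<in> hom (HomCat K A S) (i False) (i True)"
    using assms by (auto simp: copower_cell_def)
  show "i j \<in> hom K A S" for j using cell_homs[OF s o] by (cases j) auto
  show "\<exists>h \<in> hom K S B. h \<rhd> \<sigma> = \<tau>" if "B \<in> Obj K" "\<tau> \<in> Arr (HomCat K A B)" for B \<tau>
    using assms that by (simp add: copower_cell_def)
  show "h = k" if "h \<in> hom K S B" "k \<in> hom K S B" "h \<rhd> \<sigma> = k \<rhd> \<sigma>" for B h k
    using assms that hom_Obj(2)[OF that(1)] unfolding copower_cell_def by metis
  show "\<exists>\<theta> \<in> hom (HomCat K S B) h k. \<theta> \<lhd> i False = a \<and> \<theta> \<lhd> i True = b"
    if "h \<in> hom K S B" "k \<in> hom K S B" "a \<in> hom (HomCat K A B) (h \<cdot> i False) (k \<cdot> i False)"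
       "b \<in> hom (HomCat K A B) (h \<cdot> i True) (k \<cdot> i True)"
       "(k \<rhd> \<sigma>) \<cdot>\<^bsub>HomCat K A B\<^esub> a = b \<cdot>\<^bsub>HomCat K A B\<^esub> (h \<rhd> \<sigma>)" for B h k a b
    using assms that hom_Obj(2)[OF that(1)] unfolding copower_cell_def by simp
  show "\<theta> = \<theta>'"
    if "B \<in> Obj K" "\<theta> \<in> hom (HomCat K S B) h k" "\<theta>' \<in> hom (HomCat K S B) h k"
       "\<theta> \<lhd> i False = \<theta>' \<lhd> i False" "\<theta> \<lhd> i True = \<theta>' \<lhd> i True" for B h k \<theta> \<theta>'
    using assms that unfolding copower_cell_def by metis
qed

lemma power_cellD:
  assumes "power_cell B H e \<epsilon>"
  shows "B \<in> Obj K" "H \<in> Obj K" "\<epsilon> \<in> hom (HomCat K H B) (e False) (e True)" "\<And>j. e j \<in> hom K H B"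
    "\<And>A \<tau>. \<lbrakk>A \<in> Obj K; \<tau> \<in> Arr (HomCat K A B)\<rbrakk> \<Longrightarrow> \<exists>h \<in> hom K A H. \<epsilon> \<lhd> h = \<tau>"
    "\<And>A h k. \<lbrakk>h \<in> hom K A H; k \<in> hom K A H; \<epsilon> \<lhd> h = \<epsilon> \<lhd> k\<rbrakk> \<Longrightarrow> h = k"
    "\<And>A h k a b. \<lbrakk>h \<in> hom K A H; k \<in> hom K A H;
       a \<in> hom (HomCat K A B) (e False \<cdot> h) (e False \<cdot> k);
       b \<in> hom (HomCat K A B) (e True \<cdot> h) (e True \<cdot> k);
       (\<epsilon> \<lhd> k) \<cdot>\<^bsub>HomCat K A B\<^esub> a = b \<cdot>\<^bsub>HomCat K A B\<^esub> (\<epsilon> \<lhd> h)\<rbrakk> \<Longrightarrow>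
       \<exists>\<theta> \<in> hom (HomCat K A H) h k. e False \<rhd> \<theta> = a \<and> e True \<rhd> \<theta> = b"
    "\<And>A h k \<theta> \<theta>'. \<lbrakk>A \<in> Obj K; \<theta> \<in> hom (HomCat K A H) h k; \<theta>' \<in> hom (HomCat K A H) h k;
       e False \<rhd> \<theta> = e False \<rhd> \<theta>'; e True \<rhd> \<theta> = e True \<rhd> \<theta>'\<rbrakk> \<Longrightarrow> \<theta> = \<theta>'"
proof -
  show o: "B \<in> Obj K" "H \<in> Obj K" and s: "\<epsilon> \<in> hom (HomCat K H B) (e False) (e True)"
    using assms by (auto simp: power_cell_def)
  show "e j \<in> hom K H B" for j using cell_homs[OF s o(2,1)] by (cases j) auto
  show "\<exists>h \<in> hom K A H. \<epsilon> \<lhd> h = \<tau>" if "A \<in> Obj K" "\<tau> \<in> Arr (HomCat K A B)" for A \<tau>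
    using assms that by (simp add: power_cell_def)
  show "h = k" if "h \<in> hom K A H" "k \<in> hom K A H" "\<epsilon> \<lhd> h = \<epsilon> \<lhd> k" for A h k
    using assms that hom_Obj(1)[OF that(1)] unfolding power_cell_def by metis
  show "\<exists>\<theta> \<in> hom (HomCat K A H) h k. e False \<rhd> \<theta> = a \<and> e True \<rhd> \<theta> = b"
    if "h \<in> hom K A H" "k \<in> hom K A H" "a \<in> hom (HomCat K A B) (e False \<cdot> h) (e False \<cdot> k)"
       "b \<in> hom (HomCat K A B) (e True \<cdot> h) (e True \<cdot> k)"
       "(\<epsilon> \<lhd> k) \<cdot>\<^bsub>HomCat K A B\<^esub> a = b \<cdot>\<^bsub>HomCat K A B\<^esub> (\<epsilon> \<lhd> h)" for A h k a b
    using assms that hom_Obj(1)[OF that(1)] unfolding power_cell_def by simp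
  show "\<theta> = \<theta>'"
    if "A \<in> Obj K" "\<theta> \<in> hom (HomCat K A H) h k" "\<theta>' \<in> hom (HomCat K A H) h k"
       "e False \<rhd> \<theta> = e False \<rhd> \<theta>'" "e True \<rhd> \<theta> = e True \<rhd> \<theta>'" for A h k \<theta> \<theta>'
    using assms that unfolding power_cell_def by metis
qed

lemma functor_cat_map_arr:
  "farr (functor_cat_map J P) (X, Y, \<tau>) =
     (fobj (functor_cat_map J P) X, fobj (functor_cat_map J P) Y, \<lambda>j \<in> Obj J. farr P (\<tau> j))"
  by (simp add: functor_cat_map_def Let_def)

text \<open>The isomorphism sends \<open>h\<close> to \<open>h \<rhd> \<sigma>\<close> and a 2-cell
  to its whiskerings with the two legs. The clauses of \<open>copower_cell\<close> are the
  bijectivity hypotheses of \<open>arrow_functor_iso\<close>, and 2-naturality in \<open>B\<close>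
  is associativity of whiskering.\<close>

lemma is_copower_copower_cell:
  assumes cell: "copower_cell A S i \<sigma>"
  shows "is_copower K walking_arrow A S"
proof -
  note U = copower_cellD[OF cell]
  define \<Phi> where "\<Phi> B = arrow_functor (HomCat K A B) (\<lambda>j. farr (precomp K (i j))) (\<lambda>h. h \<rhd> \<sigma>)
    (Dom (HomCat K S B)) (Cod (HomCat K S B))" for B
  have fo: "fobj (\<Phi> B) h = arrow_diagram (HomCat K A B) (h \<rhd> \<sigma>)" for B h
    by (simp add: \<Phi>_def arrow_functor_def)
  have fa: "farr (\<Phi> B) \<theta> = (arrow_diagram (HomCat K A B) (Dom (HomCat K S B) \<theta> \<rhd> \<sigma>),
     arrow_diagram (HomCat K A B) (Cod (HomCat K S B) \<theta> \<rhd> \<sigma>), \<lambda>j. \<theta> \<lhd> i j)" for B \<theta>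
    by (simp add: \<Phi>_def arrow_functor_def precomp_def)
  have hs: "h \<rhd> \<sigma> \<in> hom (HomCat K A B) (h \<cdot> i False) (h \<cdot> i True)" if "h \<in> hom K S B" for h B
    using whisker_in_hom(1)[OF U(3,1,2) that] .
  have map: "fobj (functor_cat_map walking_arrow (postcomp K v)) (arrow_diagram (HomCat K A B) (h \<rhd> \<sigma>)) =
       arrow_diagram (HomCat K A B') ((v \<cdot> h) \<rhd> \<sigma>)"
    if "v \<in> hom K B B'" "h \<in> hom K S B" for v B B' h
    using functor_cat_map_arrow_diagram[OF postcomp_functor[OF that(1) U(1)] HomCat_category[OF U(1)]
        hom_Arr(1)[OF hs[OF that(2)]]] hom_Obj(1)[OF that(1)] whisker_assoc(1)[OF U(3,1,2) that(2,1)]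
    by (simp add: postcomp_def)
  have "is_cat_iso (HomCat K S B) (functor_cat walking_arrow (HomCat K A B)) (\<Phi> B)" if B: "B \<in> Obj K" for B
    unfolding \<Phi>_def
  proof (rule arrow_functor_iso)
    \<comment> \<open>Naturality in \<open>h\<close> is the exchange law for \<open>\<sigma>\<close>
      and a 2-cell out of \<open>S\<close>.\<close>
    show "is_nat_trans (HomCat K S B) (HomCat K A B) (precomp K (i False)) (precomp K (i True)) (\<lambda>h. h \<rhd> \<sigma>)"
      unfolding is_nat_trans_def Obj_HomCat[OF U(2) B] precomp_def
      using hs whisker_exchange[OF U(3) homI[OF _ refl refl] U(1,2) B, symmetric] by auto
  qed (use U B precomp_functor[OF U(4) B] in \<open>simp_all add: HomCat_category Obj_HomCat precomp_def\<close>)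
  moreover have "fobj (\<Phi> B') (fobj (postcomp K v) h) =
              fobj (functor_cat_map walking_arrow (postcomp K v)) (fobj (\<Phi> B) h)"
    if "v \<in> hom K B B'" "h \<in> Obj (HomCat K S B)" for B B' v h
    using that map Obj_HomCat[OF U(2)] hom_Obj(1)[OF that(1)] by (simp add: fo postcomp_def)
  moreover have "farr (\<Phi> B') (farr (postcomp K v) \<theta>) =
              farr (functor_cat_map walking_arrow (postcomp K v)) (farr (\<Phi> B) \<theta>)"
    if v: "v \<in> hom K B B'" and t: "\<theta> \<in> Arr (HomCat K S B)" for B B' v \<theta>
  proof -
    note B = hom_Obj(1)[OF v]
    have t': "\<theta> \<in> hom (HomCat K S B) (Dom (HomCat K S B) \<theta>) (Cod (HomCat K S B) \<theta>)"
      using t by (simp add: hom_def)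
    note h = cell_homs[OF t' U(2) B] and vt = whisker_in_hom(1)[OF t' U(2) B v]
    show ?thesis unfolding fa functor_cat_map_arr map[OF v h(1)] map[OF v h(2)]
      using hom_Arr(2,3)[OF vt] whisker_assoc(3)[OF t' U(2) B v U(4)] by (auto simp: postcomp_def)
  qed
  moreover have "farr (\<Phi> B') (HComp K \<beta> (id_cell K h)) =
              (fobj (functor_cat_map walking_arrow (postcomp K v)) (fobj (\<Phi> B) h),
               fobj (functor_cat_map walking_arrow (postcomp K v')) (fobj (\<Phi> B) h),
               \<lambda>j \<in> Obj walking_arrow. HComp K \<beta> (id_cell K (fobj (fobj (\<Phi> B) h) j)))"
    if v: "v \<in> hom K B B'" "v' \<in> hom K B B'" "\<beta> \<in> hom (HomCat K B B') v v'" and h: "h \<in> hom K S B"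
    for B B' v v' \<beta> h
  proof -
    note B = hom_Obj[OF v(1)]
    have "fobj (fobj (\<Phi> B) h) j = h \<cdot> i j" for j using hom_Arr(2,3)[OF hs[OF h]] by (simp add: fo)
    then show ?thesis
      unfolding fa using map[OF v(1) h] map[OF v(2) h] whisker_assoc(2)[OF v(3) B h U(4)]
        hom_Arr(2,3)[OF whisker_in_hom(2)[OF v(3) B h]] by (simp add: fo restrict_def)
  qed
  ultimately show ?thesis
    unfolding is_copower_def using U(1,2) by (intro conjI exI[of _ \<Phi>]) blast+
qed

text \<open>The argument for copowers with precomposition and postcomposition interchanged.\<close>

lemma is_power_power_cell:
  assumes cell: "power_cell B H e \<epsilon>"
  shows "is_power K walking_arrow B H"
proof -
  note U = power_cellD[OF cell]
  define \<Phi> where "\<Phi> A = arrow_functor (HomCat K A B) (\<lambda>j. farr (postcomp K (e j))) (\<lambda>h. \<epsilon> \<lhd> h)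
    (Dom (HomCat K A H)) (Cod (HomCat K A H))" for A
  have fo: "fobj (\<Phi> A) h = arrow_diagram (HomCat K A B) (\<epsilon> \<lhd> h)" for A h
    by (simp add: \<Phi>_def arrow_functor_def)
  have fa: "farr (\<Phi> A) \<theta> = (arrow_diagram (HomCat K A B) (\<epsilon> \<lhd> Dom (HomCat K A H) \<theta>),
     arrow_diagram (HomCat K A B) (\<epsilon> \<lhd> Cod (HomCat K A H) \<theta>), \<lambda>j. e j \<rhd> \<theta>)" for A \<theta>
    by (simp add: \<Phi>_def arrow_functor_def postcomp_def)
  have hs: "\<epsilon> \<lhd> h \<in> hom (HomCat K A B) (e False \<cdot> h) (e True \<cdot> h)" if "h \<in> hom K A H" for h A
    using whisker_in_hom(2)[OF U(3,2,1) that] .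
  have map: "fobj (functor_cat_map walking_arrow (precomp K u)) (arrow_diagram (HomCat K A B) (\<epsilon> \<lhd> h)) =
       arrow_diagram (HomCat K A' B) (\<epsilon> \<lhd> (h \<cdot> u))"
    if "u \<in> hom K A' A" "h \<in> hom K A H" for u A A' h
    using functor_cat_map_arrow_diagram[OF precomp_functor[OF that(1) U(1)] HomCat_category[OF _ U(1)]
        hom_Arr(1)[OF hs[OF that(2)]]] hom_Obj(2)[OF that(1)] whisker_assoc(2)[OF U(3,2,1) that(2,1)]
    by (simp add: precomp_def)
  have "is_cat_iso (HomCat K A H) (functor_cat walking_arrow (HomCat K A B)) (\<Phi> A)" if A: "A \<in> Obj K" for A
    unfolding \<Phi>_def
  proof (rule arrow_functor_iso)
    show "is_nat_trans (HomCat K A H) (HomCat K A B) (postcomp K (e False)) (postcomp K (e True)) (\<lambda>h. \<epsilon> \<lhd> h)"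
      unfolding is_nat_trans_def Obj_HomCat[OF A U(2)] postcomp_def
      using hs whisker_exchange[OF homI[OF _ refl refl] U(3) A U(2,1), symmetric] by auto
  qed (use U A postcomp_functor[OF U(4) A] in \<open>simp_all add: HomCat_category Obj_HomCat postcomp_def\<close>)
  moreover have "fobj (\<Phi> A') (fobj (precomp K u) h) =
              fobj (functor_cat_map walking_arrow (precomp K u)) (fobj (\<Phi> A) h)"
    if "u \<in> hom K A' A" "h \<in> Obj (HomCat K A H)" for A A' u h
    using that map Obj_HomCat[OF _ U(2)] hom_Obj(2)[OF that(1)] by (simp add: fo precomp_def)
  moreover have "farr (\<Phi> A') (farr (precomp K u) \<theta>) =
              farr (functor_cat_map walking_arrow (precomp K u)) (farr (\<Phi> A) \<theta>)"
    if u: "u \<in> hom K A' A" and t: "\<theta> \<in> Arr (HomCat K A H)" for A A' u \<theta>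
  proof -
    note A = hom_Obj(2)[OF u]
    have t': "\<theta> \<in> hom (HomCat K A H) (Dom (HomCat K A H) \<theta>) (Cod (HomCat K A H) \<theta>)"
      using t by (simp add: hom_def)
    note h = cell_homs[OF t' A U(2)] and vt = whisker_in_hom(2)[OF t' A U(2) u]
    show ?thesis unfolding fa functor_cat_map_arr map[OF u h(1)] map[OF u h(2)]
      using hom_Arr(2,3)[OF vt] whisker_assoc(3)[OF t' A U(2) U(4) u] by (auto simp: precomp_def)
  qed
  moreover have "farr (\<Phi> A') (HComp K (id_cell K h) \<alpha>) =
              (fobj (functor_cat_map walking_arrow (precomp K u)) (fobj (\<Phi> A) h),
               fobj (functor_cat_map walking_arrow (precomp K u')) (fobj (\<Phi> A) h),
               \<lambda>j \<in> Obj walking_arrow. HComp K (id_cell K (fobj (fobj (\<Phi> A) h) j)) \<alpha>)"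
    if u: "u \<in> hom K A' A" "u' \<in> hom K A' A" "\<alpha> \<in> hom (HomCat K A' A) u u'" and h: "h \<in> hom K A H"
    for A A' u u' \<alpha> h
  proof -
    note A = hom_Obj[OF u(1)]
    have "fobj (fobj (\<Phi> A) h) j = e j \<cdot> h" for j using hom_Arr(2,3)[OF hs[OF h]] by (simp add: fo)
    then show ?thesis
      unfolding fa using map[OF u(1) h] map[OF u(2) h] whisker_assoc(1)[OF u(3) A h U(4)]
        hom_Arr(2,3)[OF whisker_in_hom(1)[OF u(3) A h]] by (simp add: fo restrict_def)
  qed
  ultimately show ?thesis
    unfolding is_power_def using U(1,2) by (intro conjI exI[of _ \<Phi>]) blast+
qed

text \<open>A 2-cell \<open>\<theta>\<close> between arrows \<open>A \<rightarrow> H\<close> is an arrow \<open>S A \<rightarrow> H\<close>; transposing this arrow and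
  using the universal property of \<open>S (S A)\<close> turns it into a 2-cell between arrows \<open>S A \<rightarrow> B\<close>.\<close>

lemma exponential_power:
  assumes exp: "is_exponential K I B H P p q ev"
    and prod: "\<And>A. A \<in> Obj K \<Longrightarrow> is_product K A I (S A) (r A) (s A)"
    and cell: "\<And>A. A \<in> Obj K \<Longrightarrow> copower_cell A (S A) (i A) (\<sigma> A)"
    and nat: "\<And>A A' h w. \<lbrakk>h \<in> hom K A A'; w \<in> hom K (S A) (S A'); r A' \<cdot> w = h \<cdot> r A; s A' \<cdot> w = s A\<rbrakk> \<Longrightarrow>
      w \<rhd> \<sigma> A = \<sigma> A' \<lhd> h"
  shows "is_power K walking_arrow B H"
proof -
  have B: "B \<in> Obj K" and P: "is_product K H I P p q" and ev: "ev \<in> hom K P B"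
    using exp by (auto simp: is_exponential_def)
  note hP = product_homs[OF P]
  note H = hP(3)
  note hr = product_homs[OF prod]
  \<comment> \<open>The exponential comes with its own product \<open>P\<close>, while the 2-cells
    \<open>\<sigma>\<close> live on the products \<open>S A\<close>. The arrow \<open>w\<close>
    compares the two, and \<open>ev'\<close> is evaluation transported to
    \<open>S H\<close>.\<close>
  define w where "w = pairing K p q (r H) (s H)"
  note w = product_pairing[OF P hr(1,2)[OF H], folded w_def]
  define ev' where "ev' = ev \<cdot> w"
  have ev': "ev' \<in> hom K (S H) B" unfolding ev'_def by (rule Comp_in_hom[OF w(1) ev])
  define tr where "tr A h = ev \<cdot> pairing K p q (h \<cdot> r A) (s A)" for A h
  have exq: "\<exists>!h. h \<in> hom K A H \<and> tr A h = f" if "A \<in> Obj K" "f \<in> hom K (S A) B" for A f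
    using exp prod[OF that(1)] that(2) unfolding is_exponential_def tr_def by blast
  \<comment> \<open>The witness is \<open>h\<close> times the identity of \<open>I\<close>. Composed
    with it, \<open>ev'\<close> becomes the transpose of \<open>h\<close>, and \<open>nat\<close>
    applies to it.\<close>
  have tr: "\<exists>x \<in> hom K (S A) (S H). x \<rhd> \<sigma> A = \<sigma> H \<lhd> h \<and> ev' \<cdot> x = tr A h" if h: "h \<in> hom K A H" for A h
  proof -
    have A: "A \<in> Obj K" using hom_Obj h by blast
    have hr': "h \<cdot> r A \<in> hom K (S A) H" using Comp_in_hom[OF hr(1)[OF A] h] .
    define x where "x = pairing K (r H) (s H) (h \<cdot> r A) (s A)"
    note x = product_pairing[OF prod[OF H] hr' hr(2)[OF A], folded x_def]
    note y = product_pairing[OF P hr' hr(2)[OF A]]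
    have "w \<cdot> x = pairing K p q (h \<cdot> r A) (s A)"
      using Comp_assoc[OF x(1) w(1) hP(1)] Comp_assoc[OF x(1) w(1) hP(2)] w(2,3) x(2,3) y
      by (intro product_ext[OF P Comp_in_hom[OF x(1) w(1)] y(1)]) simp_all
    then have "ev' \<cdot> x = tr A h"
      unfolding ev'_def tr_def using Comp_assoc[OF x(1) w(1) ev] by simp
    then show ?thesis using nat[OF h x(1-3)] x(1) by blast
  qed
  note U = copower_cellD[OF cell]
  \<comment> \<open>The universal 2-cell has to correspond to the identity of \<open>H\<close>. The
    transpose of that identity is \<open>ev'\<close>, and whiskering \<open>ev'\<close> with
    \<open>\<sigma> H\<close> gives \<open>\<epsilon>\<close>.\<close>
  define e where "e j = ev' \<cdot> i H j" for j
  define \<epsilon> where "\<epsilon> = ev' \<rhd> \<sigma> H"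
  have e: "e j \<in> hom K H B" for j unfolding e_def by (rule Comp_in_hom[OF U(4)[OF H] ev'])
  have eps: "\<epsilon> \<in> hom (HomCat K H B) (e False) (e True)"
    unfolding \<epsilon>_def e_def using whisker_in_hom(1)[OF U(3)[OF H] H U(2)[OF H] ev'] .
  \<comment> \<open>Whiskering \<open>\<epsilon>\<close> with \<open>h\<close> is thus transposition
    followed by whiskering with \<open>\<sigma> A\<close>. Both are bijective, which settles the
    1-cells in \<open>V1\<close> and \<open>V1u\<close>.\<close>
  have eh: "\<epsilon> \<lhd> h = tr A h \<rhd> \<sigma> A" and trh: "tr A h \<in> hom K (S A) B" if h: "h \<in> hom K A H" for A h
  proof -
    have A: "A \<in> Obj K" using hom_Obj h by blast
    obtain x where x: "x \<in> hom K (S A) (S H)" "x \<rhd> \<sigma> A = \<sigma> H \<lhd> h" "ev' \<cdot> x = tr A h"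
      using tr[OF h] by blast
    show "tr A h \<in> hom K (S A) B" using Comp_in_hom[OF x(1) ev'] x(3) by simp
    have "\<epsilon> \<lhd> h = ev' \<rhd> x \<rhd> \<sigma> A"
      unfolding \<epsilon>_def using whisker_assoc(3)[OF U(3)[OF H] H U(2)[OF H] ev' h] x(2) by simp
    then show "\<epsilon> \<lhd> h = tr A h \<rhd> \<sigma> A" using whisker_assoc(1)[OF U(3)[OF A] A U(2)[OF A] x(1) ev'] x(3) by simp
  qed
  have V1: "\<exists>h \<in> hom K A H. \<epsilon> \<lhd> h = \<tau>" if A: "A \<in> Obj K" and t: "\<tau> \<in> Arr (HomCat K A B)" for A \<tau>
  proof -
    obtain f where "f \<in> hom K (S A) B" "f \<rhd> \<sigma> A = \<tau>" using U(5)[OF A B t] by blast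
    then show ?thesis using exq[OF A] eh by metis
  qed
  have V1u: "h = k" if h: "h \<in> hom K A H" and k: "k \<in> hom K A H" and "\<epsilon> \<lhd> h = \<epsilon> \<lhd> k" for A h k
  proof -
    have A: "A \<in> Obj K" using hom_Obj h by blast
    have "tr A h = tr A k" using U(6)[OF A trh[OF h] trh[OF k]] eh[OF h] eh[OF k] that(3) by simp
    then show ?thesis using exq[OF A trh[OF h]] h k by metis
  qed
  \<comment> \<open>The square is read in the other direction. Its sides \<open>a\<close> and
    \<open>b\<close> become arrows \<open>f\<close> and \<open>g\<close> out of \<open>S A\<close>,
    and the sides \<open>\<epsilon> \<lhd> h\<close> and \<open>\<epsilon> \<lhd> k\<close> make up
    a 2-cell from \<open>f\<close> to \<open>g\<close>. By \<open>V1\<close> over \<open>S A\<close>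
    this 2-cell is an arrow \<open>u\<close> into \<open>H\<close>, and
    \<open>u \<rhd> \<sigma> A\<close> is the 2-cell sought.\<close>
  have V2: "\<exists>\<theta> \<in> hom (HomCat K A H) h k. e False \<rhd> \<theta> = a \<and> e True \<rhd> \<theta> = b"
    if h: "h \<in> hom K A H" and k: "k \<in> hom K A H"
      and a: "a \<in> hom (HomCat K A B) (e False \<cdot> h) (e False \<cdot> k)"
      and b: "b \<in> hom (HomCat K A B) (e True \<cdot> h) (e True \<cdot> k)"
      and ab: "(\<epsilon> \<lhd> k) \<cdot>\<^bsub>HomCat K A B\<^esub> a = b \<cdot>\<^bsub>HomCat K A B\<^esub> (\<epsilon> \<lhd> h)" for A h k a b
  proof -
    have A: "A \<in> Obj K" using hom_Obj h by blast
    note U = copower_cellD[OF cell[OF A]]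
    note oS = U(2)
    note si = whisker_in_hom(1)[OF U(3) A oS]
    obtain f where f: "f \<in> hom K (S A) B" "f \<rhd> \<sigma> A = a" using U(5)[OF B hom_Arr(1)[OF a]] by blast
    obtain g where g: "g \<in> hom K (S A) B" "g \<rhd> \<sigma> A = b" using U(5)[OF B hom_Arr(1)[OF b]] by blast
    have fg: "f \<cdot> i A False = e False \<cdot> h" "f \<cdot> i A True = e False \<cdot> k"
      "g \<cdot> i A False = e True \<cdot> h" "g \<cdot> i A True = e True \<cdot> k"
      using si[OF f(1)] si[OF g(1)] f(2) g(2) a b by (auto simp: hom_def)
    have "\<exists>\<tau> \<in> hom (HomCat K (S A) B) f g. \<tau> \<lhd> i A False = \<epsilon> \<lhd> h \<and> \<tau> \<lhd> i A True = \<epsilon> \<lhd> k"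
      using U(7)[OF f(1) g(1), of "\<epsilon> \<lhd> h" "\<epsilon> \<lhd> k"] fg f(2) g(2) ab
        whisker_in_hom(2)[OF eps H B h] whisker_in_hom(2)[OF eps H B k] by simp
    then obtain \<tau> where t: "\<tau> \<in> hom (HomCat K (S A) B) f g" "\<tau> \<lhd> i A False = \<epsilon> \<lhd> h" "\<tau> \<lhd> i A True = \<epsilon> \<lhd> k"
      by blast
    obtain u where u: "u \<in> hom K (S A) H" "\<epsilon> \<lhd> u = \<tau>" using V1[OF oS hom_Arr(1)[OF t(1)]] by blast
    have ui: "\<epsilon> \<lhd> (u \<cdot> i A j) = \<tau> \<lhd> i A j" for j
      using whisker_assoc(2)[OF eps H B u(1) U(4)] u(2) by simp
    \<comment> \<open>\<open>V1u\<close> identifies the ends of \<open>u\<close>, because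
      \<open>\<epsilon>\<close> whiskers them to \<open>\<epsilon> \<lhd> h\<close> and
      \<open>\<epsilon> \<lhd> k\<close>.\<close>
    have uh: "u \<cdot> i A False = h" "u \<cdot> i A True = k"
      using V1u[OF Comp_in_hom[OF U(4) u(1)] h] V1u[OF Comp_in_hom[OF U(4) u(1)] k] ui t by simp_all
    have "e False \<cdot> u = f" "e True \<cdot> u = g"
      using whisker_in_hom(2)[OF eps H B u(1)] u(2) t(1) by (auto simp: hom_def)
    then have "e False \<rhd> u \<rhd> \<sigma> A = a" "e True \<rhd> u \<rhd> \<sigma> A = b"
      using whisker_assoc(1)[OF U(3) A oS u(1) e] f(2) g(2) by simp_all
    then show ?thesis using si[OF u(1)] uh by auto
  qed
  have V2u: "\<theta> = \<theta>'"
    if A: "A \<in> Obj K" and t: "\<theta> \<in> hom (HomCat K A H) h k" and t': "\<theta>' \<in> hom (HomCat K A H) h k"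
      and eq: "e False \<rhd> \<theta> = e False \<rhd> \<theta>'" "e True \<rhd> \<theta> = e True \<rhd> \<theta>'" for A h k \<theta> \<theta>'
  proof -
    note U = copower_cellD[OF cell[OF A]]
    note oS = U(2)
    note si = whisker_in_hom(1)[OF U(3) A oS]
    obtain u where u: "u \<in> hom K (S A) H" "u \<rhd> \<sigma> A = \<theta>" using U(5)[OF H hom_Arr(1)[OF t]] by blast
    obtain v where v: "v \<in> hom K (S A) H" "v \<rhd> \<sigma> A = \<theta>'" using U(5)[OF H hom_Arr(1)[OF t']] by blast
    have uv: "u \<cdot> i A False = v \<cdot> i A False" "u \<cdot> i A True = v \<cdot> i A True"
      using si[OF u(1)] si[OF v(1)] u(2) v(2) t t' by (auto simp: hom_def)
    have "e j \<rhd> \<theta> = e j \<rhd> \<theta>'" for j using eq by (cases j) auto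
    then have e_uv: "e j \<cdot> u = e j \<cdot> v" for j
      using U(6)[OF Comp_in_hom[OF u(1) e] Comp_in_hom[OF v(1) e]] u(2) v(2)
        whisker_assoc(1)[OF U(3) A oS u(1) e] whisker_assoc(1)[OF U(3) A oS v(1) e] by metis
    \<comment> \<open>The two directions of the square again: the hypotheses \<open>eq\<close> give
      both 2-cells the same boundary, and the common boundary of \<open>\<theta>\<close> and
      \<open>\<theta>'\<close> makes them agree along both legs.\<close>
    have "\<epsilon> \<lhd> u = \<epsilon> \<lhd> v"
    proof (rule U(8)[OF B])
      show "\<epsilon> \<lhd> u \<in> hom (HomCat K (S A) B) (e False \<cdot> u) (e True \<cdot> u)"
        using whisker_in_hom(2)[OF eps H B u(1)] .
      show "\<epsilon> \<lhd> v \<in> hom (HomCat K (S A) B) (e False \<cdot> u) (e True \<cdot> u)"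
        using whisker_in_hom(2)[OF eps H B v(1)] e_uv by simp
      show "\<epsilon> \<lhd> u \<lhd> i A False = \<epsilon> \<lhd> v \<lhd> i A False" "\<epsilon> \<lhd> u \<lhd> i A True = \<epsilon> \<lhd> v \<lhd> i A True"
        using whisker_assoc(2)[OF eps H B u(1) U(4)] whisker_assoc(2)[OF eps H B v(1) U(4)] uv by simp_all
    qed
    then show ?thesis using V1u[OF u(1) v(1)] u(2) v(2) by simp
  qed
  have "power_cell B H e \<epsilon>"
    unfolding power_cell_def using B H eps V1 V1u V2 V2u by simp
  then show ?thesis by (rule is_power_power_cell)
qed

end

section \<open>Products of internal categories\<close>

context category begin

lemma product_iso:
  assumes P: "is_product C A B P p q" and P': "is_product C A B P' p' q'"
  shows "\<exists>j \<in> hom C P P'. \<exists>k \<in> hom C P' P. p' \<cdot> j = p \<and> q' \<cdot> j = q \<and>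
     k \<cdot> j = Ident C P \<and> j \<cdot> k = Ident C P'"
proof -
  note h = product_homs[OF P] and h' = product_homs[OF P']
  define j where "j = pairing C p' q' p q"
  define k where "k = pairing C p q p' q'"
  note j = product_pairing[OF P' h(1,2), folded j_def] and k = product_pairing[OF P h'(1,2), folded k_def]
  have "k \<cdot> j = Ident C P"
    by (rule product_ext[OF P Comp_in_hom[OF j(1) k(1)] Ident_in_hom[OF h(5)]])
      (use j k h Comp_assoc[OF j(1) k(1) h(1), symmetric] Comp_assoc[OF j(1) k(1) h(2), symmetric] Comp_Ident[OF h(1)] Comp_Ident[OF h(2)] in simp_all)
  moreover have "j \<cdot> k = Ident C P'"
    by (rule product_ext[OF P' Comp_in_hom[OF k(1) j(1)] Ident_in_hom[OF h'(5)]])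
      (use j k h' Comp_assoc[OF k(1) j(1) h'(1), symmetric] Comp_assoc[OF k(1) j(1) h'(2), symmetric] Comp_Ident[OF h'(1)] Comp_Ident[OF h'(2)] in simp_all)
  ultimately show ?thesis using j k by blast
qed

lemma product_transfer:
  assumes P': "is_product C A B P' p' q'" and j: "j \<in> hom C P P'" and k: "k \<in> hom C P' P"
    and jk: "k \<cdot> j = Ident C P" "j \<cdot> k = Ident C P'"
  shows "is_product C A B P (p' \<cdot> j) (q' \<cdot> j)"
  unfolding is_product_def
proof (intro conjI ballI)
  note h = product_homs[OF P']
  show "A \<in> Obj C" "B \<in> Obj C" "P \<in> Obj C" "p' \<cdot> j \<in> hom C P A" "q' \<cdot> j \<in> hom C P B"
    using h hom_Obj[OF j] Comp_in_hom[OF j] by auto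
  fix X f g assume f: "f \<in> hom C X A" and g: "g \<in> hom C X B"
  note u = product_pairing[OF P' f g]
  let ?u = "pairing C p' q' f g"
  have jku: "j \<cdot> (k \<cdot> ?u) = ?u" using Comp_assoc[OF u(1) k j] jk Ident_Comp[OF u(1)] by simp
  note ku = Comp_in_hom[OF u(1) k]
  show "\<exists>!u. u \<in> hom C X P \<and> (p' \<cdot> j) \<cdot> u = f \<and> (q' \<cdot> j) \<cdot> u = g"
  proof (intro ex1I[of _ "k \<cdot> ?u"] conjI ku)
    show "(p' \<cdot> j) \<cdot> k \<cdot> ?u = f" "(q' \<cdot> j) \<cdot> k \<cdot> ?u = g"
      using Comp_assoc[OF ku j h(1)] Comp_assoc[OF ku j h(2)] jku u by simp_all
    fix v assume v: "v \<in> hom C X P \<and> (p' \<cdot> j) \<cdot> v = f \<and> (q' \<cdot> j) \<cdot> v = g"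
    then have v': "v \<in> hom C X P" by simp
    have "j \<cdot> v = ?u"
      by (rule product_ext[OF P' Comp_in_hom[OF v' j] u(1)])
        (use v u Comp_assoc[OF v' j h(1)] Comp_assoc[OF v' j h(2)] in simp_all)
    then show "v = k \<cdot> ?u" using Comp_assoc[OF v' j k] jk Ident_Comp[OF v'] by simp
  qed
qed

lemma pullback_homs:
  assumes "is_pullback C f g P p q"
  shows "f \<in> hom C (Dom C f) (Cod C f)" "g \<in> hom C (Dom C g) (Cod C f)" "p \<in> hom C P (Dom C f)"
    "q \<in> hom C P (Dom C g)" "f \<cdot> p = g \<cdot> q" "P \<in> Obj C"
  using assms by (auto simp: is_pullback_def hom_def)

lemma pullback_ext:
  assumes P: "is_pullback C f g P p q" and u: "u \<in> hom C X P" and v: "v \<in> hom C X P"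
    and e: "p \<cdot> u = p \<cdot> v" "q \<cdot> u = q \<cdot> v"
  shows "u = v"
proof -
  note h = pullback_homs[OF P]
  have "f \<cdot> p \<cdot> v = g \<cdot> q \<cdot> v"
    using Comp_assoc[OF v h(3,1)] Comp_assoc[OF v h(4,2)] h(5) by simp
  then show ?thesis
    using pairing_pullback(4)[OF P Comp_in_hom[OF v h(3)] Comp_in_hom[OF v h(4)]] u v e by metis
qed

lemma ICat_hom: "F \<in> hom (ICat C) A B \<longleftrightarrow> is_ifun C F \<and> fdom F = A \<and> fcod F = B"
  by (auto simp: hom_def ICat_def)

text \<open>A generalized element of \<open>Ob2 A\<close> is the pairing of its own
  projections.\<close>

lemma cmp_eq_icomp:
  assumes A: "is_icat C A" and x: "x \<in> hom C X (Ob2 A)"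
  shows "icomp C A (pr2 A \<cdot> x) (pr1 A \<cdot> x) = cmp A \<cdot> x"
proof -
  note H = icat_homs[OF A]
  have "tgt A \<cdot> pr1 A \<cdot> x = src A \<cdot> pr2 A \<cdot> x"
    using Comp_assoc[OF x H(5,2)] Comp_assoc[OF x H(6,1)] pullback_homs(5)[OF H(7)] by simp
  then have "x = pairing C (pr1 A) (pr2 A) (pr1 A \<cdot> x) (pr2 A \<cdot> x)"
    using pairing_pullback(4)[OF H(7), unfolded H(8,9), OF Comp_in_hom[OF x H(5)] Comp_in_hom[OF x H(6)]] x
    by simp
  then show ?thesis by (simp add: icomp_def)
qed

context
  assumes pbs: "has_pullbacks C" and prods: "has_products C"
begin

text \<open>Objects and arrows are multiplied separately, and any pullback of the resulting target
  and source serves as the object of composable pairs. The two component products are part of the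
  conclusion so that arbitrary products can be compared with this one.\<close>

lemma icat_product_exists:
  assumes A: "is_icat C A" and B: "is_icat C B"
  shows "\<exists>P p q. is_product (ICat C) A B P p q \<and>
    is_product C (Ob0 A) (Ob0 B) (Ob0 P) (map0 p) (map0 q) \<and>
    is_product C (Ob1 A) (Ob1 B) (Ob1 P) (map1 p) (map1 q)"
proof -
  note HA = icat_homs[OF A] and HB = icat_homs[OF B]
  obtain P0 p0 q0 where P0: "is_product C (Ob0 A) (Ob0 B) P0 p0 q0"
    using prods HA(12) HB(12) unfolding has_products_def by blast
  obtain P1 p1 q1 where P1: "is_product C (Ob1 A) (Ob1 B) P1 p1 q1"
    using prods HA(13) HB(13) unfolding has_products_def by blast
  note h0 = product_homs[OF P0] and h1 = product_homs[OF P1]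
  define s where "s = pairing C p0 q0 (src A \<cdot> p1) (src B \<cdot> q1)"
  define t where "t = pairing C p0 q0 (tgt A \<cdot> p1) (tgt B \<cdot> q1)"
  define n where "n = pairing C p1 q1 (unit_arr A \<cdot> p0) (unit_arr B \<cdot> q0)"
  note s = product_pairing[OF P0 Comp_in_hom[OF h1(1) HA(1)] Comp_in_hom[OF h1(2) HB(1)], folded s_def]
  note t = product_pairing[OF P0 Comp_in_hom[OF h1(1) HA(2)] Comp_in_hom[OF h1(2) HB(2)], folded t_def]
  note n = product_pairing[OF P1 Comp_in_hom[OF h0(1) HA(3)] Comp_in_hom[OF h0(2) HB(3)], folded n_def]
  obtain P2 r1 r2 where pb: "is_pullback C t s P2 r1 r2"
    using pbs[unfolded has_pullbacks_def, rule_format, OF hom_Arr(1)[OF t(1)] hom_Arr(1)[OF s(1)]]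
      hom_Arr(3)[OF s(1)] hom_Arr(3)[OF t(1)] by blast
  have dts: "Dom C t = P1" "Dom C s = P1" using s(1) t(1) by (auto simp: hom_def)
  note r = pullback_homs[OF pb, unfolded dts]
  \<comment> \<open>The projections commute with source and target at every generalized element;
    \<open>N\<close>, \<open>Cz\<close> and \<open>I\<close> say the same of units and composition.
    With \<open>product_ext\<close> they reduce each law for \<open>P\<close> to the same law in
    \<open>A\<close> and in \<open>B\<close>.\<close>
  have S: "p0 \<cdot> (s \<cdot> f) = src A \<cdot> (p1 \<cdot> f)" "q0 \<cdot> (s \<cdot> f) = src B \<cdot> (q1 \<cdot> f)"
    "p0 \<cdot> (t \<cdot> f) = tgt A \<cdot> (p1 \<cdot> f)" "q0 \<cdot> (t \<cdot> f) = tgt B \<cdot> (q1 \<cdot> f)"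
    "p1 \<cdot> f \<in> hom C X (Ob1 A)" "q1 \<cdot> f \<in> hom C X (Ob1 B)"
    "s \<cdot> f \<in> hom C X P0" "t \<cdot> f \<in> hom C X P0"
    if f: "f \<in> hom C X P1" for f X
    using s t Comp_assoc[OF f s(1) h0(1)] Comp_assoc[OF f s(1) h0(2)] Comp_assoc[OF f t(1) h0(1)]
      Comp_assoc[OF f t(1) h0(2)] Comp_assoc[OF f h1(1) HA(1)] Comp_assoc[OF f h1(1) HA(2)]
      Comp_assoc[OF f h1(2) HB(1)] Comp_assoc[OF f h1(2) HB(2)] Comp_in_hom[OF f h1(1)] Comp_in_hom[OF f h1(2)]
      Comp_in_hom[OF f s(1)] Comp_in_hom[OF f t(1)]
    by simp_all
  have N: "p1 \<cdot> (n \<cdot> x) = unit_arr A \<cdot> (p0 \<cdot> x)" "q1 \<cdot> (n \<cdot> x) = unit_arr B \<cdot> (q0 \<cdot> x)"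
    "n \<cdot> x \<in> hom C X P1" if x: "x \<in> hom C X P0" for x X
    using n Comp_assoc[OF x n(1) h1(1)] Comp_assoc[OF x n(1) h1(2)] Comp_assoc[OF x h0(1) HA(3)]
      Comp_assoc[OF x h0(2) HB(3)] Comp_in_hom[OF x n(1)] by simp_all
  have pt: "tgt A \<cdot> p1 \<cdot> f = src A \<cdot> p1 \<cdot> g" "tgt B \<cdot> q1 \<cdot> f = src B \<cdot> q1 \<cdot> g"
    if "f \<in> hom C X P1" "g \<in> hom C X P1" "t \<cdot> f = s \<cdot> g" for f g X
    using S(1,2)[OF that(2)] S(3,4)[OF that(1)] that(3) by simp_all
  note cA = icomp[OF A S(5)[OF r(3)] S(5)[OF r(4)] pt(1)[OF r(3,4,5)]]
    and cB = icomp[OF B S(6)[OF r(3)] S(6)[OF r(4)] pt(2)[OF r(3,4,5)]]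
  define c where "c = pairing C p1 q1 (icomp C A (p1 \<cdot> r2) (p1 \<cdot> r1)) (icomp C B (q1 \<cdot> r2) (q1 \<cdot> r1))"
  note c = product_pairing[OF P1 cA(1) cB(1), folded c_def]
  have Cz: "p1 \<cdot> (c \<cdot> z) = icomp C A (p1 \<cdot> (r2 \<cdot> z)) (p1 \<cdot> (r1 \<cdot> z))"
    "q1 \<cdot> (c \<cdot> z) = icomp C B (q1 \<cdot> (r2 \<cdot> z)) (q1 \<cdot> (r1 \<cdot> z))" "c \<cdot> z \<in> hom C X P1"
    if z: "z \<in> hom C X P2" for z X
    using c cA(4)[OF z] cB(4)[OF z] Comp_assoc[OF z c(1) h1(1)] Comp_assoc[OF z c(1) h1(2)]
      Comp_assoc[OF z r(3) h1(1)] Comp_assoc[OF z r(4) h1(1)] Comp_assoc[OF z r(3) h1(2)]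
      Comp_assoc[OF z r(4) h1(2)] Comp_in_hom[OF z c(1)] by simp_all
  define P where "P = \<lparr>Ob0 = P0, Ob1 = P1, Ob2 = P2, src = s, tgt = t, unit_arr = n, pr1 = r1, pr2 = r2, cmp = c\<rparr>"
  have P: "Ob0 P = P0" "Ob1 P = P1" "Ob2 P = P2" "src P = s" "tgt P = t" "unit_arr P = n" "pr1 P = r1"
    "pr2 P = r2" "cmp P = c" by (simp_all add: P_def)
  have I: "p1 \<cdot> icomp C P g f = icomp C A (p1 \<cdot> g) (p1 \<cdot> f)" "q1 \<cdot> icomp C P g f = icomp C B (q1 \<cdot> g) (q1 \<cdot> f)"
     "icomp C P g f \<in> hom C X P1"
    if f: "f \<in> hom C X P1" and g: "g \<in> hom C X P1" and e: "t \<cdot> f = s \<cdot> g" for f g X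
  proof -
    note w = pairing_pullback[OF pb, unfolded dts, OF f g e]
    show "p1 \<cdot> icomp C P g f = icomp C A (p1 \<cdot> g) (p1 \<cdot> f)" "q1 \<cdot> icomp C P g f = icomp C B (q1 \<cdot> g) (q1 \<cdot> f)"
     "icomp C P g f \<in> hom C X P1"
      unfolding icomp_def[of C P] P using Cz[OF w(1)] w(1-3) by simp_all
  qed
  have id1: "Ident C P1 \<in> hom C P1 P1" and id0: "Ident C P0 \<in> hom C P0 P0"
    using Ident_in_hom h0(5) h1(5) by auto
  note ids = Comp_Ident[OF h0(1)] Comp_Ident[OF h0(2)] Comp_Ident[OF h1(1)] Comp_Ident[OF h1(2)]
    Comp_Ident[OF s(1)] Comp_Ident[OF t(1)] Comp_Ident[OF n(1)] Comp_Ident[OF r(3)] Comp_Ident[OF r(4)]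
    Comp_Ident[OF c(1)]
  have "is_icat C P"
    unfolding is_icat_def P
  proof (intro conjI allI impI pb)
    show "P0 \<in> Obj C" "P1 \<in> Obj C" "s \<in> hom C P1 P0" "t \<in> hom C P1 P0" "n \<in> hom C P0 P1" "c \<in> hom C P2 P1"
      using h0 h1 s t n c by auto
    show "s \<cdot> n = Ident C P0"
      by (rule product_ext[OF P0 S(7)[OF n(1)] id0])
        (use S(1,2)[OF n(1)] n unit_elt(2)[OF A h0(1)] unit_elt(2)[OF B h0(2)] ids in simp_all)
    show "t \<cdot> n = Ident C P0"
      by (rule product_ext[OF P0 S(8)[OF n(1)] id0])
        (use S(3,4)[OF n(1)] n unit_elt(3)[OF A h0(1)] unit_elt(3)[OF B h0(2)] ids in simp_all)
    show sc: "s \<cdot> c = s \<cdot> r1"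
      by (rule product_ext[OF P0 S(7)[OF c(1)] S(7)[OF r(3)]])
        (use S(1,2)[OF c(1)] S(1,2)[OF r(3)] c cA(2) cB(2) in simp_all)
    show tc: "t \<cdot> c = t \<cdot> r2"
      by (rule product_ext[OF P0 S(8)[OF c(1)] S(8)[OF r(4)]])
        (use S(3,4)[OF c(1)] S(3,4)[OF r(4)] c cA(3) cB(3) in simp_all)
    note sA = unit_elt(3)[OF A Comp_in_hom[OF h1(1) HA(1)]] unit_elt(3)[OF B Comp_in_hom[OF h1(2) HB(1)]]
      and tA = unit_elt(2)[OF A Comp_in_hom[OF h1(1) HA(2)]] unit_elt(2)[OF B Comp_in_hom[OF h1(2) HB(2)]]
    have e1: "t \<cdot> n \<cdot> s = s \<cdot> Ident C P1" unfolding Comp_Ident[OF s(1)]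
      by (rule product_ext[OF P0 S(8)[OF N(3)[OF s(1)]] s(1)])
        (use S(3,4)[OF N(3)[OF s(1)]] N(1,2)[OF s(1)] s sA in simp_all)
    have e2: "t \<cdot> Ident C P1 = s \<cdot> n \<cdot> t" unfolding Comp_Ident[OF t(1)]
      by (rule product_ext[OF P0 t(1) S(7)[OF N(3)[OF t(1)]]])
        (use S(1,2)[OF N(3)[OF t(1)]] N(1,2)[OF t(1)] t tA in simp_all)
    show "icomp C P (Ident C P1) (n \<cdot> s) = Ident C P1"
      by (rule product_ext[OF P1 I(3)[OF N(3)[OF s(1)] id1 e1] id1])
        (use I[OF N(3)[OF s(1)] id1 e1] N[OF s(1)] s ids icomp_unit[OF A h1(1)] icomp_unit[OF B h1(2)] in simp_all)
    show "icomp C P (n \<cdot> t) (Ident C P1) = Ident C P1"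
      by (rule product_ext[OF P1 I(3)[OF id1 N(3)[OF t(1)] e2] id1])
        (use I[OF id1 N(3)[OF t(1)] e2] N[OF t(1)] t ids icomp_unit[OF A h1(1)] icomp_unit[OF B h1(2)] in simp_all)
    \<comment> \<open>The generic composable triple over \<open>T\<close> consists of
      \<open>r1 \<cdot> q\<close>, the shared arrow \<open>r2 \<cdot> q = r1 \<cdot> r\<close>, and
      \<open>r2 \<cdot> r\<close>.\<close>
    fix T q r assume T: "is_pullback C r2 r1 T q r"
    have "Dom C r2 = P2" "Dom C r1 = P2" using r by (auto simp: hom_def)
    note T = pullback_homs[OF T, unfolded this]
    note h = Comp_in_hom[OF T(3) r(3)] Comp_in_hom[OF T(3) r(4)] Comp_in_hom[OF T(4) r(4)]
    have tt: "t \<cdot> r1 \<cdot> q = s \<cdot> r2 \<cdot> q" "t \<cdot> r2 \<cdot> q = s \<cdot> r2 \<cdot> r"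
      using Comp_assoc[OF T(3) r(3) t(1)] Comp_assoc[OF T(3) r(4) s(1)] Comp_assoc[OF T(4) r(3) t(1)]
        Comp_assoc[OF T(4) r(4) s(1)] r(5) T(5) by simp_all
    have c1: "t \<cdot> c \<cdot> q = s \<cdot> r2 \<cdot> r" and c2: "t \<cdot> r1 \<cdot> q = s \<cdot> c \<cdot> r"
      using sc tc Comp_assoc[OF T(3) c(1) t(1)] Comp_assoc[OF T(4) c(1) s(1)]
        Comp_assoc[OF T(3) r(4) t(1)] Comp_assoc[OF T(4) r(3) s(1)] tt T(5) by simp_all
    note i1 = I[OF Cz(3)[OF T(3)] h(3) c1] and i2 = I[OF h(1) Cz(3)[OF T(4)] c2]
    note as = icomp_assoc[OF pbs A S(5)[OF h(1)] S(5)[OF h(2)] S(5)[OF h(3)] pt(1)[OF h(1,2) tt(1)] pt(1)[OF h(2,3) tt(2)]]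
      icomp_assoc[OF pbs B S(6)[OF h(1)] S(6)[OF h(2)] S(6)[OF h(3)] pt(2)[OF h(1,2) tt(1)] pt(2)[OF h(2,3) tt(2)]]
    show "icomp C P (r2 \<cdot> r) (c \<cdot> q) = icomp C P (c \<cdot> r) (r1 \<cdot> q)"
      by (rule product_ext[OF P1 i1(3) i2(3)]) (use i1 i2 Cz[OF T(3)] Cz[OF T(4)] T(5) as in simp_all)
  qed
  note icP = this
  define p where "p = \<lparr>fdom = P, fcod = A, map0 = p0, map1 = p1\<rparr>"
  define q where "q = \<lparr>fdom = P, fcod = B, map0 = q0, map1 = q1\<rparr>"
  have pq: "is_ifun C p" "is_ifun C q"
    unfolding is_ifun_def p_def q_def using A B icP h0 h1 s t n c by (simp_all add: P)
  have "is_product (ICat C) A B P p q"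
    unfolding is_product_def
  proof (intro conjI ballI)
    show "A \<in> Obj (ICat C)" "B \<in> Obj (ICat C)" "P \<in> Obj (ICat C)" using A B icP by (simp_all add: ICat_simps[OF pbs])
    show "p \<in> hom (ICat C) P A" "q \<in> hom (ICat C) P B" using pq by (simp_all add: ICat_hom p_def q_def)
    fix X F G assume F: "F \<in> hom (ICat C) X A" and G: "G \<in> hom (ICat C) X B"
    have F: "is_ifun C F" "fdom F = X" "fcod F = A" and G: "is_ifun C G" "fdom G = X" "fcod G = B"
      using F G by (simp_all add: ICat_hom)
    note f = ifun[OF F(1), unfolded F(2,3)] and g = ifun[OF G(1), unfolded G(2,3)]
    note HX = icat_homs[OF f(1)]
    define u0 where "u0 = pairing C p0 q0 (map0 F) (map0 G)"
    define u1 where "u1 = pairing C p1 q1 (map1 F) (map1 G)"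
    note u0 = product_pairing[OF P0 f(3) g(3), folded u0_def] and u1 = product_pairing[OF P1 f(4) g(4), folded u1_def]
    define u where "u = \<lparr>fdom = X, fcod = P, map0 = u0, map1 = u1\<rparr>"
    have U0: "p0 \<cdot> (u0 \<cdot> x) = map0 F \<cdot> x" "q0 \<cdot> (u0 \<cdot> x) = map0 G \<cdot> x" if x: "x \<in> hom C Y (Ob0 X)" for x Y
      using Comp_assoc[OF x u0(1) h0(1)] Comp_assoc[OF x u0(1) h0(2)] u0 by simp_all
    have U1: "p1 \<cdot> (u1 \<cdot> x) = map1 F \<cdot> x" "q1 \<cdot> (u1 \<cdot> x) = map1 G \<cdot> x" "u1 \<cdot> x \<in> hom C Y P1"
      if x: "x \<in> hom C Y (Ob1 X)" for x Y
      using Comp_assoc[OF x u1(1) h1(1)] Comp_assoc[OF x u1(1) h1(2)] u1 Comp_in_hom[OF x u1(1)] by simp_all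
    have su: "s \<cdot> u1 = u0 \<cdot> src X"
      by (rule product_ext[OF P0 S(7)[OF u1(1)] Comp_in_hom[OF HX(1) u0(1)]])
        (use S[OF u1(1)] U0[OF HX(1)] u1 f g in simp_all)
    have tu: "t \<cdot> u1 = u0 \<cdot> tgt X"
      by (rule product_ext[OF P0 S(8)[OF u1(1)] Comp_in_hom[OF HX(2) u0(1)]])
        (use S[OF u1(1)] U0[OF HX(2)] u1 f g in simp_all)
    have nu: "n \<cdot> u0 = u1 \<cdot> unit_arr X"
      by (rule product_ext[OF P1 N(3)[OF u0(1)] U1(3)[OF HX(3)]])
        (use N[OF u0(1)] U1[OF HX(3)] u0 f g in simp_all)
    have "t \<cdot> u1 \<cdot> pr1 X = s \<cdot> u1 \<cdot> pr2 X"
      using su tu Comp_assoc[OF HX(5) u1(1) t(1)] Comp_assoc[OF HX(6) u1(1) s(1)]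
        Comp_assoc[OF HX(5) HX(2) u0(1)] Comp_assoc[OF HX(6) HX(1) u0(1)] pullback_homs(5)[OF HX(7)] by simp
    note iu = I[OF U1(3)[OF HX(5)] U1(3)[OF HX(6)] this]
    have "icomp C P (u1 \<cdot> pr2 X) (u1 \<cdot> pr1 X) = u1 \<cdot> cmp X"
      by (rule product_ext[OF P1 iu(3) U1(3)[OF HX(4)]])
        (use iu U1[OF HX(4)] U1[OF HX(5)] U1[OF HX(6)] F G in \<open>simp_all add: is_ifun_def\<close>)
    then have u: "is_ifun C u" "fdom u = X" "fcod u = P"
      unfolding is_ifun_def u_def using f(1) icP u0(1) u1(1) su tu nu by (simp_all add: P)
    show "\<exists>!u. u \<in> hom (ICat C) X P \<and> p \<cdot>\<^bsub>ICat C\<^esub> u = F \<and> q \<cdot>\<^bsub>ICat C\<^esub> u = G"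
    proof (intro ex1I[of _ u] conjI)
      show "u \<in> hom (ICat C) X P" using u by (simp add: ICat_hom)
      show "p \<cdot>\<^bsub>ICat C\<^esub> u = F" "q \<cdot>\<^bsub>ICat C\<^esub> u = G"
        using u0 u1 F G by (simp_all add: ICat_simps[OF pbs] comp_ifun_def p_def q_def u_def)
      fix v assume "v \<in> hom (ICat C) X P \<and> p \<cdot>\<^bsub>ICat C\<^esub> v = F \<and> q \<cdot>\<^bsub>ICat C\<^esub> v = G"
      then have v: "is_ifun C v" "fdom v = X" "fcod v = P" "p0 \<cdot> map0 v = map0 F" "p1 \<cdot> map1 v = map1 F"
        "q0 \<cdot> map0 v = map0 G" "q1 \<cdot> map1 v = map1 G"
        by (auto simp: ICat_hom ICat_simps[OF pbs] comp_ifun_def p_def q_def)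
      note w = ifun[OF v(1), unfolded v(2,3) P]
      have "map0 v = u0" by (rule product_ext[OF P0 w(3) u0(1)]) (use v u0 in simp_all)
      moreover have "map1 v = u1" by (rule product_ext[OF P1 w(4) u1(1)]) (use v u1 in simp_all)
      ultimately show "v = u" using v by (simp add: u_def)
    qed
  qed
  then show ?thesis using P0 P1 P(1,2) by (intro exI[of _ P] exI[of _ p] exI[of _ q]) (simp add: p_def q_def)
qed

text \<open>Any product cone is isomorphic to the componentwise one. The isomorphism of internal
  categories consists of isomorphisms on objects and on arrows, and along these the two component
  products are carried over.\<close>

lemma icat_product_components:
  assumes P: "is_product (ICat C) A B P p q"
  shows "is_product C (Ob0 A) (Ob0 B) (Ob0 P) (map0 p) (map0 q)"
    "is_product C (Ob1 A) (Ob1 B) (Ob1 P) (map1 p) (map1 q)"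
proof -
  interpret I: category "ICat C" by (rule ICat_category[OF pbs])
  have "is_icat C A" "is_icat C B" using I.product_homs[OF P] by (simp_all add: ICat_simps[OF pbs])
  from icat_product_exists[OF this] obtain P' p' q' where P': "is_product (ICat C) A B P' p' q'"
    "is_product C (Ob0 A) (Ob0 B) (Ob0 P') (map0 p') (map0 q')"
    "is_product C (Ob1 A) (Ob1 B) (Ob1 P') (map1 p') (map1 q')" by blast
  obtain j k where jk: "j \<in> hom (ICat C) P P'" "k \<in> hom (ICat C) P' P" "p' \<cdot>\<^bsub>ICat C\<^esub> j = p"
    "q' \<cdot>\<^bsub>ICat C\<^esub> j = q" "k \<cdot>\<^bsub>ICat C\<^esub> j = Ident (ICat C) P" "j \<cdot>\<^bsub>ICat C\<^esub> k = Ident (ICat C) P'"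
    using I.product_iso[OF P P'(1)] by blast
  have J: "is_ifun C j" "fdom j = P" "fcod j = P'" and K: "is_ifun C k" "fdom k = P'" "fcod k = P"
    using jk by (simp_all add: ICat_hom)
  note j = ifun[OF J(1), unfolded J(2,3)] and k = ifun[OF K(1), unfolded K(2,3)]
  have e: "map0 p = map0 p' \<cdot> map0 j" "map1 p = map1 p' \<cdot> map1 j" "map0 q = map0 q' \<cdot> map0 j"
    "map1 q = map1 q' \<cdot> map1 j" "map0 k \<cdot> map0 j = Ident C (Ob0 P)" "map1 k \<cdot> map1 j = Ident C (Ob1 P)"
    "map0 j \<cdot> map0 k = Ident C (Ob0 P')" "map1 j \<cdot> map1 k = Ident C (Ob1 P')"
    using jk(3-6) by (auto simp: ICat_simps[OF pbs] comp_ifun_def)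
  show "is_product C (Ob0 A) (Ob0 B) (Ob0 P) (map0 p) (map0 q)"
    using product_transfer[OF P'(2) j(3) k(3) e(5,7)] e by simp
  show "is_product C (Ob1 A) (Ob1 B) (Ob1 P) (map1 p) (map1 q)"
    using product_transfer[OF P'(3) j(4) k(4) e(6,8)] e by simp
qed

end
end

section \<open>Cylinders\<close>

text \<open>The component of an identity 2-cell is an identity arrow, so one of the two factors in
  the formula for \<open>HComp\<close> cancels by \<open>icomp_unit\<close>.\<close>

lemma (in category) ICat_whisker:
  assumes pbs: "has_pullbacks C"
  shows "\<lbrakk>is_ifun C h; is_inat C \<alpha>; fcod (ndom \<alpha>) = fdom h\<rbrakk> \<Longrightarrow>
      HComp (ICat C) (id_cell (ICat C) h) \<alpha> =
      \<lparr>ndom = comp_ifun C h (ndom \<alpha>), ncod = comp_ifun C h (ncod \<alpha>), ncomp = map1 h \<cdot> ncomp \<alpha>\<rparr>"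
    "\<lbrakk>is_ifun C u; is_inat C \<beta>; fcod u = fdom (ndom \<beta>)\<rbrakk> \<Longrightarrow>
      HComp (ICat C) \<beta> (id_cell (ICat C) u) =
      \<lparr>ndom = comp_ifun C (ndom \<beta>) u, ncod = comp_ifun C (ncod \<beta>) u, ncomp = ncomp \<beta> \<cdot> map0 u\<rparr>"
proof -
  have id: "id_cell (ICat C) h = \<lparr>ndom = h, ncod = h, ncomp = unit_arr (fcod h) \<cdot> map0 h\<rparr>" for h
    by (simp add: ICat_def)
  show "HComp (ICat C) (id_cell (ICat C) h) \<alpha> =
      \<lparr>ndom = comp_ifun C h (ndom \<alpha>), ncod = comp_ifun C h (ncod \<alpha>), ncomp = map1 h \<cdot> ncomp \<alpha>\<rparr>"
    if h: "is_ifun C h" and a: "is_inat C \<alpha>" and e: "fcod (ndom \<alpha>) = fdom h"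
  proof -
    note I = inat[OF a, unfolded e] and H = ifun[OF h]
    note G = ifun[OF I(2), unfolded I(3,4)]
    note m = ifun_elt[OF h I(5)]
    have "(unit_arr (fcod h) \<cdot> map0 h) \<cdot> map0 (ncod \<alpha>) = unit_arr (fcod h) \<cdot> tgt (fcod h) \<cdot> map1 h \<cdot> ncomp \<alpha>"
      using Comp_assoc[OF G(3) H(3) icat_homs(3)[OF H(2)]] m(3) I(7) by simp
    then show ?thesis unfolding id using icomp_unit(2)[OF H(2) m(1)] by (simp add: ICat_simps[OF pbs])
  qed
  show "HComp (ICat C) \<beta> (id_cell (ICat C) u) =
      \<lparr>ndom = comp_ifun C (ndom \<beta>) u, ncod = comp_ifun C (ncod \<beta>) u, ncomp = ncomp \<beta> \<cdot> map0 u\<rparr>"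
    if u: "is_ifun C u" and b: "is_inat C \<beta>" and e: "fcod u = fdom (ndom \<beta>)"
  proof -
    note U = ifun[OF u, unfolded e] and I = inat[OF b]
    note m = inat_elt[OF b U(3)]
    have "map1 (ndom \<beta>) \<cdot> unit_arr (fdom (ndom \<beta>)) \<cdot> map0 u =
        unit_arr (fcod (ndom \<beta>)) \<cdot> src (fcod (ndom \<beta>)) \<cdot> ncomp \<beta> \<cdot> map0 u"
      using ifun_unit_elt[OF I(1) U(3)] m(2) by simp
    then show ?thesis
      unfolding id using icomp_unit(1)[OF ifun(2)[OF I(1)] m(1)] e by (simp add: ICat_simps[OF pbs])
  qed
qed

text \<open>The product \<open>S\<close> of \<open>A\<close> with the free-living arrow, seen through the copies of \<open>A\<close> that it is
  made of: \<open>j0 i\<close>, \<open>j1 i k\<close> and \<open>j2 i k l\<close> embed the objects, arrows and composable pairs of \<open>A\<close>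
  as those lying over a chain of \<open>False \<le> True\<close>.\<close>

locale cylinder = category C for C :: "('o, 'm, 'z) cat_scheme" (structure) +
  fixes A S :: "('o, 'm) icat"
    and j0 :: "bool \<Rightarrow> 'm" and j1 :: "bool \<Rightarrow> bool \<Rightarrow> 'm" and j2 :: "bool \<Rightarrow> bool \<Rightarrow> bool \<Rightarrow> 'm"
  assumes pbs: "has_pullbacks C" and A: "is_icat C A" and S: "is_icat C S"
    and j0: "j0 i \<in> hom C (Ob0 A) (Ob0 S)"
    and j1: "i \<le> k \<Longrightarrow> j1 i k \<in> hom C (Ob1 A) (Ob1 S)"
    and j2: "\<lbrakk>i \<le> k; k \<le> l\<rbrakk> \<Longrightarrow> j2 i k l \<in> hom C (Ob2 A) (Ob2 S)"
    and src_j1: "i \<le> k \<Longrightarrow> src S \<cdot> j1 i k = j0 i \<cdot> src A"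
    and tgt_j1: "i \<le> k \<Longrightarrow> tgt S \<cdot> j1 i k = j0 k \<cdot> tgt A"
    and unit_j0: "unit_arr S \<cdot> j0 i = j1 i i \<cdot> unit_arr A"
    and pr1_j2: "\<lbrakk>i \<le> k; k \<le> l\<rbrakk> \<Longrightarrow> pr1 S \<cdot> j2 i k l = j1 i k \<cdot> pr1 A"
    and pr2_j2: "\<lbrakk>i \<le> k; k \<le> l\<rbrakk> \<Longrightarrow> pr2 S \<cdot> j2 i k l = j1 k l \<cdot> pr2 A"
    and cmp_j2: "\<lbrakk>i \<le> k; k \<le> l\<rbrakk> \<Longrightarrow> cmp S \<cdot> j2 i k l = j1 i l \<cdot> cmp A"
    and ex0: "\<lbrakk>\<And>i. f i \<in> hom C (Ob0 A) Z\<rbrakk> \<Longrightarrow> \<exists>u \<in> hom C (Ob0 S) Z. \<forall>i. u \<cdot> j0 i = f i"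
    and ex1: "\<lbrakk>\<And>i k. i \<le> k \<Longrightarrow> g i k \<in> hom C (Ob1 A) Z\<rbrakk> \<Longrightarrow>
      \<exists>u \<in> hom C (Ob1 S) Z. \<forall>i k. i \<le> k \<longrightarrow> u \<cdot> j1 i k = g i k"
    and epi0: "\<lbrakk>u \<in> hom C (Ob0 S) Z; v \<in> hom C (Ob0 S) Z; \<And>i. u \<cdot> j0 i = v \<cdot> j0 i\<rbrakk> \<Longrightarrow> u = v"
    and epi1: "\<lbrakk>u \<in> hom C (Ob1 S) Z; v \<in> hom C (Ob1 S) Z;
      \<And>i k. i \<le> k \<Longrightarrow> u \<cdot> j1 i k = v \<cdot> j1 i k\<rbrakk> \<Longrightarrow> u = v"
    and epi2: "\<lbrakk>u \<in> hom C (Ob2 S) Z; v \<in> hom C (Ob2 S) Z;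
      \<And>i k l. \<lbrakk>i \<le> k; k \<le> l\<rbrakk> \<Longrightarrow> u \<cdot> j2 i k l = v \<cdot> j2 i k l\<rbrakk> \<Longrightarrow> u = v"
begin

lemmas HA = icat_homs[OF A] and HS = icat_homs[OF S]

lemma j1_elt:
  assumes "i \<le> k" and f: "f \<in> hom C X (Ob1 A)"
  shows "j1 i k \<cdot> f \<in> hom C X (Ob1 S)" "src S \<cdot> j1 i k \<cdot> f = j0 i \<cdot> src A \<cdot> f"
    "tgt S \<cdot> j1 i k \<cdot> f = j0 k \<cdot> tgt A \<cdot> f"
proof -
  note j = j1[OF assms(1)]
  show "j1 i k \<cdot> f \<in> hom C X (Ob1 S)" using Comp_in_hom[OF f j] .
  show "src S \<cdot> j1 i k \<cdot> f = j0 i \<cdot> src A \<cdot> f" "tgt S \<cdot> j1 i k \<cdot> f = j0 k \<cdot> tgt A \<cdot> f"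
    using Comp_assoc[OF f j HS(1)] Comp_assoc[OF f j HS(2)] Comp_assoc[OF f HA(1) j0] Comp_assoc[OF f HA(2) j0]
      src_j1[OF assms(1)] tgt_j1[OF assms(1)] by simp_all
qed

text \<open>The pair of \<open>f\<close> and \<open>g\<close> is an element of \<open>Ob2 A\<close>;
  its image under \<open>j2 i k l\<close> has the two given arrows as projections, and
  \<open>cmp_j2\<close> computes its composite.\<close>

lemma icomp_j1:
  assumes ik: "i \<le> k" "k \<le> l" and f: "f \<in> hom C X (Ob1 A)" and g: "g \<in> hom C X (Ob1 A)"
    and e: "tgt A \<cdot> f = src A \<cdot> g"
  shows "icomp C S (j1 k l \<cdot> g) (j1 i k \<cdot> f) = j1 i l \<cdot> icomp C A g f"
proof -
  define x where "x = pairing C (pr1 A) (pr2 A) f g"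
  note x = pairing_pullback(1-3)[OF HA(7), unfolded HA(8,9), OF f g e, folded x_def]
  note jx = Comp_in_hom[OF x(1) j2[OF ik]]
  have il: "i \<le> l" using ik by simp
  have "pr2 S \<cdot> j2 i k l \<cdot> x = j1 k l \<cdot> g" "pr1 S \<cdot> j2 i k l \<cdot> x = j1 i k \<cdot> f"
    using Comp_assoc[OF x(1) j2[OF ik] HS(5)] Comp_assoc[OF x(1) j2[OF ik] HS(6)] pr1_j2[OF ik] pr2_j2[OF ik]
      Comp_assoc[OF x(1) HA(5) j1[OF ik(1)]] Comp_assoc[OF x(1) HA(6) j1[OF ik(2)]] x(2,3) by simp_all
  then have "icomp C S (j1 k l \<cdot> g) (j1 i k \<cdot> f) = cmp S \<cdot> j2 i k l \<cdot> x"
    using cmp_eq_icomp[OF S jx] by simp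
  also have "\<dots> = j1 i l \<cdot> cmp A \<cdot> x"
    using Comp_assoc[OF x(1) j2[OF ik] HS(4)] cmp_j2[OF ik] Comp_assoc[OF x(1) HA(4) j1[OF il]] by simp
  finally show ?thesis by (simp add: icomp_def x_def)
qed

definition inc :: "bool \<Rightarrow> ('o, 'm) ifun" where
  "inc i = \<lparr>fdom = A, fcod = S, map0 = j0 i, map1 = j1 i i\<rparr>"

text \<open>The candidate for the universal 2-cell: its component at an object of \<open>A\<close>
  is the identity of that object, placed over False \<le> True.\<close>

definition gen :: "('o, 'm) inat" where
  "gen = \<lparr>ndom = inc False, ncod = inc True, ncomp = j1 False True \<cdot> unit_arr A\<rparr>"

lemma inc_simps [simp]: "fdom (inc i) = A" "fcod (inc i) = S" "map0 (inc i) = j0 i" "map1 (inc i) = j1 i i"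
  by (simp_all add: inc_def)

lemma gen_simps [simp]: "ndom gen = inc False" "ncod gen = inc True" "ncomp gen = j1 False True \<cdot> unit_arr A"
  by (simp_all add: gen_def)

section \<open>Arrows over the middle of the cylinder\<close>

lemma ident1: "Ident C (Ob1 A) \<in> hom C (Ob1 A) (Ob1 A)"
  by (rule Ident_in_hom[OF HA(13)])

lemma unit_tgt:
  "unit_arr A \<cdot> tgt A \<in> hom C (Ob1 A) (Ob1 A)" "tgt A \<cdot> Ident C (Ob1 A) = src A \<cdot> unit_arr A \<cdot> tgt A"
  "icomp C A (unit_arr A \<cdot> tgt A) (Ident C (Ob1 A)) = Ident C (Ob1 A)"
  using unit_elt[OF A HA(2)] Comp_Ident[OF HA(2)] A by (simp_all add: is_icat_def)

lemma unit_src: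
  "unit_arr A \<cdot> src A \<in> hom C (Ob1 A) (Ob1 A)" "tgt A \<cdot> unit_arr A \<cdot> src A = src A \<cdot> Ident C (Ob1 A)"
  "icomp C A (Ident C (Ob1 A)) (unit_arr A \<cdot> src A) = Ident C (Ob1 A)"
  using unit_elt[OF A HA(1)] Comp_Ident[OF HA(1)] A by (simp_all add: is_icat_def)

lemma j1_ident: "i \<le> k \<Longrightarrow> j1 i k \<cdot> Ident C (Ob1 A) = j1 i k"
  using Comp_Ident[OF j1] .

lemma le_FT: "False \<le> True" by simp

text \<open>An arrow over False \<le> True factors as its copy over False followed by
  \<open>gen\<close> at its target, and as \<open>gen\<close> at its source followed by its copy
  over True. This is \<open>icomp_j1\<close> at the generic arrow \<open>Ident C (Ob1 A)\<close>,
  and the agreement of the two factorizations is the naturality of \<open>gen\<close>.\<close>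

lemma j1_decomp: "icomp C S (j1 False True \<cdot> unit_arr A \<cdot> tgt A) (j1 False False) = j1 False True"
  "icomp C S (j1 True True) (j1 False True \<cdot> unit_arr A \<cdot> src A) = j1 False True"
  using icomp_j1[OF order_refl le_FT ident1 unit_tgt(1,2)] icomp_j1[OF le_FT order_refl unit_src(1) ident1 unit_src(2)]
    unit_tgt(3) unit_src(3) j1_ident by simp_all

lemma inc_ifun: "is_ifun C (inc i)"
proof -
  have "icomp C S (j1 i i \<cdot> pr2 A) (j1 i i \<cdot> pr1 A) = j1 i i \<cdot> cmp A"
    using icomp_j1[OF order_refl order_refl HA(5,6) pullback_homs(5)[OF HA(7)], of i]
      A cmp_eq_icomp[OF A Ident_in_hom[OF pullback_homs(6)[OF HA(7)]]]
      Comp_Ident[OF HA(4)] Comp_Ident[OF HA(5)] Comp_Ident[OF HA(6)] by simp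
  then show ?thesis
    unfolding is_ifun_def using A S j0[of i] j1[of i i] src_j1 tgt_j1 unit_j0 by simp
qed

lemma gen_inat: "is_inat C gen"
  unfolding gen_def
proof (rule inatI[OF inc_ifun inc_ifun]; simp)
  note g = j1_elt[OF le_FT HA(3)]
  show "j1 False True \<cdot> unit_arr A \<in> hom C (Ob0 A) (Ob1 S)" by (rule g)
  show "src S \<cdot> j1 False True \<cdot> unit_arr A = j0 False" "tgt S \<cdot> j1 False True \<cdot> unit_arr A = j0 True"
    using g(2,3) HA(10,11) Comp_Ident[OF j0] by simp_all
  show "icomp C S ((j1 False True \<cdot> unit_arr A) \<cdot> tgt A) (j1 False False) =
    icomp C S (j1 True True) ((j1 False True \<cdot> unit_arr A) \<cdot> src A)"
    using j1_decomp Comp_assoc[OF HA(1) HA(3) j1[OF le_FT]] Comp_assoc[OF HA(2) HA(3) j1[OF le_FT]] by simp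
qed

text \<open>Hence a functor on \<open>S\<close> is determined over the middle by its values over
  False and on \<open>gen\<close>.\<close>

lemma map1_j1_decomp:
  assumes h: "is_ifun C h" "fdom h = S"
  shows "icomp C (fcod h) (map1 h \<cdot> j1 False True \<cdot> unit_arr A \<cdot> tgt A) (map1 h \<cdot> j1 False False) = map1 h \<cdot> j1 False True"
proof -
  have "tgt S \<cdot> j1 False False = src S \<cdot> j1 False True \<cdot> unit_arr A \<cdot> tgt A"
    using j1_elt[OF le_FT unit_tgt(1)] tgt_j1[of False False] unit_elt[OF A HA(2)] by simp
  then show ?thesis
    using ifun_icomp[OF h(1), unfolded h(2), OF j1[OF order_refl] j1_elt(1)[OF le_FT unit_tgt(1)], of False]
      j1_decomp(1) by simp
qed

text \<open>The functor is \<open>ndom \<tau>\<close> over False, \<open>ncod \<tau>\<close> over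
  True, and sends an arrow over False \<le> True to the diagonal of its naturality square. Every
  equation required of it is checked on the copies of \<open>A\<close>.\<close>

lemma arrow_exists:
  assumes t: "is_inat C \<tau>" and d: "fdom (ndom \<tau>) = A" "fcod (ndom \<tau>) = B"
  shows "\<exists>h. is_ifun C h \<and> fdom h = S \<and> fcod h = B \<and> HComp (ICat C) (id_cell (ICat C) h) gen = \<tau>"
proof -
  let ?f = "ndom \<tau>" and ?g = "ncod \<tau>"
  note I = inat[OF t, unfolded d]
  note f = ifun[OF I(1), unfolded d] and g = ifun[OF I(2), unfolded I(3,4)]
  note B = f(2)
  note HB = icat_homs[OF B]
  note nt = inat_elt[OF t, unfolded d]
  \<comment> \<open>The diagonal of the naturality square of \<open>\<tau>\<close> at the generic
    arrow of \<open>A\<close>. Naturality gives it the second form \<open>D'\<close>, in which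
    \<open>\<tau>\<close> comes first.\<close>
  define D where "D = icomp C B (ncomp \<tau> \<cdot> tgt A) (map1 ?f)"
  have D': "D = icomp C B (map1 ?g) (ncomp \<tau> \<cdot> src A)"
    using inat_nat[OF t] d by (simp add: D_def)
  have mD: "tgt B \<cdot> map1 ?f = src B \<cdot> ncomp \<tau> \<cdot> tgt A" and mD': "tgt B \<cdot> ncomp \<tau> \<cdot> src A = src B \<cdot> map1 ?g"
    using nt[OF HA(2)] nt[OF HA(1)] f(6) g(5) by simp_all
  note D = icomp[OF B f(4) nt(1)[OF HA(2)] mD, folded D_def]
  note Dg = icomp(4)[OF B nt(1)[OF HA(1)] g(4) mD', folded D']
  \<comment> \<open>No chain runs from True to False; the default \<open>map1 ?g\<close> there keeps
    the type and the source of \<open>G i k\<close> right for all \<open>i\<close> and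
    \<open>k\<close>.\<close>
  define G where "G i k = (if i then map1 ?g else if k then D else map1 ?f)" for i k :: bool
  define m where "m i = (if i then map0 ?g else map0 ?f)" for i :: bool
  have G: "G i k \<in> hom C (Ob1 A) (Ob1 B)" "src B \<cdot> G i k = m i \<cdot> src A"
    "i \<le> k \<Longrightarrow> tgt B \<cdot> G i k = m k \<cdot> tgt A" for i k
    using f(4-6) g(4-6) D(1-3) nt[OF HA(2)] by (auto simp: G_def m_def)
  obtain h0 where h0: "h0 \<in> hom C (Ob0 S) (Ob0 B)" "\<And>i. h0 \<cdot> j0 i = m i"
    using ex0[of m "Ob0 B"] f(3) g(3) unfolding m_def by (metis (mono_tags, lifting))
  obtain h1 where h1: "h1 \<in> hom C (Ob1 S) (Ob1 B)" "\<And>i k. i \<le> k \<Longrightarrow> h1 \<cdot> j1 i k = G i k"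
    using ex1[of G "Ob1 B"] G(1) by blast
  have h1e: "h1 \<cdot> j1 i k \<cdot> x = G i k \<cdot> x" if "i \<le> k" "x \<in> hom C X (Ob1 A)" for i k x X
    using Comp_assoc[OF that(2) j1[OF that(1)] h1(1)] h1(2)[OF that(1)] by simp
  have h0e: "h0 \<cdot> j0 i \<cdot> x = m i \<cdot> x" if "x \<in> hom C X (Ob0 A)" for i x X
    using Comp_assoc[OF that j0 h0(1)] h0(2) by simp
  have src: "src B \<cdot> h1 = h0 \<cdot> src S"
  proof (rule epi1[OF Comp_in_hom[OF h1(1) HB(1)] Comp_in_hom[OF HS(1) h0(1)]])
    fix i k :: bool assume "i \<le> k"
    note j = j1[OF this]
    show "(src B \<cdot> h1) \<cdot> j1 i k = (h0 \<cdot> src S) \<cdot> j1 i k"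
      using Comp_assoc[OF j h1(1) HB(1)] Comp_assoc[OF j HS(1) h0(1)] h1(2)[OF \<open>i \<le> k\<close>] src_j1[OF \<open>i \<le> k\<close>]
        h0e[OF HA(1)] G(2) by simp
  qed
  have tgt: "tgt B \<cdot> h1 = h0 \<cdot> tgt S"
  proof (rule epi1[OF Comp_in_hom[OF h1(1) HB(2)] Comp_in_hom[OF HS(2) h0(1)]])
    fix i k :: bool assume "i \<le> k"
    note j = j1[OF this]
    show "(tgt B \<cdot> h1) \<cdot> j1 i k = (h0 \<cdot> tgt S) \<cdot> j1 i k"
      using Comp_assoc[OF j h1(1) HB(2)] Comp_assoc[OF j HS(2) h0(1)] h1(2)[OF \<open>i \<le> k\<close>] tgt_j1[OF \<open>i \<le> k\<close>]
        h0e[OF HA(2)] G(3)[OF \<open>i \<le> k\<close>] by simp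
  qed
  have unit: "unit_arr B \<cdot> h0 = h1 \<cdot> unit_arr S"
  proof (rule epi0[OF Comp_in_hom[OF h0(1) HB(3)] Comp_in_hom[OF HS(3) h1(1)]])
    fix i show "(unit_arr B \<cdot> h0) \<cdot> j0 i = (h1 \<cdot> unit_arr S) \<cdot> j0 i"
      using Comp_assoc[OF j0 h0(1) HB(3)] Comp_assoc[OF j0 HS(3) h1(1)] h0(2) unit_j0
        h1e[OF order_refl HA(3)] f(7) g(7) by (cases i) (simp_all add: m_def G_def)
  qed
  have pe: "tgt S \<cdot> pr1 S = src S \<cdot> pr2 S" and pa: "tgt A \<cdot> pr1 A = src A \<cdot> pr2 A"
    using pullback_homs(5)[OF HS(7)] pullback_homs(5)[OF HA(7)] by auto
  note h1p = Comp_in_hom[OF HS(5) h1(1)] Comp_in_hom[OF HS(6) h1(1)]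
  have hp: "tgt B \<cdot> h1 \<cdot> pr1 S = src B \<cdot> h1 \<cdot> pr2 S"
    using src tgt pe Comp_assoc[OF HS(5) h1(1) HB(2)] Comp_assoc[OF HS(6) h1(1) HB(1)]
      Comp_assoc[OF HS(5) HS(2) h0(1)] Comp_assoc[OF HS(6) HS(1) h0(1)] by simp
  note ih = icomp[OF B h1p hp]
  \<comment> \<open>On the two constant chains this is functoriality of \<open>?f\<close> and of
    \<open>?g\<close>. The mixed chains use one form of the diagonal each: \<open>\<tau>\<close>
    last when the first arrow lies over False, \<open>\<tau>\<close> first when the second lies over
    True, so that the other two arrows become adjacent.\<close>
  have GG: "icomp C B (G k l \<cdot> pr2 A) (G i k \<cdot> pr1 A) = G i l \<cdot> cmp A" if "i \<le> k" "k \<le> l" for i k l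
  proof -
    have ff: "icomp C B (map1 ?f \<cdot> pr2 A) (map1 ?f \<cdot> pr1 A) = map1 ?f \<cdot> cmp A"
      and gg: "icomp C B (map1 ?g \<cdot> pr2 A) (map1 ?g \<cdot> pr1 A) = map1 ?g \<cdot> cmp A"
      using I(1,2) d I(3,4) by (simp_all add: is_ifun_def)
    note fe = ifun_elt[OF I(1), unfolded d] and ge = ifun_elt[OF I(2), unfolded I(3,4)]
    note n = nt[OF icat_elt(2)[OF A HA(6)]] and n' = nt[OF icat_elt(1)[OF A HA(5)]]
    have as: "(ncomp \<tau> \<cdot> tgt A) \<cdot> x = ncomp \<tau> \<cdot> tgt A \<cdot> x" "(ncomp \<tau> \<cdot> src A) \<cdot> x = ncomp \<tau> \<cdot> src A \<cdot> x"
      if "x \<in> hom C X (Ob1 A)" for x X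
      using Comp_assoc[OF that HA(2) I(5)] Comp_assoc[OF that HA(1) I(5)] by auto
    have ca: "tgt A \<cdot> cmp A = tgt A \<cdot> pr2 A" "src A \<cdot> cmp A = src A \<cdot> pr1 A" using A by (auto simp: is_icat_def)
    have "icomp C B (D \<cdot> pr2 A) (map1 ?f \<cdot> pr1 A) =
        icomp C B (icomp C B (ncomp \<tau> \<cdot> tgt A \<cdot> pr2 A) (map1 ?f \<cdot> pr2 A)) (map1 ?f \<cdot> pr1 A)"
      using D(4)[OF HA(6)] as[OF HA(6)] by simp
    also have "\<dots> = icomp C B (ncomp \<tau> \<cdot> tgt A \<cdot> pr2 A) (icomp C B (map1 ?f \<cdot> pr2 A) (map1 ?f \<cdot> pr1 A))"
      by (rule icomp_assoc[OF pbs B fe(1)[OF HA(5)] fe(1)[OF HA(6)] n(1)])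
        (use fe[OF HA(5)] fe[OF HA(6)] n pa in simp_all)
    also have "\<dots> = D \<cdot> cmp A"
      using D(4)[OF HA(4)] as[OF HA(4)] ca ff by simp
    finally have D1: "icomp C B (D \<cdot> pr2 A) (map1 ?f \<cdot> pr1 A) = D \<cdot> cmp A" .
    have "icomp C B (map1 ?g \<cdot> pr2 A) (D \<cdot> pr1 A) =
        icomp C B (map1 ?g \<cdot> pr2 A) (icomp C B (map1 ?g \<cdot> pr1 A) (ncomp \<tau> \<cdot> src A \<cdot> pr1 A))"
      using Dg[OF HA(5)] as[OF HA(5)] by simp
    also have "\<dots> = icomp C B (icomp C B (map1 ?g \<cdot> pr2 A) (map1 ?g \<cdot> pr1 A)) (ncomp \<tau> \<cdot> src A \<cdot> pr1 A)"
      by (rule icomp_assoc[OF pbs B n'(1) ge(1)[OF HA(5)] ge(1)[OF HA(6)], symmetric])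
        (use ge[OF HA(5)] ge[OF HA(6)] n' pa in simp_all)
    also have "\<dots> = D \<cdot> cmp A"
      using Dg[OF HA(4)] as[OF HA(4)] ca gg by simp
    finally have D2: "icomp C B (map1 ?g \<cdot> pr2 A) (D \<cdot> pr1 A) = D \<cdot> cmp A" .
    show ?thesis using that ff gg D1 D2 by (auto simp: G_def)
  qed
  have comp: "icomp C B (h1 \<cdot> pr2 S) (h1 \<cdot> pr1 S) = h1 \<cdot> cmp S"
  proof (rule epi2[OF ih(1) Comp_in_hom[OF HS(4) h1(1)]])
    fix i k l :: bool assume ik: "i \<le> k" "k \<le> l"
    then have il: "i \<le> l" by simp
    note j = j2[OF ik]
    show "icomp C B (h1 \<cdot> pr2 S) (h1 \<cdot> pr1 S) \<cdot> j2 i k l = (h1 \<cdot> cmp S) \<cdot> j2 i k l"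
      using ih(4)[OF j] Comp_assoc[OF j HS(5) h1(1)] Comp_assoc[OF j HS(6) h1(1)] Comp_assoc[OF j HS(4) h1(1)]
        pr1_j2[OF ik] pr2_j2[OF ik] cmp_j2[OF ik] h1e[OF ik(1) HA(5)] h1e[OF ik(2) HA(6)] h1e[OF il HA(4)]
        GG[OF ik] by simp
  qed
  define h where "h = \<lparr>fdom = S, fcod = B, map0 = h0, map1 = h1\<rparr>"
  have h: "is_ifun C h" "fdom h = S" "fcod h = B"
    unfolding is_ifun_def h_def using S B h0 h1 src tgt unit comp by simp_all
  have hf: "comp_ifun C h (inc i) = (if i then ?g else ?f)" for i
    using h0(2)[of i] h1(2)[OF order_refl, of i] d I(3,4) by (simp add: comp_ifun_def h_def m_def G_def)
  \<comment> \<open>At an identity the naturality square degenerates, and its diagonal is the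
    component of \<open>\<tau>\<close>.\<close>
  have "h1 \<cdot> j1 False True \<cdot> unit_arr A = ncomp \<tau>"
  proof -
    have "h1 \<cdot> j1 False True \<cdot> unit_arr A = icomp C B ((ncomp \<tau> \<cdot> tgt A) \<cdot> unit_arr A) (map1 ?f \<cdot> unit_arr A)"
      using h1e[OF le_FT HA(3)] D(4)[OF HA(3)] by (simp add: G_def)
    also have "\<dots> = icomp C B (ncomp \<tau>) (unit_arr B \<cdot> src B \<cdot> ncomp \<tau>)"
      using f(7) I(6) Comp_assoc[OF HA(3) HA(2) I(5)] HA(11) Comp_Ident[OF I(5)] by simp
    finally show ?thesis using icomp_unit(1)[OF B I(5)] by simp
  qed
  then have "HComp (ICat C) (id_cell (ICat C) h) gen = \<tau>"
    using ICat_whisker(1)[OF pbs h(1) gen_inat] h(2) hf by (simp add: h_def)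
  then show ?thesis using h by blast
qed

text \<open>The boundary of the whiskered 2-cell fixes the functor over both ends, and its component
  fixes it over the middle by \<open>map1_j1_decomp\<close>.\<close>

lemma arrow_unique:
  assumes h: "is_ifun C h" "fdom h = S" "fcod h = B" and k: "is_ifun C k" "fdom k = S" "fcod k = B"
    and e: "HComp (ICat C) (id_cell (ICat C) h) gen = HComp (ICat C) (id_cell (ICat C) k) gen"
  shows "h = k"
proof -
  note H = ifun[OF h(1), unfolded h(2,3)] and K = ifun[OF k(1), unfolded k(2,3)]
  have e': "comp_ifun C h (inc False) = comp_ifun C k (inc False)" "comp_ifun C h (inc True) = comp_ifun C k (inc True)"
     "map1 h \<cdot> j1 False True \<cdot> unit_arr A = map1 k \<cdot> j1 False True \<cdot> unit_arr A"
    using e ICat_whisker(1)[OF pbs h(1) gen_inat] ICat_whisker(1)[OF pbs k(1) gen_inat] h(2) k(2) by auto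
  have "map0 h \<cdot> j0 i = map0 k \<cdot> j0 i" "map1 h \<cdot> j1 i i = map1 k \<cdot> j1 i i" for i
    using e'(1,2) by (cases i; simp add: comp_ifun_def)+
  note ee = this
  note ju = j1_elt(1)[OF le_FT HA(3)]
  have as: "map1 l \<cdot> j1 False True \<cdot> unit_arr A \<cdot> tgt A = (map1 l \<cdot> j1 False True \<cdot> unit_arr A) \<cdot> tgt A"
    if "is_ifun C l" "fdom l = S" for l
    using Comp_assoc[OF HA(2) ju ifun(4)[OF that(1), unfolded that(2)]] Comp_assoc[OF HA(2) HA(3) j1[OF le_FT]] by simp
  have FT: "map1 h \<cdot> j1 False True = map1 k \<cdot> j1 False True"
    using map1_j1_decomp[OF h(1,2)] map1_j1_decomp[OF k(1,2)] as[OF h(1,2)] as[OF k(1,2)] e'(3) ee(2) h(3) k(3)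
    by simp
  have "map1 h = map1 k"
    by (rule epi1[OF H(4) K(4)]) (metis (full_types) ee(2) FT le_boolD)
  moreover have "map0 h = map0 k" using epi0[OF H(3) K(3) ee(1)] .
  ultimately show ?thesis using h k by simp
qed

text \<open>The component on \<open>S\<close> is assembled from those of \<open>a\<close> and
  \<open>b\<close> on the two copies of the objects. Its naturality is tested on the three copies of
  the arrows; over the ends it is that of \<open>a\<close> and of \<open>b\<close>.\<close>

lemma cell_exists:
  assumes h: "is_ifun C h" "fdom h = S" "fcod h = B" and k: "is_ifun C k" "fdom k = S" "fcod k = B"
    and a: "is_inat C a" "ndom a = comp_ifun C h (inc False)" "ncod a = comp_ifun C k (inc False)"
    and b: "is_inat C b" "ndom b = comp_ifun C h (inc True)" "ncod b = comp_ifun C k (inc True)"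
    and e: "icomp C B (map1 k \<cdot> j1 False True \<cdot> unit_arr A) (ncomp a) =
      icomp C B (ncomp b) (map1 h \<cdot> j1 False True \<cdot> unit_arr A)"
  shows "\<exists>\<theta>. is_inat C \<theta> \<and> ndom \<theta> = h \<and> ncod \<theta> = k \<and> ncomp \<theta> \<cdot> j0 False = ncomp a \<and> ncomp \<theta> \<cdot> j0 True = ncomp b"
proof -
  note H = ifun[OF h(1), unfolded h(2,3)] and K = ifun[OF k(1), unfolded k(2,3)]
  note B = H(2)
  note HB = icat_homs[OF B]
  have c: "fdom (comp_ifun C l (inc i)) = A" "fcod (comp_ifun C l (inc i)) = fcod l"
    "map0 (comp_ifun C l (inc i)) = map0 l \<cdot> j0 i" "map1 (comp_ifun C l (inc i)) = map1 l \<cdot> j1 i i" for l i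
    by (simp_all add: comp_ifun_def)
  note Ia = inat[OF a(1), unfolded a(2,3) c h(3)] and Ib = inat[OF b(1), unfolded b(2,3) c h(3)]
  note na = inat_nat[OF a(1), unfolded a(2,3) c h(3)] and nb = inat_nat[OF b(1), unfolded b(2,3) c h(3)]
  note ea = inat_elt[OF a(1), unfolded a(2,3) c h(3)] and eb = inat_elt[OF b(1), unfolded b(2,3) c h(3)]
  obtain t where t: "t \<in> hom C (Ob0 S) (Ob1 B)" "\<And>i. t \<cdot> j0 i = (if i then ncomp b else ncomp a)"
    using ex0[of "\<lambda>i. if i then ncomp b else ncomp a" "Ob1 B"] Ia(5) Ib(5)
    by (metis (mono_tags, lifting))
  have st: "src B \<cdot> t = map0 h"
  proof (rule epi0[OF Comp_in_hom[OF t(1) HB(1)] H(3)])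
    show "(src B \<cdot> t) \<cdot> j0 i = map0 h \<cdot> j0 i" for i
      using Comp_assoc[OF j0 t(1) HB(1)] t(2) Ia(6) Ib(6) by (cases i) simp_all
  qed
  have tt: "tgt B \<cdot> t = map0 k"
  proof (rule epi0[OF Comp_in_hom[OF t(1) HB(2)] K(3)])
    show "(tgt B \<cdot> t) \<cdot> j0 i = map0 k \<cdot> j0 i" for i
      using Comp_assoc[OF j0 t(1) HB(2)] t(2) Ia(7) Ib(7) by (cases i) simp_all
  qed
  note ts = Comp_in_hom[OF HS(1) t(1)] and tg = Comp_in_hom[OF HS(2) t(1)]
  have m1: "tgt B \<cdot> map1 h = src B \<cdot> t \<cdot> tgt S" and m2: "tgt B \<cdot> t \<cdot> src S = src B \<cdot> map1 k"
    using Comp_assoc[OF HS(2) t(1) HB(1)] Comp_assoc[OF HS(1) t(1) HB(2)] st tt H(6) K(5) by simp_all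
  note i1 = icomp[OF B H(4) tg m1] and i2 = icomp[OF B ts K(4) m2]
  note ju = j1_elt(1)[OF le_FT HA(3)] and FF = j1[OF order_refl, of False]
  \<comment> \<open>\<open>hs\<close> and \<open>ks\<close> are the components of \<open>gen\<close>
    whiskered with \<open>h\<close> and \<open>k\<close>, which form two sides of the square
    \<open>e\<close>.\<close>
  define hs where "hs = map1 h \<cdot> j1 False True \<cdot> unit_arr A"
  define ks where "ks = map1 k \<cdot> j1 False True \<cdot> unit_arr A"
  have hs: "hs \<in> hom C (Ob0 A) (Ob1 B)" "src B \<cdot> hs = map0 h \<cdot> j0 False" "tgt B \<cdot> hs = map0 h \<cdot> j0 True"
    using ifun_elt[OF h(1), unfolded h(2,3), OF ju] j1_elt(2,3)[OF le_FT HA(3)] HA(10,11) Comp_Ident[OF j0]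
    by (simp_all add: hs_def)
  have ks: "ks \<in> hom C (Ob0 A) (Ob1 B)" "src B \<cdot> ks = map0 k \<cdot> j0 False" "tgt B \<cdot> ks = map0 k \<cdot> j0 True"
    using ifun_elt[OF k(1), unfolded k(2,3), OF ju] j1_elt(2,3)[OF le_FT HA(3)] HA(10,11) Comp_Ident[OF j0]
    by (simp_all add: ks_def)
  have e': "icomp C B ks (ncomp a) = icomp C B (ncomp b) hs" using e by (simp add: hs_def ks_def)
  have dec: "map1 h \<cdot> j1 False True = icomp C B (hs \<cdot> tgt A) (map1 h \<cdot> j1 False False)"
    "map1 k \<cdot> j1 False True = icomp C B (ks \<cdot> tgt A) (map1 k \<cdot> j1 False False)"
    using map1_j1_decomp[OF h(1,2)] map1_j1_decomp[OF k(1,2)] h(3) k(3) Comp_assoc[OF HA(2) ju H(4)]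
      Comp_assoc[OF HA(2) ju K(4)] Comp_assoc[OF HA(2) HA(3) j1[OF le_FT]] by (simp_all add: hs_def ks_def)
  have hst: "hs \<cdot> tgt A \<in> hom C (Ob1 A) (Ob1 B)" "src B \<cdot> hs \<cdot> tgt A = (map0 h \<cdot> j0 False) \<cdot> tgt A"
    "tgt B \<cdot> hs \<cdot> tgt A = (map0 h \<cdot> j0 True) \<cdot> tgt A"
    using Comp_in_hom[OF HA(2) hs(1)] Comp_assoc[OF HA(2) hs(1) HB(1)] Comp_assoc[OF HA(2) hs(1) HB(2)] hs by simp_all
  have kst: "ks \<cdot> tgt A \<in> hom C (Ob1 A) (Ob1 B)" "src B \<cdot> ks \<cdot> tgt A = (map0 k \<cdot> j0 False) \<cdot> tgt A"
    "tgt B \<cdot> ks \<cdot> tgt A = (map0 k \<cdot> j0 True) \<cdot> tgt A"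
    using Comp_in_hom[OF HA(2) ks(1)] Comp_assoc[OF HA(2) ks(1) HB(1)] Comp_assoc[OF HA(2) ks(1) HB(2)] ks by simp_all
  have hF: "map1 h \<cdot> j1 False False \<in> hom C (Ob1 A) (Ob1 B)" "tgt B \<cdot> map1 h \<cdot> j1 False False = (map0 h \<cdot> j0 False) \<cdot> tgt A"
    using ifun_elt[OF h(1), unfolded h(2,3), OF FF] tgt_j1[of False False] Comp_assoc[OF HA(2) j0 H(3)] by simp_all
  have kF: "map1 k \<cdot> j1 False False \<in> hom C (Ob1 A) (Ob1 B)" "tgt B \<cdot> map1 k \<cdot> j1 False False = (map0 k \<cdot> j0 False) \<cdot> tgt A"
    "src B \<cdot> map1 k \<cdot> j1 False False = (map0 k \<cdot> j0 False) \<cdot> src A"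
    using ifun_elt[OF k(1), unfolded k(2,3), OF FF] tgt_j1[of False False] src_j1[of False False]
      Comp_assoc[OF HA(2) j0 K(3)] Comp_assoc[OF HA(1) j0 K(3)] by simp_all
  note at = ea[OF HA(2)] and as = ea[OF HA(1)] and bt = eb[OF HA(2)]
  \<comment> \<open>Naturality over the middle copy: the arrow is factored through
    \<open>gen\<close> at its target, and the naturality square of \<open>a\<close> over False is
    pasted to the square \<open>e\<close> at that target.\<close>
  have "icomp C B (ncomp b \<cdot> tgt A) (map1 h \<cdot> j1 False True) =
      icomp C B (icomp C B (ncomp b \<cdot> tgt A) (hs \<cdot> tgt A)) (map1 h \<cdot> j1 False False)"
    unfolding dec
    by (rule icomp_assoc[OF pbs B hF(1) hst(1) bt(1), symmetric]) (use hF hst bt in simp_all)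
  also have "icomp C B (ncomp b \<cdot> tgt A) (hs \<cdot> tgt A) = icomp C B (ks \<cdot> tgt A) (ncomp a \<cdot> tgt A)"
    using icomp(4)[OF B hs(1) Ib(5) _ HA(2)] icomp(4)[OF B Ia(5) ks(1) _ HA(2)] hs ks Ia(7) Ib(6) e' by simp
  also have "icomp C B (icomp C B (ks \<cdot> tgt A) (ncomp a \<cdot> tgt A)) (map1 h \<cdot> j1 False False) =
      icomp C B (ks \<cdot> tgt A) (icomp C B (ncomp a \<cdot> tgt A) (map1 h \<cdot> j1 False False))"
    by (rule icomp_assoc[OF pbs B hF(1) at(1) kst(1)]) (use hF kst at in simp_all)
  also have "\<dots> = icomp C B (ks \<cdot> tgt A) (icomp C B (map1 k \<cdot> j1 False False) (ncomp a \<cdot> src A))"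
    using na by simp
  also have "\<dots> = icomp C B (map1 k \<cdot> j1 False True) (ncomp a \<cdot> src A)"
    unfolding dec
    by (rule icomp_assoc[OF pbs B as(1) kF(1) kst(1), symmetric]) (use kF kst as in simp_all)
  finally have FT: "icomp C B (ncomp b \<cdot> tgt A) (map1 h \<cdot> j1 False True) =
      icomp C B (map1 k \<cdot> j1 False True) (ncomp a \<cdot> src A)" .
  have "icomp C B (t \<cdot> tgt S) (map1 h) = icomp C B (map1 k) (t \<cdot> src S)"
  proof (rule epi1[OF i1(1) i2(1)])
    fix i l :: bool assume il: "i \<le> l"
    note j = j1[OF il]
    have "(t \<cdot> tgt S) \<cdot> j1 i l = (if l then ncomp b else ncomp a) \<cdot> tgt A"
      "(t \<cdot> src S) \<cdot> j1 i l = (if i then ncomp b else ncomp a) \<cdot> src A"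
      using Comp_assoc[OF j HS(2) t(1)] Comp_assoc[OF j HS(1) t(1)] src_j1[OF il] tgt_j1[OF il]
        Comp_assoc[OF HA(1) j0 t(1)] Comp_assoc[OF HA(2) j0 t(1)] t(2) by simp_all
    then show "icomp C B (t \<cdot> tgt S) (map1 h) \<cdot> j1 i l = icomp C B (map1 k) (t \<cdot> src S) \<cdot> j1 i l"
      using i1(4)[OF j] i2(4)[OF j] il na nb FT by (cases i; cases l) simp_all
  qed
  then have "is_inat C \<lparr>ndom = h, ncod = k, ncomp = t\<rparr>"
    using h k t(1) st tt by (intro inatI) simp_all
  then show ?thesis using t(2) by (intro exI[of _ "\<lparr>ndom = h, ncod = k, ncomp = t\<rparr>"]) simp
qed

lemma copower_cell_gen: "two_category.copower_cell (ICat C) A S inc gen"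
proof -
  interpret I: two_category "ICat C" by (rule two_category_ICat[OF pbs])
  have cell: "\<alpha> \<in> hom (HomCat (ICat C) X Y) f g \<longleftrightarrow> is_inat C \<alpha> \<and> ndom \<alpha> = f \<and> ncod \<alpha> = g \<and> fdom f = X \<and> fcod f = Y"
    for \<alpha> X Y f g by (auto simp: hom_def ICat_simps[OF pbs])
  have arr: "\<alpha> \<in> Arr (HomCat (ICat C) X Y) \<longleftrightarrow> is_inat C \<alpha> \<and> fdom (ndom \<alpha>) = X \<and> fcod (ndom \<alpha>) = Y"
    for \<alpha> X Y by (simp add: ICat_simps[OF pbs])
  show ?thesis
    unfolding I.copower_cell_def
  proof (intro conjI ballI allI impI)
    show "A \<in> Obj (ICat C)" "S \<in> Obj (ICat C)" using A S by (simp_all add: ICat_simps[OF pbs])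
    show "gen \<in> hom (HomCat (ICat C) A S) (inc False) (inc True)" using gen_inat by (simp add: cell)
  next
    fix B \<tau> assume "\<tau> \<in> Arr (HomCat (ICat C) A B)"
    then show "\<exists>h \<in> hom (ICat C) S B. HComp (ICat C) (id_cell (ICat C) h) gen = \<tau>"
      using arrow_exists[of \<tau> B] by (auto simp: arr ICat_hom)
  next
    fix B h k assume "h \<in> hom (ICat C) S B" "k \<in> hom (ICat C) S B"
      "HComp (ICat C) (id_cell (ICat C) h) gen = HComp (ICat C) (id_cell (ICat C) k) gen"
    then show "h = k" using arrow_unique[of h B k] by (simp add: ICat_hom)
  next
    fix B h k a b
    assume hk: "h \<in> hom (ICat C) S B" "k \<in> hom (ICat C) S B"
      and ab: "a \<in> hom (HomCat (ICat C) A B) (h \<cdot>\<^bsub>ICat C\<^esub> inc False) (k \<cdot>\<^bsub>ICat C\<^esub> inc False)"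
        "b \<in> hom (HomCat (ICat C) A B) (h \<cdot>\<^bsub>ICat C\<^esub> inc True) (k \<cdot>\<^bsub>ICat C\<^esub> inc True)"
      and e: "HComp (ICat C) (id_cell (ICat C) k) gen \<cdot>\<^bsub>HomCat (ICat C) A B\<^esub> a =
         b \<cdot>\<^bsub>HomCat (ICat C) A B\<^esub> HComp (ICat C) (id_cell (ICat C) h) gen"
    have h: "is_ifun C h" "fdom h = S" "fcod h = B" and k: "is_ifun C k" "fdom k = S" "fcod k = B"
      using hk by (simp_all add: ICat_hom)
    have ab': "is_inat C a" "ndom a = comp_ifun C h (inc False)" "ncod a = comp_ifun C k (inc False)"
      "is_inat C b" "ndom b = comp_ifun C h (inc True)" "ncod b = comp_ifun C k (inc True)"
      using ab[unfolded cell] by (simp_all add: ICat_simps[OF pbs])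
    have "icomp C B (map1 k \<cdot> j1 False True \<cdot> unit_arr A) (ncomp a) =
      icomp C B (ncomp b) (map1 h \<cdot> j1 False True \<cdot> unit_arr A)"
      using e ICat_whisker(1)[OF pbs h(1) gen_inat] ICat_whisker(1)[OF pbs k(1) gen_inat] h(2) k(2)
      by (simp add: ICat_simps[OF pbs])
    then obtain \<theta> where t: "is_inat C \<theta>" "ndom \<theta> = h" "ncod \<theta> = k" "ncomp \<theta> \<cdot> j0 False = ncomp a"
      "ncomp \<theta> \<cdot> j0 True = ncomp b"
      using cell_exists[OF h k ab'] by blast
    have "HComp (ICat C) \<theta> (id_cell (ICat C) (inc False)) = a" "HComp (ICat C) \<theta> (id_cell (ICat C) (inc True)) = b"
      using ICat_whisker(2)[OF pbs inc_ifun t(1)] t h k ab' by simp_all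
    then show "\<exists>\<theta> \<in> hom (HomCat (ICat C) S B) h k. HComp (ICat C) \<theta> (id_cell (ICat C) (inc False)) = a \<and>
       HComp (ICat C) \<theta> (id_cell (ICat C) (inc True)) = b"
      using t h by (intro bexI[of _ \<theta>]) (simp_all add: cell)
  next
    fix B h k \<theta> \<theta>'
    assume t: "\<theta> \<in> hom (HomCat (ICat C) S B) h k" and t': "\<theta>' \<in> hom (HomCat (ICat C) S B) h k"
      and e: "HComp (ICat C) \<theta> (id_cell (ICat C) (inc False)) = HComp (ICat C) \<theta>' (id_cell (ICat C) (inc False)) \<and>
        HComp (ICat C) \<theta> (id_cell (ICat C) (inc True)) = HComp (ICat C) \<theta>' (id_cell (ICat C) (inc True))"
    have T: "is_inat C \<theta>" "ndom \<theta> = h" "ncod \<theta> = k" "fdom h = S" "fcod h = B" "is_inat C \<theta>'"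
      "ndom \<theta>' = h" "ncod \<theta>' = k" using t t' by (auto simp: cell)
    have "ncomp \<theta> \<cdot> j0 i = ncomp \<theta>' \<cdot> j0 i" for i
      using e ICat_whisker(2)[OF pbs inc_ifun T(1)] ICat_whisker(2)[OF pbs inc_ifun T(6)] T by (cases i) auto
    then have "ncomp \<theta> = ncomp \<theta>'"
      using epi0[OF inat(5)[OF T(1), unfolded T(2,4,5)] inat(5)[OF T(6), unfolded T(4,5,7)]] by blast
    then show "\<theta> = \<theta>'" using T by simp
  qed
qed

end

section \<open>Coproducts of points\<close>

text \<open>The singleton \<open>{z}\<close> plays the role of a one-point set, so that its image
  under \<open>F\<close> will be the terminal object.\<close>

definition point :: "('u set, 'u set \<times> 'u set \<times> ('u \<Rightarrow> 'u), 'o, 'm) funct \<Rightarrow> 'u \<Rightarrow> 'u set \<Rightarrow> 'u \<Rightarrow> 'm" where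
  "point F z X x = farr F ({z}, X, \<lambda>_ \<in> {z}. x)"

lemma FinSet_simps:
  "Obj FinSet = {X. finite X}"
  "(X, Y, f) \<in> Arr FinSet \<longleftrightarrow> finite X \<and> finite Y \<and> f \<in> X \<rightarrow>\<^sub>E Y"
  "Dom FinSet (X, Y, f) = X" "Cod FinSet (X, Y, f) = Y"
  "(Y', Z, g) \<cdot>\<^bsub>FinSet\<^esub> (X, Y, f) = (X, Z, compose X g f)"
  by (simp_all add: FinSet_def)

lemma FinSet_hom: "h \<in> hom FinSet X Y \<longleftrightarrow> (\<exists>f. h = (X, Y, f) \<and> finite X \<and> finite Y \<and> f \<in> X \<rightarrow>\<^sub>E Y)"
  by (cases h) (auto simp: hom_def FinSet_simps)

lemma FinSet_initial: "is_initial FinSet {}"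
  by (auto simp: is_initial_def FinSet_simps(1) FinSet_hom)

lemma FinSet_terminal: "is_terminal FinSet {z}"
proof -
  have "\<exists>!f. f \<in> hom FinSet X {z}" if "finite X" for X
  proof (rule ex1I[of _ "(X, {z}, \<lambda>_ \<in> X. z)"])
    show "(X, {z}, \<lambda>_ \<in> X. z) \<in> hom FinSet X {z}" using that by (auto simp: FinSet_hom)
    fix v assume "v \<in> hom FinSet X {z}"
    then obtain f where "v = (X, {z}, f)" "f \<in> X \<rightarrow>\<^sub>E {z}" by (auto simp: FinSet_hom)
    then show "v = (X, {z}, \<lambda>_ \<in> X. z)" by (auto simp: fun_eq_iff PiE_iff extensional_def)
  qed
  then show ?thesis by (simp add: is_terminal_def FinSet_simps(1))
qed

text \<open>The induction step for \<open>pt_coproduct\<close>. The second summand is the fixed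
  singleton \<open>{z}\<close> rather than \<open>{x}\<close>, so that \<open>F\<close> sends the
  second injection to the point \<open>x\<close>.\<close>

lemma FinSet_coproduct_insert:
  assumes X: "finite X" and x: "x \<notin> X"
  shows "is_coproduct FinSet X {z} (insert x X) (X, insert x X, \<lambda>y \<in> X. y) ({z}, insert x X, \<lambda>_ \<in> {z}. x)"
  unfolding is_coproduct_def
proof (intro conjI ballI)
  fix Y h k assume "h \<in> hom FinSet X Y" "k \<in> hom FinSet {z} Y"
  then obtain f g where h: "h = (X, Y, f)" "finite Y" "f \<in> X \<rightarrow>\<^sub>E Y" and k: "k = ({z}, Y, g)" "g \<in> {z} \<rightarrow>\<^sub>E Y"
    by (auto simp: FinSet_hom)
  let ?u = "(insert x X, Y, \<lambda>y \<in> insert x X. if y = x then g z else f y)"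
  show "\<exists>!u. u \<in> hom FinSet (insert x X) Y \<and> u \<cdot>\<^bsub>FinSet\<^esub> (X, insert x X, \<lambda>y \<in> X. y) = h \<and>
     u \<cdot>\<^bsub>FinSet\<^esub> ({z}, insert x X, \<lambda>_ \<in> {z}. x) = k"
  proof (intro ex1I[of _ ?u] conjI)
    show "?u \<in> hom FinSet (insert x X) Y" using X h k by (auto simp: FinSet_hom)
    have "compose X (\<lambda>y \<in> insert x X. if y = x then g z else f y) (\<lambda>y \<in> X. y) = f"
      using x h(3) by (auto simp: compose_def fun_eq_iff PiE_def extensional_def)
    then show "?u \<cdot>\<^bsub>FinSet\<^esub> (X, insert x X, \<lambda>y \<in> X. y) = h" by (simp add: FinSet_simps h)
    have "compose {z} (\<lambda>y \<in> insert x X. if y = x then g z else f y) (\<lambda>_ \<in> {z}. x) = g"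
      using k(2) by (auto simp: compose_def fun_eq_iff PiE_def extensional_def)
    then show "?u \<cdot>\<^bsub>FinSet\<^esub> ({z}, insert x X, \<lambda>_ \<in> {z}. x) = k" by (simp add: FinSet_simps k)
    fix v assume v: "v \<in> hom FinSet (insert x X) Y \<and> v \<cdot>\<^bsub>FinSet\<^esub> (X, insert x X, \<lambda>y \<in> X. y) = h \<and>
      v \<cdot>\<^bsub>FinSet\<^esub> ({z}, insert x X, \<lambda>_ \<in> {z}. x) = k"
    then obtain w where w: "v = (insert x X, Y, w)" "w \<in> insert x X \<rightarrow>\<^sub>E Y" by (auto simp: FinSet_hom)
    then have "compose X w (\<lambda>y \<in> X. y) = f" "compose {z} w (\<lambda>_ \<in> {z}. x) = g"
      using v by (simp_all add: FinSet_simps h k)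
    then have wg: "w x = g z" and wf: "\<And>y. y \<in> X \<Longrightarrow> w y = f y"
      by (auto simp: compose_def fun_eq_iff split: if_splits)
    have "w = (\<lambda>y \<in> insert x X. if y = x then g z else f y)"
      using wf wg w(2) by (auto simp: fun_eq_iff PiE_def extensional_def)
    then show "v = ?u" using w by simp
  qed
qed (use X in \<open>auto simp: FinSet_simps FinSet_hom\<close>)

definition bang :: "('o, 'm, 'z) cat_scheme \<Rightarrow> 'o \<Rightarrow> 'o \<Rightarrow> 'm" where
  "bang C T X = (THE f. f \<in> hom C X T)"

context category begin

lemma bang:
  assumes "is_terminal C T" "X \<in> Obj C"
  shows "bang C T X \<in> hom C X T" "f \<in> hom C X T \<Longrightarrow> f = bang C T X"
proof -
  have e: "\<exists>!f. f \<in> hom C X T" using assms by (simp add: is_terminal_def)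
  show "bang C T X \<in> hom C X T" unfolding bang_def by (rule theI'[OF e])
  then show "f \<in> hom C X T \<Longrightarrow> f = bang C T X" using e by blast
qed

lemma bang_comp:
  assumes T: "is_terminal C T" and f: "f \<in> hom C X Y"
  shows "bang C T Y \<cdot> f = bang C T X"
  using bang(2)[OF T hom_Obj(1)[OF f] Comp_in_hom[OF f bang(1)[OF T hom_Obj(2)[OF f]]]] .

end

text \<open>The copy of \<open>Y\<close> in the product with projections \<open>p\<close> and \<open>q\<close> that lies over the point \<open>c\<close>.\<close>

definition copy_at :: "('o, 'm, 'z) cat_scheme \<Rightarrow> 'o \<Rightarrow> 'm \<Rightarrow> 'm \<Rightarrow> 'o \<Rightarrow> 'm \<Rightarrow> 'm" where
  "copy_at C T p q Y c = pairing C p q (c \<cdot>\<^bsub>C\<^esub> bang C T Y) (Ident C Y)"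

locale finite_points = category C for C :: "('o, 'm, 'z) cat_scheme" (structure) +
  fixes F :: "('u set, 'u set \<times> 'u set \<times> ('u \<Rightarrow> 'u), 'o, 'm) funct" and z :: 'u
  assumes is_functor: "is_functor FinSet C F"
    and pres_coproducts: "preserves_finite_coproducts FinSet C F"
    and pres_terminal: "preserves_terminal FinSet C F"
begin

abbreviation T :: 'o where "T \<equiv> fobj F {z}"

abbreviation pt :: "'u set \<Rightarrow> 'u \<Rightarrow> 'm" where "pt \<equiv> point F z"

lemma T: "is_terminal C T"
  using pres_terminal[unfolded preserves_terminal_def, rule_format, OF FinSet_terminal] .

lemma F_arr: "\<lbrakk>finite X; finite Y; f \<in> X \<rightarrow>\<^sub>E Y\<rbrakk> \<Longrightarrow> farr F (X, Y, f) \<in> hom C (fobj F X) (fobj F Y)"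
  using is_functor FinSet_simps(2-4)[of X Y f] by (auto simp: is_functor_def)

lemma pt: "\<lbrakk>finite X; x \<in> X\<rbrakk> \<Longrightarrow> pt X x \<in> hom C T (fobj F X)"
  unfolding point_def by (rule F_arr) auto

lemma F_pt:
  assumes "finite X" "finite Y" "f \<in> X \<rightarrow>\<^sub>E Y" "x \<in> X"
  shows "farr F (X, Y, f) \<cdot> pt X x = pt Y (f x)"
proof -
  have "compose {z} f (\<lambda>_ \<in> {z}. x) = (\<lambda>_ \<in> {z}. f x)" by (auto simp: compose_def)
  moreover have "farr F ((X, Y, f) \<cdot>\<^bsub>FinSet\<^esub> ({z}, X, \<lambda>_ \<in> {z}. x)) = farr F (X, Y, f) \<cdot> farr F ({z}, X, \<lambda>_ \<in> {z}. x)"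
    using is_functor assms FinSet_simps(2)[of X Y f] FinSet_simps(2)[of "{z}" X "\<lambda>_ \<in> {z}. x"]
    unfolding is_functor_def by (auto simp: FinSet_simps(3,4))
  ultimately show ?thesis by (simp add: point_def FinSet_simps(5))
qed

text \<open>Thus \<open>F X\<close> is the coproduct of its points. By induction on
  \<open>X\<close>, starting from the initial object, each new element adds one copy of
  \<open>T\<close>.\<close>

lemma pt_coproduct:
  assumes "finite X" and Z: "Z \<in> Obj C" and f: "\<And>x. x \<in> X \<Longrightarrow> f x \<in> hom C T Z"
  shows "\<exists>!u. u \<in> hom C (fobj F X) Z \<and> (\<forall>x \<in> X. u \<cdot> pt X x = f x)"
  using assms(1) f
proof (induction X)
  case empty
  have "is_initial C (fobj F {})" using pres_coproducts FinSet_initial by (auto simp: preserves_finite_coproducts_def)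
  then show ?case using Z by (simp add: is_initial_def)
next
  case (insert x X)
  let ?i = "farr F (X, insert x X, \<lambda>y \<in> X. y)"
  have cop: "is_coproduct C (fobj F X) T (fobj F (insert x X)) ?i (pt (insert x X) x)"
    using pres_coproducts FinSet_coproduct_insert[OF insert.hyps] unfolding preserves_finite_coproducts_def point_def
    by blast
  have i: "?i \<in> hom C (fobj F X) (fobj F (insert x X))" using cop by (simp add: is_coproduct_def)
  have ipt: "?i \<cdot> pt X y = pt (insert x X) y" if "y \<in> X" for y
    using F_pt[of X "insert x X" "\<lambda>y \<in> X. y" y] insert.hyps(1) that by auto
  have upt: "u \<cdot> pt (insert x X) y = (u \<cdot> ?i) \<cdot> pt X y" if "u \<in> hom C (fobj F (insert x X)) Z" "y \<in> X" for u y
    using Comp_assoc[OF pt[OF insert.hyps(1) that(2)] i that(1)] ipt[OF that(2)] by simp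
  have un: "\<exists>!u. u \<in> hom C (fobj F X) Z \<and> (\<forall>y \<in> X. u \<cdot> pt X y = f y)"
    using insert.IH insert.prems by blast
  then obtain v where v: "v \<in> hom C (fobj F X) Z" "\<And>y. y \<in> X \<Longrightarrow> v \<cdot> pt X y = f y" by blast
  have "\<exists>!u. u \<in> hom C (fobj F (insert x X)) Z \<and> u \<cdot> ?i = v \<and> u \<cdot> pt (insert x X) x = f x"
    using cop Z v(1) insert.prems[of x] by (simp add: is_coproduct_def)
  \<comment> \<open>A family over \<open>insert x X\<close> is a family over \<open>X\<close>,
    represented by \<open>v\<close> through the induction hypothesis, together with a value at
    \<open>x\<close>.\<close>
  moreover have "u \<cdot> ?i = v \<and> u \<cdot> pt (insert x X) x = f x \<longleftrightarrow> (\<forall>y \<in> insert x X. u \<cdot> pt (insert x X) y = f y)"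
    if u: "u \<in> hom C (fobj F (insert x X)) Z" for u
  proof
    assume "u \<cdot> ?i = v \<and> u \<cdot> pt (insert x X) x = f x"
    then show "\<forall>y \<in> insert x X. u \<cdot> pt (insert x X) y = f y" using upt[OF u] v(2) by auto
  next
    assume a: "\<forall>y \<in> insert x X. u \<cdot> pt (insert x X) y = f y"
    then have "\<forall>y \<in> X. (u \<cdot> ?i) \<cdot> pt X y = f y" using upt[OF u] by auto
    then have "u \<cdot> ?i = v" using un v Comp_in_hom[OF i u] by blast
    then show "u \<cdot> ?i = v \<and> u \<cdot> pt (insert x X) x = f x" using a by simp
  qed
  ultimately show ?case by metis
qed

lemma copy_at:
  assumes P: "is_product C B Y P p q" and c: "c \<in> hom C T B"
  shows "copy_at C T p q Y c \<in> hom C Y P" "p \<cdot> copy_at C T p q Y c = c \<cdot> bang C T Y"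
    "q \<cdot> copy_at C T p q Y c = Ident C Y"
proof -
  note Y = product_homs(4)[OF P]
  show "copy_at C T p q Y c \<in> hom C Y P" "p \<cdot> copy_at C T p q Y c = c \<cdot> bang C T Y"
    "q \<cdot> copy_at C T p q Y c = Ident C Y"
    unfolding copy_at_def using product_pairing[OF P Comp_in_hom[OF bang(1)[OF T Y] c] Ident_in_hom[OF Y]] by auto
qed

text \<open>\<open>is_exponential\<close> quantifies over every product cone, so with this cone a
  map out of \<open>Y\<close> transposes directly to a point of the internal hom.\<close>

lemma terminal_product:
  assumes Y: "Y \<in> Obj C"
  shows "is_product C T Y Y (bang C T Y) (Ident C Y)"
  unfolding is_product_def
proof (intro conjI ballI)
  show "T \<in> Obj C" using T by (simp add: is_terminal_def)
  fix X f g assume X: "X \<in> Obj C" and f: "f \<in> hom C X T" and g: "g \<in> hom C X Y"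
  show "\<exists>!u. u \<in> hom C X Y \<and> bang C T Y \<cdot> u = f \<and> Ident C Y \<cdot> u = g"
    using g bang_comp[OF T g] bang(2)[OF T X f] Ident_Comp[OF g] Ident_Comp by (intro ex1I[of _ g]) auto
qed (use Y bang(1)[OF T Y] Ident_in_hom in auto)

text \<open>Since \<open>\<hyphen> \<times> Y\<close> has a right adjoint, it preserves the coproduct of the points of \<open>F X\<close>.\<close>

lemma copies_coproduct:
  assumes ccc: "cartesian_closed C" and X: "finite X" and P: "is_product C (fobj F X) Y P p q"
  shows "\<lbrakk>Z \<in> Obj C; \<And>x. x \<in> X \<Longrightarrow> f x \<in> hom C Y Z\<rbrakk> \<Longrightarrow>
      \<exists>u \<in> hom C P Z. \<forall>x \<in> X. u \<cdot> copy_at C T p q Y (pt X x) = f x"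
    "\<lbrakk>u \<in> hom C P Z; v \<in> hom C P Z;
      \<And>x. x \<in> X \<Longrightarrow> u \<cdot> copy_at C T p q Y (pt X x) = v \<cdot> copy_at C T p q Y (pt X x)\<rbrakk> \<Longrightarrow> u = v"
proof -
  note hP = product_homs[OF P]
  note Y = hP(4)
  note cp = copy_at[OF P pt[OF X]]
  note tp = terminal_product[OF Y]
  have ex: "\<exists>H P' p' q' ev. is_exponential C Y Z H P' p' q' ev" if "Z \<in> Obj C" for Z
    using ccc Y that by (simp add: cartesian_closed_def)
  \<comment> \<open>Naturality of transposition: restricting to the copy at \<open>x\<close> the map
    that \<open>g\<close> transposes to amounts to composing \<open>g\<close> with the point
    \<open>x\<close>. This carries both claims over to \<open>H\<close>, where
    \<open>pt_coproduct\<close> applies.\<close>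
  have tr: "(ev \<cdot> pairing C p' q' (g \<cdot> p) q) \<cdot> copy_at C T p q Y (pt X x) =
       ev \<cdot> pairing C p' q' ((g \<cdot> pt X x) \<cdot> bang C T Y) (Ident C Y)"
    if e: "is_exponential C Y Z H P' p' q' ev" and g: "g \<in> hom C (fobj F X) H" and x: "x \<in> X" for H P' p' q' ev g x Z
  proof -
    have P': "is_product C H Y P' p' q'" and ev: "ev \<in> hom C P' Z" using e by (auto simp: is_exponential_def)
    note gp = Comp_in_hom[OF hP(1) g]
    note w = product_pairing[OF P' gp hP(2)]
    note c = cp[OF x]
    note gx = Comp_in_hom[OF pt[OF X x] g]
    note w' = product_pairing[OF P' Comp_in_hom[OF bang(1)[OF T Y] gx] Ident_in_hom[OF Y]]
    note h' = product_homs[OF P']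
    have "pairing C p' q' (g \<cdot> p) q \<cdot> copy_at C T p q Y (pt X x) =
       pairing C p' q' ((g \<cdot> pt X x) \<cdot> bang C T Y) (Ident C Y)"
    proof (rule product_ext[OF P' Comp_in_hom[OF c(1) w(1)] w'(1)])
      show "p' \<cdot> pairing C p' q' (g \<cdot> p) q \<cdot> copy_at C T p q Y (pt X x) =
         p' \<cdot> pairing C p' q' ((g \<cdot> pt X x) \<cdot> bang C T Y) (Ident C Y)"
        using Comp_assoc[OF c(1) w(1) h'(1)] Comp_assoc[OF c(1) hP(1) g] w(2) w'(2) c(2)
          Comp_assoc[OF bang(1)[OF T Y] pt[OF X x] g] by simp
      show "q' \<cdot> pairing C p' q' (g \<cdot> p) q \<cdot> copy_at C T p q Y (pt X x) =
         q' \<cdot> pairing C p' q' ((g \<cdot> pt X x) \<cdot> bang C T Y) (Ident C Y)"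
        using Comp_assoc[OF c(1) w(1) h'(2)] w(3) w'(3) c(3) by simp
    qed
    then show ?thesis using Comp_assoc[OF c(1) w(1) ev] by simp
  qed
  have cls: "ev \<cdot> pairing C p' q' (g \<cdot> p) q \<in> hom C P Z"
    if e: "is_exponential C Y Z H P' p' q' ev" and g: "g \<in> hom C (fobj F X) H" for H P' p' q' ev g Z
  proof -
    have P': "is_product C H Y P' p' q'" and ev: "ev \<in> hom C P' Z" using e by (auto simp: is_exponential_def)
    show ?thesis by (rule Comp_in_hom[OF product_pairing(1)[OF P' Comp_in_hom[OF hP(1) g] hP(2)] ev])
  qed
  show "\<exists>u \<in> hom C P Z. \<forall>x \<in> X. u \<cdot> copy_at C T p q Y (pt X x) = f x"
    if Z: "Z \<in> Obj C" and f: "\<And>x. x \<in> X \<Longrightarrow> f x \<in> hom C Y Z"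
  proof -
    obtain H P' p' q' ev where e: "is_exponential C Y Z H P' p' q' ev" using ex[OF Z] by blast
    \<comment> \<open>Each \<open>f x\<close> becomes a point of \<open>H\<close>; these points are
      assembled into one map on \<open>F X\<close>, which is transposed back.\<close>
    have "\<exists>g. g \<in> hom C T H \<and> ev \<cdot> pairing C p' q' (g \<cdot> bang C T Y) (Ident C Y) = f x" if "x \<in> X" for x
      using e tp f[OF that] unfolding is_exponential_def by blast
    then obtain g where g: "\<And>x. x \<in> X \<Longrightarrow> g x \<in> hom C T H"
      "\<And>x. x \<in> X \<Longrightarrow> ev \<cdot> pairing C p' q' (g x \<cdot> bang C T Y) (Ident C Y) = f x" by metis
    have "H \<in> Obj C" using e by (simp add: is_exponential_def is_product_def)
    then obtain k where k: "k \<in> hom C (fobj F X) H" "\<And>x. x \<in> X \<Longrightarrow> k \<cdot> pt X x = g x"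
      using pt_coproduct[OF X, of H g] g(1) by metis
    show ?thesis
      using tr[OF e k(1)] k(2) g(2) cls[OF e k(1)]
      by (intro bexI[of _ "ev \<cdot> pairing C p' q' (k \<cdot> p) q"]) auto
  qed
  show "u = v"
    if u: "u \<in> hom C P Z" and v: "v \<in> hom C P Z"
      and uv: "\<And>x. x \<in> X \<Longrightarrow> u \<cdot> copy_at C T p q Y (pt X x) = v \<cdot> copy_at C T p q Y (pt X x)"
  proof -
    obtain H P' p' q' ev where e: "is_exponential C Y Z H P' p' q' ev" using ex hom_Obj(2)[OF u] by blast
    have H: "H \<in> Obj C" using e by (simp add: is_exponential_def is_product_def)
    have "\<exists>g. g \<in> hom C (fobj F X) H \<and> ev \<cdot> pairing C p' q' (g \<cdot> p) q = w" if "w \<in> hom C P Z" for w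
      using e P that unfolding is_exponential_def by blast
    then obtain g h where g: "g \<in> hom C (fobj F X) H" "ev \<cdot> pairing C p' q' (g \<cdot> p) q = u"
      and h: "h \<in> hom C (fobj F X) H" "ev \<cdot> pairing C p' q' (h \<cdot> p) q = v" using u v by metis
    \<comment> \<open>Both composites transpose to the common restriction of \<open>u\<close> and
      \<open>v\<close> to the copy at \<open>x\<close>, and transposition is injective.\<close>
    have "g \<cdot> pt X x = h \<cdot> pt X x" if x: "x \<in> X" for x
    proof -
      note gx = Comp_in_hom[OF pt[OF X x] g(1)] and hx = Comp_in_hom[OF pt[OF X x] h(1)]
      have "ev \<cdot> pairing C p' q' ((g \<cdot> pt X x) \<cdot> bang C T Y) (Ident C Y) =
          ev \<cdot> pairing C p' q' ((h \<cdot> pt X x) \<cdot> bang C T Y) (Ident C Y)"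
        using tr[OF e g(1) x] tr[OF e h(1) x] g(2) h(2) uv[OF x] by simp
      moreover have "\<exists>!k. k \<in> hom C T H \<and> ev \<cdot> pairing C p' q' (k \<cdot> bang C T Y) (Ident C Y) =
          u \<cdot> copy_at C T p q Y (pt X x)"
        using e tp Comp_in_hom[OF cp(1)[OF x] u] unfolding is_exponential_def by blast
      ultimately show ?thesis using gx hx tr[OF e g(1) x] g(2) by metis
    qed
    then have "g = h"
      using pt_coproduct[OF X H, of "\<lambda>x. h \<cdot> pt X x"] Comp_in_hom[OF pt[OF X] h(1)] g(1) h(1) by metis
    then show ?thesis using g h by simp
  qed
qed

end

section \<open>The product with the internal free-living arrow\<close>

context category begin

definition map2 :: "('o, 'm) ifun \<Rightarrow> 'm" where
  "map2 H = pairing C (pr1 (fcod H)) (pr2 (fcod H)) (map1 H \<cdot> pr1 (fdom H)) (map1 H \<cdot> pr2 (fdom H))"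

lemma map2:
  assumes H: "is_ifun C H"
  shows "map2 H \<in> hom C (Ob2 (fdom H)) (Ob2 (fcod H))" "pr1 (fcod H) \<cdot> map2 H = map1 H \<cdot> pr1 (fdom H)"
    "pr2 (fcod H) \<cdot> map2 H = map1 H \<cdot> pr2 (fdom H)"
proof -
  note h = ifun[OF H]
  note HA = icat_homs[OF h(1)] and HB = icat_homs[OF h(2)]
  note e = ifun_elt[OF H HA(5)] ifun_elt[OF H HA(6)]
  have "tgt (fcod H) \<cdot> map1 H \<cdot> pr1 (fdom H) = src (fcod H) \<cdot> map1 H \<cdot> pr2 (fdom H)"
    using e pullback_homs(5)[OF HA(7)] by simp
  then show "map2 H \<in> hom C (Ob2 (fdom H)) (Ob2 (fcod H))" "pr1 (fcod H) \<cdot> map2 H = map1 H \<cdot> pr1 (fdom H)"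
    "pr2 (fcod H) \<cdot> map2 H = map1 H \<cdot> pr2 (fdom H)"
    unfolding map2_def using pairing_pullback(1-3)[OF HB(7), unfolded HB(8,9), OF e(1,4)] by auto
qed

text \<open>Pullbacks commute with products: a pair of composable pairs is a composable pair of
  pairs. This lets \<open>copies_coproduct\<close> split \<open>Ob2\<close> as well.\<close>

lemma Ob2_product:
  assumes p: "is_ifun C p" "fdom p = P" "fcod p = A" and q: "is_ifun C q" "fdom q = P" "fcod q = B"
    and P0: "is_product C (Ob0 A) (Ob0 B) (Ob0 P) (map0 p) (map0 q)"
    and P1: "is_product C (Ob1 A) (Ob1 B) (Ob1 P) (map1 p) (map1 q)"
  shows "is_product C (Ob2 A) (Ob2 B) (Ob2 P) (map2 p) (map2 q)"
  unfolding is_product_def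
proof (intro conjI ballI)
  note ip = ifun[OF p(1), unfolded p(2,3)] and iq = ifun[OF q(1), unfolded q(2,3)]
  note HP = icat_homs[OF ip(1)] and HA = icat_homs[OF ip(2)] and HB = icat_homs[OF iq(2)]
  note mp = map2[OF p(1), unfolded p(2,3)] and mq = map2[OF q(1), unfolded q(2,3)]
  show "Ob2 A \<in> Obj C" "Ob2 B \<in> Obj C" "Ob2 P \<in> Obj C" "map2 p \<in> hom C (Ob2 P) (Ob2 A)" "map2 q \<in> hom C (Ob2 P) (Ob2 B)"
    using mp mq hom_Obj by blast+
  fix X a b assume a: "a \<in> hom C X (Ob2 A)" and b: "b \<in> hom C X (Ob2 B)"
  note a1 = Comp_in_hom[OF a HA(5)] and a2 = Comp_in_hom[OF a HA(6)]
    and b1 = Comp_in_hom[OF b HB(5)] and b2 = Comp_in_hom[OF b HB(6)]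
  have ea: "tgt A \<cdot> pr1 A \<cdot> a = src A \<cdot> pr2 A \<cdot> a" and eb: "tgt B \<cdot> pr1 B \<cdot> b = src B \<cdot> pr2 B \<cdot> b"
    using Comp_assoc[OF a HA(5,2)] Comp_assoc[OF a HA(6,1)] Comp_assoc[OF b HB(5,2)] Comp_assoc[OF b HB(6,1)]
      pullback_homs(5)[OF HA(7)] pullback_homs(5)[OF HB(7)] by simp_all
  define u where "u = pairing C (map1 p) (map1 q) (pr1 A \<cdot> a) (pr1 B \<cdot> b)"
  define v where "v = pairing C (map1 p) (map1 q) (pr2 A \<cdot> a) (pr2 B \<cdot> b)"
  note u = product_pairing[OF P1 a1 b1, folded u_def] and v = product_pairing[OF P1 a2 b2, folded v_def]
  note pe = ifun_elt[OF p(1), unfolded p(2,3)] and qe = ifun_elt[OF q(1), unfolded q(2,3)]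
  have uv: "tgt P \<cdot> u = src P \<cdot> v"
    by (rule product_ext[OF P0 Comp_in_hom[OF u(1) HP(2)] Comp_in_hom[OF v(1) HP(1)]])
      (use pe[OF u(1)] pe[OF v(1)] qe[OF u(1)] qe[OF v(1)] u v ea eb in \<open>simp_all\<close>)
  define w where "w = pairing C (pr1 P) (pr2 P) u v"
  note w = pairing_pullback(1-3)[OF HP(7), unfolded HP(8,9), OF u(1) v(1) uv, folded w_def]
  have pr: "pr1 A \<cdot> map2 p \<cdot> x = map1 p \<cdot> pr1 P \<cdot> x" "pr2 A \<cdot> map2 p \<cdot> x = map1 p \<cdot> pr2 P \<cdot> x"
    "pr1 B \<cdot> map2 q \<cdot> x = map1 q \<cdot> pr1 P \<cdot> x" "pr2 B \<cdot> map2 q \<cdot> x = map1 q \<cdot> pr2 P \<cdot> x"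
    if x: "x \<in> hom C X (Ob2 P)" for x
    using mp mq Comp_assoc[OF x mp(1) HA(5)] Comp_assoc[OF x mp(1) HA(6)] Comp_assoc[OF x mq(1) HB(5)]
      Comp_assoc[OF x mq(1) HB(6)] Comp_assoc[OF x HP(5) ip(4)] Comp_assoc[OF x HP(6) ip(4)]
      Comp_assoc[OF x HP(5) iq(4)] Comp_assoc[OF x HP(6) iq(4)] by simp_all
  show "\<exists>!w. w \<in> hom C X (Ob2 P) \<and> map2 p \<cdot> w = a \<and> map2 q \<cdot> w = b"
  proof (intro ex1I[of _ w] conjI w(1))
    show "map2 p \<cdot> w = a"
      by (rule pullback_ext[OF HA(7) Comp_in_hom[OF w(1) mp(1)] a]) (use pr[OF w(1)] w u v in simp_all)
    show "map2 q \<cdot> w = b"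
      by (rule pullback_ext[OF HB(7) Comp_in_hom[OF w(1) mq(1)] b]) (use pr[OF w(1)] w u v in simp_all)
    fix x assume x: "x \<in> hom C X (Ob2 P) \<and> map2 p \<cdot> x = a \<and> map2 q \<cdot> x = b"
    then have x': "x \<in> hom C X (Ob2 P)" by simp
    note x1 = Comp_in_hom[OF x' HP(5)] and x2 = Comp_in_hom[OF x' HP(6)]
    have "pr1 P \<cdot> x = u" by (rule product_ext[OF P1 x1 u(1)]) (use pr[OF x'] x u in simp_all)
    moreover have "pr2 P \<cdot> x = v" by (rule product_ext[OF P1 x2 v(1)]) (use pr[OF x'] x v in simp_all)
    ultimately show "x = w" using w by (intro pullback_ext[OF HP(7) x' w(1)]) simp_all
  qed
qed

end

text \<open>By \<open>e\<close> the map \<open>m\<close> is the product of \<open>n\<close> and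
  \<open>h\<close>, so it moves the copy over \<open>c\<close> to the copy over
  \<open>n \<cdot> c\<close> and acts as \<open>h\<close> inside it. All six structure equations of
  \<open>cylinder\<close> are instances.\<close>

lemma (in finite_points) copy_at_natural:
  assumes P: "is_product C B Y P p q" and P': "is_product C B' Y' P' p' q'"
    and m: "m \<in> hom C P P'" and n: "n \<in> hom C B B'" and h: "h \<in> hom C Y Y'"
    and e: "p' \<cdot> m = n \<cdot> p" "q' \<cdot> m = h \<cdot> q" and c: "c \<in> hom C T B"
  shows "m \<cdot> copy_at C T p q Y c = copy_at C T p' q' Y' (n \<cdot> c) \<cdot> h"
proof -
  note c' = Comp_in_hom[OF c n]
  note k = copy_at[OF P c] and k' = copy_at[OF P' c'] and hP = product_homs[OF P] and hP' = product_homs[OF P']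
  show ?thesis
  proof (rule product_ext[OF P' Comp_in_hom[OF k(1) m] Comp_in_hom[OF h k'(1)]])
    show "p' \<cdot> m \<cdot> copy_at C T p q Y c = p' \<cdot> copy_at C T p' q' Y' (n \<cdot> c) \<cdot> h"
      using Comp_assoc[OF k(1) m hP'(1)] Comp_assoc[OF h k'(1) hP'(1)] Comp_assoc[OF k(1) hP(1) n] e(1) k(2) k'(2)
        Comp_assoc[OF h bang(1)[OF T hP'(4)] c'] bang_comp[OF T h] Comp_assoc[OF bang(1)[OF T hP(4)] c n]
      by simp
    show "q' \<cdot> m \<cdot> copy_at C T p q Y c = q' \<cdot> copy_at C T p' q' Y' (n \<cdot> c) \<cdot> h"
      using Comp_assoc[OF k(1) m hP'(2)] Comp_assoc[OF h k'(1) hP'(2)] e(2) k(3) k'(3)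
        Comp_assoc[OF k(1) hP(2) h] Comp_Ident[OF h] Ident_Comp[OF h] by simp
  qed
qed

section \<open>The internal free-living arrow through its points\<close>

lemma bool_chains_simps:
  "[i] \<in> bool_chains 1" "[i, k] \<in> bool_chains 2 \<longleftrightarrow> i \<le> k" "[i, k, l] \<in> bool_chains 3 \<longleftrightarrow> i \<le> k \<and> k \<le> l"
  by (auto simp: bool_chains_def)

lemma bool_chains_cases:
  "xs \<in> bool_chains 1 \<Longrightarrow> \<exists>i. xs = [i]"
  "xs \<in> bool_chains 2 \<Longrightarrow> \<exists>i k. xs = [i, k] \<and> i \<le> k"
  "xs \<in> bool_chains 3 \<Longrightarrow> \<exists>i k l. xs = [i, k, l] \<and> i \<le> k \<and> k \<le> l"
  by (auto simp: bool_chains_def numeral_eq_Suc length_Suc_conv simp del: le_bool_def)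

lemma finite_bool_chains: "finite (bool_chains n)"
  by (rule finite_subset[OF _ finite_lists_length_eq[of UNIV n]]) (auto simp: bool_chains_def)

text \<open>The empty list is the chain of length zero, so the singleton behind the points is
  \<open>bool_chains 0\<close>.\<close>

locale internal_arrow = finite_points C F "[]"
  for C :: "('o, 'm, 'z) cat_scheme" (structure)
    and F :: "(bool list set, bool list set \<times> bool list set \<times> (bool list \<Rightarrow> bool list), 'o, 'm) funct" +
  assumes pbs: "has_pullbacks C" and ccc: "cartesian_closed C"
begin

abbreviation two :: "('o, 'm) icat" where "two \<equiv> icat_image F two_FinSet"

abbreviation pt0 :: "bool \<Rightarrow> 'm" where "pt0 i \<equiv> pt (bool_chains 1) [i]"
abbreviation pt1 :: "bool \<Rightarrow> bool \<Rightarrow> 'm" where "pt1 i k \<equiv> pt (bool_chains 2) [i, k]"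
abbreviation pt2 :: "bool \<Rightarrow> bool \<Rightarrow> bool \<Rightarrow> 'm" where "pt2 i k l \<equiv> pt (bool_chains 3) [i, k, l]"

lemma two_Ob: "Ob0 two = fobj F (bool_chains 1)" "Ob1 two = fobj F (bool_chains 2)" "Ob2 two = fobj F (bool_chains 3)"
  by (simp_all add: icat_image_def two_FinSet_def)

lemma pt_homs:
  "pt0 i \<in> hom C T (Ob0 two)" "i \<le> k \<Longrightarrow> pt1 i k \<in> hom C T (Ob1 two)"
  "\<lbrakk>i \<le> k; k \<le> l\<rbrakk> \<Longrightarrow> pt2 i k l \<in> hom C T (Ob2 two)"
  unfolding two_Ob using pt[OF finite_bool_chains] bool_chains_simps by simp_all

text \<open>By \<open>F_pt\<close> the structure maps act on points as the functions on chains act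
  on lists.\<close>

lemma two_pt:
  "i \<le> k \<Longrightarrow> src two \<cdot> pt1 i k = pt0 i" "i \<le> k \<Longrightarrow> tgt two \<cdot> pt1 i k = pt0 k" "unit_arr two \<cdot> pt0 i = pt1 i i"
  "\<lbrakk>i \<le> k; k \<le> l\<rbrakk> \<Longrightarrow> pr1 two \<cdot> pt2 i k l = pt1 i k" "\<lbrakk>i \<le> k; k \<le> l\<rbrakk> \<Longrightarrow> pr2 two \<cdot> pt2 i k l = pt1 k l"
  "\<lbrakk>i \<le> k; k \<le> l\<rbrakk> \<Longrightarrow> cmp two \<cdot> pt2 i k l = pt1 i l"
proof -
  have 1: "(\<lambda>xs \<in> bool_chains 2. [xs ! 0]) \<in> bool_chains 2 \<rightarrow>\<^sub>E bool_chains 1"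
    "(\<lambda>xs \<in> bool_chains 2. [xs ! 1]) \<in> bool_chains 2 \<rightarrow>\<^sub>E bool_chains 1"
    "(\<lambda>xs \<in> bool_chains 1. [xs ! 0, xs ! 0]) \<in> bool_chains 1 \<rightarrow>\<^sub>E bool_chains 2"
    "(\<lambda>xs \<in> bool_chains 3. [xs ! 0, xs ! 1]) \<in> bool_chains 3 \<rightarrow>\<^sub>E bool_chains 2"
    "(\<lambda>xs \<in> bool_chains 3. [xs ! 1, xs ! 2]) \<in> bool_chains 3 \<rightarrow>\<^sub>E bool_chains 2"
    "(\<lambda>xs \<in> bool_chains 3. [xs ! 0, xs ! 2]) \<in> bool_chains 3 \<rightarrow>\<^sub>E bool_chains 2"
    using bool_chains_simps by (auto dest!: bool_chains_cases)
  note f = F_pt[OF finite_bool_chains finite_bool_chains]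
  have ch: "i \<le> k \<Longrightarrow> [i, k] \<in> bool_chains 2" "\<lbrakk>i \<le> k; k \<le> l\<rbrakk> \<Longrightarrow> [i, k, l] \<in> bool_chains 3" for i k l
    using bool_chains_simps by auto
  show "i \<le> k \<Longrightarrow> src two \<cdot> pt1 i k = pt0 i" "i \<le> k \<Longrightarrow> tgt two \<cdot> pt1 i k = pt0 k" "unit_arr two \<cdot> pt0 i = pt1 i i"
    "\<lbrakk>i \<le> k; k \<le> l\<rbrakk> \<Longrightarrow> pr1 two \<cdot> pt2 i k l = pt1 i k" "\<lbrakk>i \<le> k; k \<le> l\<rbrakk> \<Longrightarrow> pr2 two \<cdot> pt2 i k l = pt1 k l"
    "\<lbrakk>i \<le> k; k \<le> l\<rbrakk> \<Longrightarrow> cmp two \<cdot> pt2 i k l = pt1 i l"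
    unfolding icat_image_def two_FinSet_def icat.simps
    using f[OF 1(1) ch(1)] f[OF 1(2) ch(1)] f[OF 1(3) bool_chains_simps(1)] f[OF 1(4) ch(2)] f[OF 1(5) ch(2)]
      f[OF 1(6) ch(2)] ch bool_chains_simps(1) by simp_all
qed

definition cyl0 :: "('o, 'm) icat \<Rightarrow> ('o, 'm) ifun \<Rightarrow> ('o, 'm) ifun \<Rightarrow> bool \<Rightarrow> 'm" where
  "cyl0 A p q i = copy_at C T (map0 p) (map0 q) (Ob0 A) (pt0 i)"

definition cyl1 :: "('o, 'm) icat \<Rightarrow> ('o, 'm) ifun \<Rightarrow> ('o, 'm) ifun \<Rightarrow> bool \<Rightarrow> bool \<Rightarrow> 'm" where
  "cyl1 A p q i k = copy_at C T (map1 p) (map1 q) (Ob1 A) (pt1 i k)"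

definition cyl2 :: "('o, 'm) icat \<Rightarrow> ('o, 'm) ifun \<Rightarrow> ('o, 'm) ifun \<Rightarrow> bool \<Rightarrow> bool \<Rightarrow> bool \<Rightarrow> 'm" where
  "cyl2 A p q i k l = copy_at C T (map2 p) (map2 q) (Ob2 A) (pt2 i k l)"

lemma has_products: "has_products C"
  using ccc by (simp add: cartesian_closed_def)

text \<open>Each structure map of \<open>S\<close> is the product of the one of \<open>two\<close>
  with the one of \<open>A\<close>. So \<open>copy_at_natural\<close> together with
  \<open>two_pt\<close> computes it on copies, and \<open>copies_coproduct\<close> supplies
  extension and joint epimorphy.\<close>

lemma product_cylinder:
  assumes P: "is_product (ICat C) two A S p q"
  shows "cylinder C A S (cyl0 A p q) (cyl1 A p q) (cyl2 A p q)"
proof -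
  interpret I: category "ICat C" by (rule ICat_category[OF pbs])
  have p: "is_ifun C p" "fdom p = S" "fcod p = two" and q: "is_ifun C q" "fdom q = S" "fcod q = A"
    using I.product_homs(1,2)[OF P] by (simp_all add: ICat_hom)
  note ip = ifun[OF p(1), unfolded p(2,3)] and iq = ifun[OF q(1), unfolded q(2,3)]
  note HS = icat_homs[OF ip(1)] and HI = icat_homs[OF ip(2)] and HA = icat_homs[OF iq(2)]
  note P0 = icat_product_components(1)[OF pbs has_products P] and P1 = icat_product_components(2)[OF pbs has_products P]
  note P2 = Ob2_product[OF p q P0 P1]
  note mp = map2[OF p(1), unfolded p(2,3)] and mq = map2[OF q(1), unfolded q(2,3)]
  let ?j0 = "cyl0 A p q" and ?j1 = "cyl1 A p q" and ?j2 = "cyl2 A p q"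
  note j0 = copy_at[OF P0 pt_homs(1), folded cyl0_def] and j1 = copy_at[OF P1 pt_homs(2), folded cyl1_def]
    and j2 = copy_at[OF P2 pt_homs(3), folded cyl2_def]
  \<comment> \<open>Preservation of composition restated with \<open>map2\<close>, the form in which
    \<open>cmp\<close> fits \<open>copy_at_natural\<close>.\<close>
  have cm: "cmp (fcod H) \<cdot> map2 H = map1 H \<cdot> cmp (fdom H)" if H: "is_ifun C H" for H
    using cmp_eq_icomp[OF ifun(2)[OF H] map2(1)[OF H]] map2(2,3)[OF H] H by (simp add: is_ifun_def Let_def)
  note fin = finite_bool_chains
  note C0 = copies_coproduct[OF ccc fin P0[unfolded two_Ob]]
    and C1 = copies_coproduct[OF ccc fin P1[unfolded two_Ob]]
    and C2 = copies_coproduct[OF ccc fin P2[unfolded two_Ob]]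
  show ?thesis
  proof unfold_locales
    show "has_pullbacks C" "is_icat C A" "is_icat C S" using pbs ip(1) iq(2) by auto
    show "?j0 i \<in> hom C (Ob0 A) (Ob0 S)" for i by (rule j0)
    show "?j1 i k \<in> hom C (Ob1 A) (Ob1 S)" if "i \<le> k" for i k using that by (rule j1)
    show "?j2 i k l \<in> hom C (Ob2 A) (Ob2 S)" if "i \<le> k" "k \<le> l" for i k l using that by (rule j2)
    show "src S \<cdot> ?j1 i k = ?j0 i \<cdot> src A" if "i \<le> k" for i k
      using copy_at_natural[OF P1 P0 HS(1) HI(1) HA(1) ip(5)[symmetric] iq(5)[symmetric] pt_homs(2)[OF that]] two_pt(1)[OF that]
      by (simp add: cyl1_def cyl0_def)
    show "tgt S \<cdot> ?j1 i k = ?j0 k \<cdot> tgt A" if "i \<le> k" for i k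
      using copy_at_natural[OF P1 P0 HS(2) HI(2) HA(2) ip(6)[symmetric] iq(6)[symmetric] pt_homs(2)[OF that]] two_pt(2)[OF that]
      by (simp add: cyl1_def cyl0_def)
    show "unit_arr S \<cdot> ?j0 i = ?j1 i i \<cdot> unit_arr A" for i
      using copy_at_natural[OF P0 P1 HS(3) HI(3) HA(3) ip(7)[symmetric] iq(7)[symmetric] pt_homs(1)] two_pt(3)
      by (simp add: cyl0_def cyl1_def)
    show "pr1 S \<cdot> ?j2 i k l = ?j1 i k \<cdot> pr1 A" if "i \<le> k" "k \<le> l" for i k l
      using copy_at_natural[OF P2 P1 HS(5) HI(5) HA(5) mp(2)[symmetric] mq(2)[symmetric] pt_homs(3)[OF that]] two_pt(4)[OF that]
      by (simp add: cyl2_def cyl1_def)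
    show "pr2 S \<cdot> ?j2 i k l = ?j1 k l \<cdot> pr2 A" if "i \<le> k" "k \<le> l" for i k l
      using copy_at_natural[OF P2 P1 HS(6) HI(6) HA(6) mp(3)[symmetric] mq(3)[symmetric] pt_homs(3)[OF that]] two_pt(5)[OF that]
      by (simp add: cyl2_def cyl1_def)
    show "cmp S \<cdot> ?j2 i k l = ?j1 i l \<cdot> cmp A" if "i \<le> k" "k \<le> l" for i k l
      using copy_at_natural[OF P2 P1 HS(4) HI(4) HA(4) cm[OF p(1), unfolded p(2,3), symmetric] cm[OF q(1), unfolded q(2,3), symmetric]
            pt_homs(3)[OF that]] two_pt(6)[OF that]
      by (simp add: cyl2_def cyl1_def)
    show "\<exists>u \<in> hom C (Ob0 S) Z. \<forall>i. u \<cdot> ?j0 i = f i" if f: "\<And>i. f i \<in> hom C (Ob0 A) Z" for f Z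
    proof -
      obtain u where "u \<in> hom C (Ob0 S) Z"
        "\<forall>x \<in> bool_chains 1. u \<cdot> copy_at C T (map0 p) (map0 q) (Ob0 A) (pt (bool_chains 1) x) = f (x ! 0)"
        using C0(1)[of Z "\<lambda>x. f (x ! 0)"] f hom_Obj(2)[OF f] by blast
      then show ?thesis using bool_chains_simps(1) by (intro bexI[of _ u]) (auto simp: cyl0_def)
    qed
    show "\<exists>u \<in> hom C (Ob1 S) Z. \<forall>i k. i \<le> k \<longrightarrow> u \<cdot> ?j1 i k = g i k"
      if g: "\<And>i k. i \<le> k \<Longrightarrow> g i k \<in> hom C (Ob1 A) Z" for g Z
    proof -
      have "g (x ! 0) (x ! 1) \<in> hom C (Ob1 A) Z" if "x \<in> bool_chains 2" for x
        using bool_chains_cases(2)[OF that] g by auto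
      then obtain u where "u \<in> hom C (Ob1 S) Z"
        "\<forall>x \<in> bool_chains 2. u \<cdot> copy_at C T (map1 p) (map1 q) (Ob1 A) (pt (bool_chains 2) x) = g (x ! 0) (x ! 1)"
        using C1(1)[of Z "\<lambda>x. g (x ! 0) (x ! 1)"] hom_Obj(2)[OF g[OF order_refl]] by blast
      then show ?thesis using bool_chains_simps(2) by (intro bexI[of _ u]) (auto simp: cyl1_def)
    qed
    show "u = v" if "u \<in> hom C (Ob0 S) Z" "v \<in> hom C (Ob0 S) Z" "\<And>i. u \<cdot> ?j0 i = v \<cdot> ?j0 i" for u v Z
      by (rule C0(2)[OF that(1,2)]) (use that(3) in \<open>auto simp: cyl0_def simp del: One_nat_def dest!: bool_chains_cases(1)\<close>)
    show "u = v" if "u \<in> hom C (Ob1 S) Z" "v \<in> hom C (Ob1 S) Z" "\<And>i k. i \<le> k \<Longrightarrow> u \<cdot> ?j1 i k = v \<cdot> ?j1 i k" for u v Z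
      by (rule C1(2)[OF that(1,2)]) (use that(3) in \<open>auto simp: cyl1_def dest!: bool_chains_cases(2)\<close>)
    show "u = v" if "u \<in> hom C (Ob2 S) Z" "v \<in> hom C (Ob2 S) Z"
      "\<And>i k l. \<lbrakk>i \<le> k; k \<le> l\<rbrakk> \<Longrightarrow> u \<cdot> ?j2 i k l = v \<cdot> ?j2 i k l" for u v Z
      by (rule C2(2)[OF that(1,2)]) (use that(3) in \<open>auto simp: cyl2_def dest!: bool_chains_cases(3)\<close>)
  qed
qed

lemma two_product_copower:
  assumes P: "is_product (ICat C) two A S p q"
  shows "is_copower (ICat C) walking_arrow A S"
  using two_category.is_copower_copower_cell[OF two_category_ICat[OF pbs]
      cylinder.copower_cell_gen[OF product_cylinder[OF P]]] .

text \<open>Given \<open>exponential_power\<close>, what remains is the naturality in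
  \<open>A\<close> of the universal 2-cell. It holds because \<open>h\<close> preserves identities,
  and these are the components of that cell.\<close>

lemma two_exponential_power:
  assumes exp: "is_exponential (ICat C) two B H P p q ev"
  shows "is_power (ICat C) walking_arrow B H"
proof -
  interpret I: two_category "ICat C" by (rule two_category_ICat[OF pbs])
  have two: "is_icat C two" using exp by (simp add: is_exponential_def is_product_def ICat_simps[OF pbs])
  have "\<exists>S r s. is_product (ICat C) A two S r s" if "A \<in> Obj (ICat C)" for A
    using icat_product_exists[OF pbs has_products _ two, of A] that unfolding ICat_simps[OF pbs] by blast
  then obtain S r s where prod: "\<And>A. A \<in> Obj (ICat C) \<Longrightarrow> is_product (ICat C) A two (S A) (r A) (s A)"
    by metis
  \<comment> \<open>In the exponential \<open>two\<close> is the right factor, in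
    \<open>product_cylinder\<close> the left one.\<close>
  note prod' = I.product_swap[OF prod]
  note cyl = product_cylinder[OF prod']
  define i where "i A = cylinder.inc A (S A) (cyl0 A (s A) (r A)) (cyl1 A (s A) (r A))" for A
  define \<sigma> where "\<sigma> A = cylinder.gen C A (S A) (cyl0 A (s A) (r A)) (cyl1 A (s A) (r A))" for A
  show ?thesis
  proof (rule I.exponential_power[OF exp prod, of i \<sigma>])
    show "I.copower_cell A (S A) (i A) (\<sigma> A)" if "A \<in> Obj (ICat C)" for A
      unfolding i_def \<sigma>_def by (rule cylinder.copower_cell_gen[OF cyl[OF that]])
    fix A A' h w
    assume h: "h \<in> hom (ICat C) A A'" and w: "w \<in> hom (ICat C) (S A) (S A')"
      and e: "r A' \<cdot>\<^bsub>ICat C\<^esub> w = h \<cdot>\<^bsub>ICat C\<^esub> r A" "s A' \<cdot>\<^bsub>ICat C\<^esub> w = s A"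
    note A = I.hom_Obj[OF h]
    interpret c: cylinder C A "S A" "cyl0 A (s A) (r A)" "cyl1 A (s A) (r A)" "cyl2 A (s A) (r A)"
      by (rule cyl[OF A(1)])
    interpret c': cylinder C A' "S A'" "cyl0 A' (s A') (r A')" "cyl1 A' (s A') (r A')" "cyl2 A' (s A') (r A')"
      by (rule cyl[OF A(2)])
    have H: "is_ifun C h" "fdom h = A" "fcod h = A'" and W: "is_ifun C w" "fdom w = S A" "fcod w = S A'"
      using h w by (simp_all add: ICat_hom)
    note ih = ifun[OF H(1), unfolded H(2,3)] and iw = ifun[OF W(1), unfolded W(2,3)]
    note HI = icat_homs[OF two]
    note C0 = icat_product_components(1)[OF pbs has_products prod'[OF A(1)]]
        icat_product_components(1)[OF pbs has_products prod'[OF A(2)]]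
      and C1 = icat_product_components(2)[OF pbs has_products prod'[OF A(1)]]
        icat_product_components(2)[OF pbs has_products prod'[OF A(2)]]
    \<comment> \<open>\<open>w\<close> is the product of the identity of \<open>two\<close> with
      \<open>h\<close>. The identity is written out so that the equations have the shape required by
      \<open>copy_at_natural\<close>.\<close>
    have e0: "map0 (r A') \<cdot> map0 w = map0 h \<cdot> map0 (r A)" "map1 (r A') \<cdot> map1 w = map1 h \<cdot> map1 (r A)"
      and e1: "map0 (s A') \<cdot> map0 w = Ident C (Ob0 two) \<cdot> map0 (s A)" "map1 (s A') \<cdot> map1 w = Ident C (Ob1 two) \<cdot> map1 (s A)"
      using e Ident_Comp[OF product_homs(1)[OF C0(1)]] Ident_Comp[OF product_homs(1)[OF C1(1)]]
      by (auto simp: ICat_simps[OF pbs] comp_ifun_def dest: arg_cong[of _ _ map0] arg_cong[of _ _ map1])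
    note i0 = Ident_in_hom[OF HI(12)] and i1 = Ident_in_hom[OF HI(13)]
    have n0: "map0 w \<cdot> cyl0 A (s A) (r A) j = cyl0 A' (s A') (r A') j \<cdot> map0 h" for j
      using copy_at_natural[OF C0 iw(3) i0 ih(3) e1(1) e0(1) pt_homs(1)] Ident_Comp[OF pt_homs(1)]
      by (simp add: cyl0_def)
    have n1: "map1 w \<cdot> cyl1 A (s A) (r A) j k = cyl1 A' (s A') (r A') j k \<cdot> map1 h" if "j \<le> k" for j k
      using copy_at_natural[OF C1 iw(4) i1 ih(4) e1(2) e0(2) pt_homs(2)[OF that]] Ident_Comp[OF pt_homs(2)[OF that]]
      by (simp add: cyl1_def)
    note FT = c.j1[OF c.le_FT] c'.j1[OF c.le_FT]
    have "map1 w \<cdot> cyl1 A (s A) (r A) False True \<cdot> unit_arr A =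
        (cyl1 A' (s A') (r A') False True \<cdot> unit_arr A') \<cdot> map0 h"
      using Comp_assoc[OF c.HA(3) FT(1) iw(4)] n1[OF c.le_FT] Comp_assoc[OF c.HA(3) ih(4) FT(2)] ih(7)
        Comp_assoc[OF ih(3) c'.HA(3) FT(2)] by simp
    moreover have "comp_ifun C w (i A j) = comp_ifun C (i A' j) h" for j
      using n0 n1[OF order_refl] H W by (simp add: comp_ifun_def i_def)
    ultimately show "HComp (ICat C) (id_cell (ICat C) w) (\<sigma> A) = HComp (ICat C) (\<sigma> A') (id_cell (ICat C) h)"
      using ICat_whisker(1)[OF pbs W(1) c.gen_inat] ICat_whisker(2)[OF pbs H(1) c'.gen_inat] H W
      by (simp add: \<sigma>_def i_def)
  qed
qed

end

theorem theorem5p5: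
  fixes E :: "('o, 'm) cat"
    and F :: "(bool list set, bool list set \<times> bool list set \<times> (bool list \<Rightarrow> bool list), 'o, 'm) funct"
  assumes "lextensive E"
    and "cartesian_closed E"
    and "is_functor FinSet E F"
    and "preserves_finite_coproducts FinSet E F"
    and "preserves_terminal FinSet E F"
  shows "(\<forall>\<B> \<in> Obj (ICat E). \<forall>\<H> \<P> p q ev.
            is_exponential (ICat E) (icat_image F two_FinSet) \<B> \<H> \<P> p q ev \<longrightarrow>
            is_power (ICat E) walking_arrow \<B> \<H>) \<and>
         (\<forall>\<A> \<in> Obj (ICat E). \<forall>\<P> p q.
            is_product (ICat E) (icat_image F two_FinSet) \<A> \<P> p q \<longrightarrow>
            is_copower (ICat E) walking_arrow \<A> \<P>)"
proof -
  have E: "category E" "has_pullbacks E"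
    using assms(1) by (simp_all add: lextensive_def extensive_def)
  interpret internal_arrow E F
    using E assms by (intro internal_arrow.intro finite_points.intro finite_points_axioms.intro internal_arrow_axioms.intro)
  show ?thesis using two_exponential_power two_product_copower by blast
qed

end
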